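(* Let $n \ge 8$ with $n \equiv 0 \pmod 4$, let $s$ be an integer with $s^2 \equiv 1 \pmod n$ and $s \not\equiv \pm 1 \pmod n$, let $G = \langle x,y \mid x^2 = y^{n/2},\ y^n = 1,\ yx = xy^s\rangle$, and let $S$ be a sequence over $G$. (a) If $|S| = 2n-1$, then $S$ has no $n$-product-one subsequence if and only if there exist $\alpha,\beta\in G$ and integers $t_1,t_2,t_3$ such that $G \cong \langle \alpha,\beta \mid \alpha^2=\beta^{n/2},\ \beta^n=1,\ \beta\alpha=\alpha\beta^s\rangle$ (i.e. $\alpha,\beta$ generate $G$ and satisfy these defining relations), $\gcd(t_1-t_2,n)=1$, and $S = (\beta^{t_1})^{[n-1]}\cdot(\beta^{t_2})^{[n-1]}\cdot(\alpha\beta^{t_3})$. (b) If $|S| = 3n-1$, then $S$ has no $2n$-product-one subsequence if and only if there exist $\alpha,\beta\in G$ and integers $t_1,t_2,t_3$ such that $G \cong \langle \alpha,\beta \mid \alpha^2=\beta^{n/2},\ \beta^n=1,\ \beta\alpha=\alpha\beta^s\rangle$, $\gcd(t_1-t_2,n)=1$, and $S = (\beta^{t_1})^{[2n-1]}\cdot(\beta^{t_2})^{[n-1]}\cdot(\alpha\beta^{t_3})$. (c) If $|S| = n$, then $S$ is product-one free (equivalently, has no short product-one subsequence) if and only if there exist $\alpha,\beta\in G$ and an integer $t$ such that $G \cong \langle \alpha,\beta \mid \alpha^2=\beta^{n/2},\ \beta^n=1,\ \beta\alpha=\alpha\beta^s\rangle$ and $S = \beta^{[n-1]}\cdot(\a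lpha\beta^{t})$.
   Context: A sequence over a finite group $G$ is a finite unordered list of elements of $G$ with repetition allowed; $|S|$ is its length; $g^{[k]}$ denotes the sequence consisting of $k$ copies of $g$, and $\cdot$ denotes concatenation of sequences. For $S=g_1\cdots g_k$, $\pi(S)$ is the set of products $g_{\tau(1)}\cdots g_{\tau(k)}$ over all permutations $\tau$. $S$ is product-one if $1\in\pi(S)$; an $m$-product-one sequence is a product-one sequence of length $m$; a short product-one sequence is a product-one sequence of length in $[1,\exp(G)]$ (here $\exp(G)=n$, $|G|=2n$); $S$ is product-one free if no nonempty subsequence is product-one. *)

theory Defs
  imports "HOL-Algebra.Algebra" "HOL-Library.Multiset"
begin

text \<open>Sequences over a group G are finite multisets of elements of the carrier.
  A sequence S is product-one if some ordering of its terms has product one.\<close>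

definition list_prod :: "('a, 'b) monoid_scheme \<Rightarrow> 'a list \<Rightarrow> 'a" where
  "list_prod G xs = foldr (\<lambda>a b. a \<otimes>\<^bsub>G\<^esub> b) xs \<one>\<^bsub>G\<^esub>"

definition product_one :: "('a, 'b) monoid_scheme \<Rightarrow> 'a multiset \<Rightarrow> bool" where
  "product_one G S \<longleftrightarrow> (\<exists>xs. mset xs = S \<and> list_prod G xs = \<one>\<^bsub>G\<^esub>)"

definition has_m_product_one_subseq :: "('a, 'b) monoid_scheme \<Rightarrow> nat \<Rightarrow> 'a multiset \<Rightarrow> bool" where
  "has_m_product_one_subseq G m S \<longleftrightarrow> (\<exists>T. T \<subseteq># S \<and> size T = m \<and> product_one G T)"

definition product_one_free :: "('a, 'b) monoid_scheme \<Rightarrow> 'a multiset \<Rightarrow> bool" where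
  "product_one_free G S \<longleftrightarrow> (\<forall>T. T \<subseteq># S \<and> T \<noteq> {#} \<longrightarrow> \<not> product_one G T)"

definition dicyclic_gens :: "('a, 'b) monoid_scheme \<Rightarrow> nat \<Rightarrow> int \<Rightarrow> 'a \<Rightarrow> 'a \<Rightarrow> bool" where
  "dicyclic_gens G n s a b \<longleftrightarrow>
     a \<in> carrier G \<and> b \<in> carrier G \<and> generate G {a, b} = carrier G \<and>
     a [^]\<^bsub>G\<^esub> (2::nat) = b [^]\<^bsub>G\<^esub> (n div 2) \<and>
     b [^]\<^bsub>G\<^esub> n = \<one>\<^bsub>G\<^esub> \<and>
     b \<otimes>\<^bsub>G\<^esub> a = a \<otimes>\<^bsub>G\<^esub> (b [^]\<^bsub>G\<^esub> s)"

end

theory Submission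
  imports Defs
begin

text \<open>Let \<open>H\<close> be the cyclic subgroup generated by \<open>y\<close> and \<open>N\<close> its complement. Sequences with at most one
  term in \<open>N\<close> are governed by the Erdos--Ginzburg--Ziv theorem and its inverse for cyclic groups, which
  follow from the Moser--Scherk bound \<open>|A + B| \<ge> |A| + |B| - 1\<close> for sets in which \<open>0\<close> is a sum in one
  way only.

  If a sequence has two terms in \<open>N\<close> and \<open>n div 2\<close> does not divide \<open>s - 1\<close>, then some \<open>m\<close>, either \<open>4\<close> or
  twice an odd prime, divides both \<open>s + 1\<close> and \<open>n div 2\<close>, so that the quotient by the \<open>m\<close>-th powers in \<open>H\<close> is
  dihedral. There every sequence of length \<open>2 m - 1\<close> with two terms outside the rotations has a
  product-one subsequence of length \<open>m\<close>; peeling off such blocks and applying the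
  Erdos--Ginzburg--Ziv theorem to their products yields a product-one subsequence of length \<open>n\<close>.

  If \<open>s = 1 + n div 2\<close> modulo \<open>n\<close>, the commutator subgroup has order two and all elements square into the
  cyclic group \<open>Z\<close> of even powers of \<open>y\<close>. Pairing terms in equal cosets of \<open>Z\<close> gives a sequence over \<open>Z\<close>
  to which the inverse theorem applies, and the freedom to flip a product by the commutator leaves only
  the sequences in the statement.

  The assertions on lengths \<open>2 n\<close> and on product-one free sequences reduce to the one on length \<open>n\<close>.\<close>
section \<open>Zero-sum sequences over cyclic groups\<close>

text \<open>For \<open>n = q * m\<close> the identity
  \<open>(2 * q - 2) * m + (2 * m - 1) = 2 * n - 1\<close> fixes the plan: a quotient that handles
  length \<open>2 * m - 1\<close> yields the \<open>2 * q - 1\<close> blocks that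
  Erdos--Ginzburg--Ziv modulo \<open>q\<close> asks for. The quotient is dihedral because
  \<open>m\<close> divides \<open>half\<close> (so \<open>x\<close> squares to one) and
  \<open>s + 1\<close> (so \<open>x\<close> inverts \<open>y\<close>). An odd \<open>m\<close>
  cannot serve: an odd number of terms outside \<open>H\<close> never has its product in
  \<open>H\<close>. Nor can \<open>m = 2\<close>: the quotient is then a Klein four-group, and three
  terms of distinct types contain no block of length two. This leaves \<open>4\<close> and
  \<open>2 * p\<close> as the moduli to try.

  If \<open>half\<close> divides \<open>s - 1\<close>, every common divisor of \<open>half\<close>
  and \<open>s + 1\<close> divides \<open>2\<close>; so the exceptional case is exactly the one
  without a usable modulus. Pairs of equal type are then all there is, and up to four terms stay
  unpaired. In a sequence without the desired subsequence this leaves \<open>n - 2\<close> pairs,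
  one short of what Erdos--Ginzburg--Ziv modulo \<open>n div 2\<close> asks for, which is why the
  inverse theorem has to supply the structure.\<close>

definition msum :: "int \<Rightarrow> int set \<Rightarrow> int set \<Rightarrow> int set" where
  "msum q A B = (\<lambda>(a, b). (a + b) mod q) ` (A \<times> B)"

text \<open>Induction on \<open>B\<close> by the Dyson transform, which moves terms of \<open>B\<close> into \<open>A\<close> and preserves unique
  representability of \<open>0\<close>.\<close>

lemma moser_scherk:
  fixes q :: int
  assumes q: "0 < q" and "A \<subseteq> {0..<q}" "B \<subseteq> {0..<q}" "0 \<in> A" "0 \<in> B"
    and "\<And>a b. a \<in> A \<Longrightarrow> b \<in> B \<Longrightarrow> (a + b) mod q = 0 \<Longrightarrow> a = 0 \<and> b = 0"
  shows "card A + card B \<le> card (msum q A B) + 1"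
  using assms(2-)
proof (induction "card B" arbitrary: A B rule: less_induct)
  case less
  have fin: "finite A" "finite B"
    using less.prems(1,2) finite_subset by blast+
  show ?case
  proof (cases "B = {0}")
    case True
    have "A \<subseteq> msum q A B"
    proof
      fix a assume "a \<in> A"
      then have "(a + 0) mod q = a" using less.prems(1) by (simp add: subset_iff)
      then show "a \<in> msum q A B"
        unfolding msum_def using \<open>a \<in> A\<close> less.prems(4)
        by (intro image_eqI[of _ _ "(a, 0)"]) auto
    qed
    moreover have "finite (msum q A B)" using fin by (simp add: msum_def)
    ultimately have "card A \<le> card (msum q A B)" by (intro card_mono)
    then show ?thesis using True by simp
  next
    case False
    then obtain b where b: "b \<in> B" "b \<noteq> 0" using less.prems(4) by blast
    \<comment> \<open>Were \<open>A\<close> stable under adding \<open>b\<close>, it would contain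
      \<open>(q - 1) * b\<close>, that is \<open>-b\<close>, and \<open>-b + b\<close> would
      represent \<open>0\<close> a second time.\<close>
    have "\<exists>e\<in>A. (e + b) mod q \<notin> A"
    proof (rule ccontr)
      assume "\<not> ?thesis"
      then have step: "\<And>e. e \<in> A \<Longrightarrow> (e + b) mod q \<in> A" by blast
      have mul: "(int k * b) mod q \<in> A" for k
      proof (induction k)
        case 0 then show ?case using less.prems(3) by simp
      next
        case (Suc k)
        have "((int k * b) mod q + b) mod q = (int (Suc k) * b) mod q"
          by (simp add: mod_simps distrib_right add.commute)
        then show ?case using step[OF Suc] by simp
      qed
      have "((int (nat (q - 1)) * b) mod q + b) mod q = ((q - 1) * b + b) mod q"
        using q by (simp add: mod_add_left_eq)
      also have "(q - 1) * b + b = q * b" by (simp add: left_diff_distrib)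
      finally have "((int (nat (q - 1)) * b) mod q + b) mod q = 0" by simp
      then have "b = 0" by (rule less.prems(5)[OF mul b(1), THEN conjunct2])
      then show False using b(2) by simp
    qed
    then obtain e where e: "e \<in> A" "(e + b) mod q \<notin> A" by blast
    \<comment> \<open>Dyson transform at \<open>e\<close>: those \<open>c\<close> in
      \<open>B\<close> with \<open>c + e\<close> outside \<open>A\<close> move into \<open>A\<close>
      as \<open>c + e\<close>, the others stay. The total size is unchanged; \<open>0\<close> stays
      because \<open>e\<close> is in \<open>A\<close>, and \<open>b\<close> moves, so
      \<open>B\<close> shrinks.\<close>
    define tr where "tr c = (c + e) mod q" for c
    define B1 where "B1 = {c \<in> B. tr c \<in> A}"
    define A1 where "A1 = A \<union> tr ` (B - B1)"
    have inj: "inj_on tr B"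
    proof (rule inj_onI)
      fix c d assume cd: "c \<in> B" "d \<in> B" "tr c = tr d"
      then have "c mod q = d mod q"
        unfolding tr_def by (simp only: mod_eq_dvd_iff add_diff_cancel_right)
      moreover have "c mod q = c" "d mod q = d" using cd(1,2) less.prems(2) by (simp_all add: subset_iff)
      ultimately show "c = d" by simp
    qed
    have disj: "A \<inter> tr ` (B - B1) = {}" by (auto simp: B1_def)
    have "card A1 = card A + card (tr ` (B - B1))"
      unfolding A1_def using fin disj by (intro card_Un_disjoint) auto
    also have "card (tr ` (B - B1)) = card (B - B1)"
      using inj by (intro card_image) (auto intro: inj_on_subset)
    also have "card (B - B1) = card B - card B1"
      using fin by (intro card_Diff_subset) (auto simp: B1_def)
    finally have "card A1 + card B1 = card A + card B"
      using card_mono[of B B1] fin by (auto simp: B1_def)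
    moreover have "card A1 + card B1 \<le> card (msum q A1 B1) + 1"
    proof (rule less.hyps)
      have "b \<notin> B1" using e(2) by (simp add: B1_def tr_def add.commute)
      then have "B1 \<subset> B" using b(1) by (auto simp: B1_def)
      then show "card B1 < card B" using fin by (simp add: psubset_card_mono)
      show "A1 \<subseteq> {0..<q}" using less.prems(1) q by (auto simp: A1_def tr_def)
      show "B1 \<subseteq> {0..<q}" using less.prems(2) by (auto simp: B1_def)
      show "0 \<in> A1" using less.prems(3) by (simp add: A1_def)
      have "e mod q = e" using e(1) less.prems(1) by (simp add: subset_iff)
      then show "0 \<in> B1" using less.prems(4) e(1) by (simp add: B1_def tr_def)
      fix a c assume a: "a \<in> A1" and c: "c \<in> B1" and ac: "(a + c) mod q = 0"
      show "a = 0 \<and> c = 0"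
      proof (cases "a \<in> A")
        case True
        then show ?thesis using less.prems(5) c ac by (auto simp: B1_def)
      next
        case False
        then obtain d where d: "d \<in> B - B1" "a = tr d" using a by (auto simp: A1_def)
        have tc: "tr c \<in> A" and cB: "c \<in> B" using c by (auto simp: B1_def)
        \<comment> \<open>The sum \<open>(d + e) + c\<close> regroups as \<open>(c + e) + d\<close>
          with \<open>c + e\<close> in \<open>A\<close> and \<open>d\<close> in \<open>B\<close>.
          Uniqueness there gives \<open>d = 0\<close>, but \<open>0\<close> was never moved.\<close>
        have "(tr c + d) mod q = 0" using ac d(2) by (simp add: tr_def mod_simps add.commute add.left_commute)
        then have "tr c = 0" "d = 0" using less.prems(5)[OF tc] d(1) by auto
        then have "d \<in> B1" using \<open>0 \<in> B1\<close> by simp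
        then show ?thesis using d(1) by simp
      qed
    qed
    moreover have "msum q A1 B1 \<subseteq> msum q A B"
    proof
      fix w assume "w \<in> msum q A1 B1"
      then obtain a c where ac: "a \<in> A1" "c \<in> B1" "w = (a + c) mod q" by (auto simp: msum_def)
      have cB: "c \<in> B" and tc: "tr c \<in> A" using ac(2) by (auto simp: B1_def)
      show "w \<in> msum q A B"
      proof (cases "a \<in> A")
        case True
        then show ?thesis using ac cB by (auto simp: msum_def)
      next
        case False
        then obtain d where d: "d \<in> B" "a = tr d" using ac(1) by (auto simp: A1_def)
        have "w = (tr c + d) mod q" using ac(3) d(2) by (simp add: tr_def mod_simps add.commute add.left_commute)
        then show ?thesis using tc d(1) by (auto simp: msum_def)
      qed
    qed
    then have "card (msum q A1 B1) \<le> card (msum q A B)"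
      using fin by (intro card_mono) (auto simp: msum_def)
    ultimately show ?thesis by linarith
  qed
qed

text \<open>As long as only the trivial choice sums to \<open>0\<close>, \<open>moser_scherk\<close>
  makes each set \<open>A\<close>, with \<open>0\<close> adjoined, enlarge the set of attainable
  sums by at least \<open>card A\<close>. Starting from \<open>{0}\<close>, total size
  \<open>q\<close> would produce \<open>q + 1\<close> residues.\<close>

lemma zero_choice:
  fixes q :: nat
  assumes q: "0 < q" and As: "\<And>A. A \<in> set As \<Longrightarrow> A \<subseteq> {1..<int q}"
    and sz: "q \<le> (\<Sum>A\<leftarrow>As. card A)"
  shows "\<exists>cs. list_all2 (\<lambda>c A. c = 0 \<or> c \<in> A) cs As \<and> (\<exists>c\<in>set cs. c \<noteq> 0) \<and> int q dvd sum_list cs"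
proof (rule ccontr)
  assume none: "\<not> ?thesis"
  define Ch where "Ch Bs cs \<longleftrightarrow> list_all2 (\<lambda>c A. c = (0::int) \<or> c \<in> A) cs Bs" for Bs cs
  define Xs where "Xs Bs = {sum_list cs mod int q | cs. Ch Bs cs}" for Bs
  have sub: "Xs Bs \<subseteq> {0..<int q}" for Bs using q by (auto simp: Xs_def)
  have main: "(\<Sum>A\<leftarrow>Bs. card A) + 1 \<le> card (Xs Bs)"
    if "set Bs \<subseteq> set As" and "\<And>cs. Ch Bs cs \<Longrightarrow> int q dvd sum_list cs \<Longrightarrow> \<forall>c\<in>set cs. c = 0" for Bs
    using that
  proof (induction Bs)
    case Nil
    have "Xs [] = {0}" by (auto simp: Xs_def Ch_def)
    then show ?case by simp
  next
    case (Cons A Bs)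
    have Aq: "A \<subseteq> {1..<int q}" using As Cons.prems(1) by simp
    have fA: "finite A" using Aq finite_subset by blast
    have IH: "(\<Sum>A\<leftarrow>Bs. card A) + 1 \<le> card (Xs Bs)"
    proof (rule Cons.IH)
      show "set Bs \<subseteq> set As" using Cons.prems(1) by simp
      fix cs assume "Ch Bs cs" "int q dvd sum_list cs"
      then show "\<forall>c\<in>set cs. c = 0" using Cons.prems(2)[of "0 # cs"] by (simp add: Ch_def)
    qed
    have "card (insert 0 A) + card (Xs Bs) \<le> card (msum (int q) (insert 0 A) (Xs Bs)) + 1"
    proof (rule moser_scherk)
      have "Ch Bs (replicate (length Bs) 0)" by (simp add: Ch_def list_all2_conv_all_nth)
      then show "0 \<in> Xs Bs" unfolding Xs_def
        by (intro CollectI exI[of _ "replicate (length Bs) 0"]) (simp add: sum_list_replicate)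
      fix a w assume a: "a \<in> insert 0 A" and w: "w \<in> Xs Bs" and aw: "(a + w) mod int q = 0"
      obtain cs where cs: "Ch Bs cs" "w = sum_list cs mod int q" using w by (auto simp: Xs_def)
      have "Ch (A # Bs) (a # cs)" using a cs(1) by (auto simp: Ch_def)
      moreover have "int q dvd sum_list (a # cs)"
        using aw cs(2) by (simp add: mod_simps dvd_eq_mod_eq_0)
      ultimately have "\<forall>c\<in>set (a # cs). c = 0" by (rule Cons.prems(2))
      then have "a = 0" "\<forall>c\<in>set cs. c = 0" by auto
      then have "sum_list cs = 0" by (induction cs) auto
      then show "a = 0 \<and> w = 0" using cs(2) \<open>a = 0\<close> by simp
    qed (use q sub Aq in auto)
    moreover have "msum (int q) (insert 0 A) (Xs Bs) \<subseteq> Xs (A # Bs)"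
    proof
      fix w assume "w \<in> msum (int q) (insert 0 A) (Xs Bs)"
      then obtain a cs where a: "a \<in> insert 0 A" "Ch Bs cs" "w = (a + sum_list cs mod int q) mod int q"
        by (auto simp: msum_def Xs_def)
      then have "Ch (A # Bs) (a # cs)" "w = sum_list (a # cs) mod int q"
        by (auto simp: Ch_def mod_simps)
      then show "w \<in> Xs (A # Bs)" unfolding Xs_def by blast
    qed
    then have "card (msum (int q) (insert 0 A) (Xs Bs)) \<le> card (Xs (A # Bs))"
      by (rule card_mono[rotated]) (use sub finite_subset in blast)
    moreover have "card (insert 0 A) = card A + 1" using Aq fA by (subst card_insert_disjoint) auto
    ultimately show ?case using IH by simp
  qed
  have "(\<Sum>A\<leftarrow>As. card A) + 1 \<le> card (Xs As)"
    by (rule main) (use none in \<open>auto simp: Ch_def\<close>)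
  also have "\<dots> \<le> card {0..<int q}" by (rule card_mono) (use sub in auto)
  finally show False using sz by simp
qed


lemma subseteq_image_mset_pullback:
  assumes "T' \<subseteq># image_mset f M"
  obtains T where "T \<subseteq># M" "image_mset f T = T'"
proof -
  obtain C where "image_mset f M = T' + C" using assms by (auto simp: subset_mset.le_iff_add)
  then show ?thesis using image_mset_eq_plusD that by (metis mset_subset_eq_add_left)
qed

lemma obtain_submset_of_size:
  assumes "k \<le> size M"
  obtains T where "T \<subseteq># M" "size T = k"
proof -
  obtain xs where xs: "mset xs = M" using ex_mset by blast
  have "mset (take k xs) \<subseteq># M" unfolding xs[symmetric]
    by (metis append_take_drop_id mset_append mset_subset_eq_add_left)
  moreover have "size (mset (take k xs)) = k" using assms xs by auto
  ultimately show ?thesis using that by blast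
qed

text \<open>In a choice the value \<open>0\<close> means that nothing is taken. Dropping the zeros
  leaves at most one term from each set, hence the length bound.\<close>

lemma mset_choice_subseteq:
  assumes "list_all2 (\<lambda>c A. c = (0::int) \<or> c \<in> A) cs As" "\<And>A. A \<in> set As \<Longrightarrow> finite A"
  shows "mset (filter (\<lambda>c. c \<noteq> 0) cs) \<subseteq># (\<Sum>A\<leftarrow>As. mset_set A) \<and> length (filter (\<lambda>c. c \<noteq> 0) cs) \<le> length As
    \<and> sum_list (filter (\<lambda>c. c \<noteq> 0) cs) = sum_list cs"
  using assms
proof (induction rule: list_all2_induct)
  case (Cons c cs A As)
  show ?case
  proof (cases "c = 0")
    case True
    then have "mset (filter (\<lambda>c. c \<noteq> 0) (c # cs)) \<subseteq># (\<Sum>A\<leftarrow>As. mset_set A)" using Cons by simp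
    also have "\<dots> \<subseteq># (\<Sum>A\<leftarrow>A # As. mset_set A)" by simp
    finally show ?thesis using Cons True by simp
  next
    case False
    then have "{#c#} \<subseteq># mset_set A" using Cons by simp
    then have "{#c#} + mset (filter (\<lambda>c. c \<noteq> 0) cs) \<subseteq># mset_set A + (\<Sum>A\<leftarrow>As. mset_set A)"
      using Cons by (intro subset_mset.add_mono) auto
    then show ?thesis using Cons False by simp
  qed
qed simp

lemma short_zero_sum_residues:
  fixes q h :: nat and R :: "int multiset"
  assumes q: "0 < q" and R: "\<And>r. r \<in># R \<Longrightarrow> 1 \<le> r \<and> r < int q"
    and h: "\<And>r. count R r \<le> h" and sz: "q \<le> size R"
  obtains T where "T \<subseteq># R" "T \<noteq> {#}" "size T \<le> h" "int q dvd sum_mset T"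
proof -
  \<comment> \<open>\<open>R\<close> is sliced into \<open>h\<close> layers, layer \<open>i\<close>
    holding the residues of multiplicity greater than \<open>i\<close>. A choice takes at most one
    term per layer, so its length is at most \<open>h\<close>.\<close>
  define As where "As = map (\<lambda>i. {r \<in> set_mset R. i < count R r}) [0..<h]"
  have fin: "finite A" if "A \<in> set As" for A using that by (auto simp: As_def)
  have eq: "(\<Sum>A\<leftarrow>As. mset_set A) = R"
  proof (rule multiset_eqI)
    fix r
    have fin0: "finite {r. r \<in># R \<and> P r}" for P
      by (rule finite_subset[of _ "set_mset R"]) auto
    have inR: "r \<in># R" if "i < count R r" for i
      using that by (auto intro: count_inI)
    have "count (\<Sum>i\<leftarrow>is. mset_set {r \<in> set_mset R. i < count R r}) r = length (filter (\<lambda>i. i < count R r) is)" for "is"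
      by (induction "is") (auto simp: count_mset_set' fin0 inR)
    then have "count (\<Sum>A\<leftarrow>As. mset_set A) r = length (filter (\<lambda>i. i < count R r) [0..<h])"
      by (simp add: As_def comp_def)
    also have "\<dots> = card {i. i < h \<and> i < count R r}"
      by (subst distinct_card[symmetric]) (auto intro!: arg_cong[where f = card])
    also have "{i. i < h \<and> i < count R r} = {..<count R r}" using h[of r] by auto
    finally show "count (\<Sum>A\<leftarrow>As. mset_set A) r = count R r" by simp
  qed
  have "(\<Sum>A\<leftarrow>Bs. card A) = size (\<Sum>A\<leftarrow>Bs. mset_set A)" for Bs :: "int set list"
    by (induction Bs) auto
  then have "q \<le> (\<Sum>A\<leftarrow>As. card A)" using eq sz by simp
  moreover have "A \<subseteq> {1..<int q}" if "A \<in> set As" for A using that R by (auto simp: As_def)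
  ultimately obtain cs where cs: "list_all2 (\<lambda>c A. c = 0 \<or> c \<in> A) cs As" "\<exists>c\<in>set cs. c \<noteq> 0"
    "int q dvd sum_list cs"
    using zero_choice[OF q] by blast
  define T where "T = mset (filter (\<lambda>c. c \<noteq> 0) cs)"
  note ch = mset_choice_subseteq[OF cs(1) fin]
  show ?thesis
  proof
    show "T \<subseteq># R" using ch eq by (simp add: T_def)
    show "T \<noteq> {#}" using cs(2) by (auto simp: T_def filter_empty_conv)
    show "size T \<le> h" using ch unfolding T_def size_mset by (simp add: As_def)
    have "sum_mset T = sum_list cs" using ch unfolding T_def sum_mset_sum_list by simp
    then show "int q dvd sum_mset T" using cs(3) by simp
  qed
qed

text \<open>Two distinct terms count for three: with \<open>{r1, r2, r1 + r2}\<close>, a set of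
  three distinct nonzero residues, in place of \<open>r1\<close> and \<open>r2\<close>, and
  singletons for the other terms, the total size is \<open>3 + (q - 3) = q\<close>, and
  \<open>zero_choice\<close> produces a forbidden zero-sum.\<close>

lemma zero_sum_free_constant:
  fixes q :: nat and R :: "int multiset"
  assumes q: "0 < q" and R: "\<And>r. r \<in># R \<Longrightarrow> 0 \<le> r \<and> r < int q"
    and free: "\<And>T. T \<subseteq># R \<Longrightarrow> T \<noteq> {#} \<Longrightarrow> \<not> int q dvd sum_mset T"
    and sz: "size R = q - 1" and r: "r1 \<in># R" "r2 \<in># R"
  shows "r1 = r2"
proof (rule ccontr)
  assume ne: "r1 \<noteq> r2"
  have pos: "1 \<le> r \<and> r < int q" if "r \<in># R" for r
  proof -
    have "\<not> int q dvd r" using free[of "{#r#}"] that by simp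
    then have "r \<noteq> 0" by auto
    then show ?thesis using R[OF that] by linarith
  qed
  have "r2 \<in># R - {#r1#}" using r ne by (simp add: in_diff_count)
  then obtain Q where Q: "R = {#r1, r2#} + Q"
    by (metis r(1) add_mset_add_single insert_DiffM union_commute union_mset_add_mset_left)
  obtain Qs where Qs: "mset Qs = Q" using ex_mset by blast
  define r12 where "r12 = (r1 + r2) mod int q"
  have d12: "\<not> int q dvd r1 + r2" using free[of "{#r1, r2#}"] by (simp add: Q)
  have "r12 \<noteq> 0" using d12 by (simp add: r12_def dvd_eq_mod_eq_0)
  then have r12: "1 \<le> r12 \<and> r12 < int q"
    using q by (smt (verit) r12_def of_nat_0_less_iff pos_mod_bound pos_mod_sign)
  have "r12 \<noteq> r1"
  proof
    assume "r12 = r1"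
    then have "(r1 + r2) mod int q = r1 mod int q" using pos[OF r(1)] by (simp add: r12_def)
    then have "int q dvd r2" by (simp add: mod_eq_dvd_iff)
    then show False using pos[OF r(2)] by (auto dest: zdvd_imp_le)
  qed
  moreover have "r12 \<noteq> r2"
  proof
    assume "r12 = r2"
    then have "(r1 + r2) mod int q = r2 mod int q" using pos[OF r(2)] by (simp add: r12_def)
    then have "int q dvd r1" by (simp add: mod_eq_dvd_iff)
    then show False using pos[OF r(1)] by (auto dest: zdvd_imp_le)
  qed
  ultimately have card3: "card {r1, r2, r12} = 3" using ne by auto
  define As where "As = {r1, r2, r12} # map (\<lambda>x. {x}) Qs"
  have "(\<Sum>A\<leftarrow>As. card A) = 3 + length Qs"
    by (simp add: As_def card3 comp_def sum_list_triv)
  moreover have "length Qs + 2 = q - 1" using sz Qs by (auto simp: Q)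
  ultimately have "q \<le> (\<Sum>A\<leftarrow>As. card A)" by linarith
  moreover have "A \<subseteq> {1..<int q}" if "A \<in> set As" for A
    using that r12 pos r Qs Q by (auto simp: As_def)
  ultimately obtain cs where cs: "list_all2 (\<lambda>c A. c = 0 \<or> c \<in> A) cs As" "\<exists>c\<in>set cs. c \<noteq> 0"
    "int q dvd sum_list cs"
    using zero_choice[OF q] by blast
  obtain c ds where cds: "cs = c # ds" "c = 0 \<or> c \<in> {r1, r2, r12}"
    "list_all2 (\<lambda>c A. c = 0 \<or> c \<in> A) ds (map (\<lambda>x. {x}) Qs)"
    using cs(1) by (auto simp: As_def list_all2_Cons2)
  define D where "D = mset (filter (\<lambda>c. c \<noteq> 0) ds)"
  have "(\<Sum>A\<leftarrow>map (\<lambda>x. {x}) Qs. mset_set A) = mset Qs" by (induction Qs) auto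
  then have D: "D \<subseteq># Q" "sum_mset D = sum_list ds"
    using mset_choice_subseteq[OF cds(3)] Qs unfolding D_def sum_mset_sum_list by auto
  \<comment> \<open>A chosen \<open>r12\<close> stands for taking both \<open>r1\<close> and
    \<open>r2\<close>.\<close>
  define E where "E = (if c = 0 then {#} else if c = r1 then {#r1#} else if c = r2 then {#r2#} else {#r1, r2#})"
  have E: "E \<subseteq># {#r1, r2#}" by (auto simp: E_def)
  have "int q dvd sum_mset E - c" using cds(2) by (auto simp: E_def r12_def mod_eq_dvd_iff[symmetric])
  then have "int q dvd (sum_mset E - c) + sum_list cs" using cs(3) by (rule dvd_add)
  then have "int q dvd sum_mset (E + D)" using D(2) by (simp add: cds(1))
  moreover have "E + D \<noteq> {#}" using cs(2) cds(1) by (auto simp: E_def D_def filter_empty_conv)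
  moreover have "E + D \<subseteq># R" unfolding Q using E D(1) by (rule subset_mset.add_mono)
  ultimately show False using free by blast
qed


section \<open>The Erdos--Ginzburg--Ziv theorem and its inverse for cyclic groups\<close>

definition zero_sum :: "nat \<Rightarrow> ('a \<Rightarrow> int) \<Rightarrow> 'a multiset \<Rightarrow> bool" where
  "zero_sum q f T \<longleftrightarrow> int q dvd (\<Sum>x\<in>#T. f x)"

lemma zero_sum_union: "zero_sum q f A \<Longrightarrow> zero_sum q f B \<Longrightarrow> zero_sum q f (A + B)"
  by (simp add: zero_sum_def)

lemma dvd_sum_mset_residues:
  "int q dvd (\<Sum>x\<in>#T. f x) \<longleftrightarrow> int q dvd sum_mset (image_mset (\<lambda>x. f x mod int q) T)"
proof -
  have "int q dvd (\<Sum>x\<in>#T. f x) - sum_mset (image_mset (\<lambda>x. f x mod int q) T)"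
  proof (induction T)
    case (add x T)
    have "int q dvd f x - f x mod int q" by (simp add: minus_mod_eq_mult_div)
    then have "int q dvd (f x - f x mod int q) + ((\<Sum>x\<in>#T. f x) - sum_mset (image_mset (\<lambda>x. f x mod int q) T))"
      using add by (rule dvd_add)
    then show ?case by (simp add: algebra_simps)
  qed simp
  then show ?thesis by (metis dvd_diff_commute dvd_add_right_iff diff_add_cancel)
qed

text \<open>The argument revolves around a largest subsequence \<open>W\<close> having zero-sum subsequences of all
  lengths up to its own: no zero-sum sequence of length at most \<open>|W| + 1\<close> is disjoint from it.\<close>

lemma egz_core:
  fixes q :: nat and f :: "'a \<Rightarrow> int"
  assumes q: "2 \<le> q" and none: "\<And>T. T \<subseteq># S \<Longrightarrow> size T = q \<Longrightarrow> \<not> zero_sum q f T"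
    and top: "\<And>r. count (image_mset (\<lambda>x. f x mod int q) S) r \<le> count (image_mset (\<lambda>x. f x mod int q) S) 0"
  shows "size S \<le> 2 * q - 2 \<and> (size S = 2 * q - 2 \<longrightarrow> (\<exists>v. coprime v (int q) \<and>
    image_mset (\<lambda>x. f x mod int q) S = replicate_mset (q - 1) 0 + replicate_mset (q - 1) (v mod int q)))"
proof -
  define res where "res x = f x mod int q" for x
  define full where "full W \<longleftrightarrow> W \<subseteq># S \<and> (\<forall>l\<le>size W. \<exists>T. T \<subseteq># W \<and> size T = l \<and> zero_sum q f T)" for W
  have dv: "zero_sum q f T \<longleftrightarrow> int q dvd sum_mset (image_mset res T)" for T
    unfolding zero_sum_def res_def by (rule dvd_sum_mset_residues)
  have "full {#}" by (simp add: full_def zero_sum_def)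
  moreover have "size W \<le> size S" if "full W" for W using that by (simp add: full_def size_mset_mono)
  ultimately have "\<exists>W. full W \<and> (\<forall>W'. full W' \<longrightarrow> size W' \<le> size W)"
    by (intro ex_has_greatest_nat[of full "{#}" size "Suc (size S)"]) (auto simp: less_Suc_eq_le)
  then obtain W where W: "full W" and Wmax: "\<And>W'. full W' \<Longrightarrow> size W' \<le> size W" by blast
  define R where "R = S - W"
  have SW: "S = W + R" using W by (simp add: full_def R_def)
  have free: "\<not> zero_sum q f B" if B: "B \<subseteq># R" "B \<noteq> {#}" "size B \<le> size W + 1" for B
  proof
    assume zB: "zero_sum q f B"
    have "full (W + B)" unfolding full_def
    proof (intro conjI allI impI)
      show "W + B \<subseteq># S" using B(1) by (simp add: SW)
      fix l assume l: "l \<le> size (W + B)"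
      show "\<exists>T. T \<subseteq># W + B \<and> size T = l \<and> zero_sum q f T"
      proof (cases "l \<le> size W")
        case True
        then obtain T where "T \<subseteq># W" "size T = l" "zero_sum q f T" using W by (auto simp: full_def)
        then show ?thesis by (metis mset_subset_eq_add_left subset_mset.order_trans)
      next
        case False
        \<comment> \<open>Zero-sums longer than \<open>W\<close> consist of \<open>B\<close> and a
          shorter one inside \<open>W\<close>. The subtraction is genuine, as
          \<open>size B \<le> size W + 1 \<le> l\<close>.\<close>
        then have "l - size B \<le> size W" using l by simp
        then obtain T where T: "T \<subseteq># W" "size T = l - size B" "zero_sum q f T" using W by (auto simp: full_def)
        have "T + B \<subseteq># W + B" "size (T + B) = l" "zero_sum q f (T + B)"
          using T False B(3) zB by (auto intro: zero_sum_union)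
        then show ?thesis by blast
      qed
    qed
    then show False using Wmax[of "W + B"] B(2) by (simp add: nonempty_has_size)
  qed
  have Wq: "size W \<le> q - 1"
  proof (rule ccontr)
    assume "\<not> ?thesis"
    then have "q \<le> size W" by simp
    then obtain T where "T \<subseteq># W" "size T = q" "zero_sum q f T" using W unfolding full_def by blast
    then show False using none[of T] SW by (metis mset_subset_eq_add_left subset_mset.order_trans)
  qed
  \<comment> \<open>Every subsequence of \<open>Z\<close> is zero-sum, so \<open>Z\<close> is full
    and no larger than \<open>W\<close>. As \<open>0\<close> is the most frequent residue,
    \<open>size W\<close> then bounds all multiplicities, which is the bound that
    \<open>short_zero_sum_residues\<close> turns into short zero-sums.\<close>
  define Z where "Z = filter_mset (\<lambda>x. res x = 0) S"
  have "full Z" unfolding full_def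
  proof (intro conjI allI impI)
    show "Z \<subseteq># S" by (simp add: Z_def)
    fix l assume "l \<le> size Z"
    then obtain T where T: "T \<subseteq># Z" "size T = l" using obtain_submset_of_size by blast
    have "int q dvd f x" if "x \<in># T" for x
      using mset_subset_eqD[OF T(1) that] by (auto simp: Z_def res_def)
    then have "zero_sum q f T" unfolding zero_sum_def by (induction T) auto
    then show "\<exists>T. T \<subseteq># Z \<and> size T = l \<and> zero_sum q f T" using T by blast
  qed
  then have "size Z \<le> size W" by (rule Wmax)
  moreover have "size Z = count (image_mset res S) 0"
    unfolding Z_def by (induction S) auto
  ultimately have cnt: "count (image_mset res S) r \<le> size W" for r
    using top[of r] by (simp add: res_def[abs_def])
  have Rpos: "1 \<le> r \<and> r < int q" if rR: "r \<in># image_mset res R" for r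
  proof -
    obtain x where x: "x \<in># R" "r = res x" using rR by auto
    have "\<not> zero_sum q f {#x#}" using free[of "{#x#}"] x(1) by simp
    then have "r \<noteq> 0" using x(2) by (simp add: zero_sum_def res_def dvd_eq_mod_eq_0)
    moreover have "0 \<le> r" "r < int q" using q by (auto simp: x(2) res_def)
    ultimately show ?thesis by linarith
  qed
  have pull: "\<not> int q dvd sum_mset T" if T: "T \<subseteq># image_mset res R" "T \<noteq> {#}" "size T \<le> size W + 1" for T
  proof -
    obtain B where B: "B \<subseteq># R" "image_mset res B = T" using T(1) by (rule subseteq_image_mset_pullback)
    then have "\<not> zero_sum q f B" using free[of B] T by auto
    then show ?thesis using B(2) by (simp add: dv)
  qed
  have Rq: "size R \<le> q - 1"
  proof (rule ccontr)
    assume "\<not> ?thesis"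
    then have "q \<le> size (image_mset res R)" by simp
    moreover have "count (image_mset res R) r \<le> size W + 1" for r
      using cnt[of r] by (simp add: SW)
    ultimately obtain T where "T \<subseteq># image_mset res R" "T \<noteq> {#}" "size T \<le> size W + 1" "int q dvd sum_mset T"
      using short_zero_sum_residues[of q "image_mset res R" "size W + 1"] Rpos q by (metis gr0I not_numeral_le_zero)
    then show False using pull by blast
  qed
  have szS: "size S = size W + size R" by (simp add: SW)
  show ?thesis
  proof (intro conjI impI)
    show "size S \<le> 2 * q - 2" using szS Wq Rq q by linarith
    assume eq: "size S = 2 * q - 2"
    then have W1: "size W = q - 1" and R1: "size R = q - 1" using szS Wq Rq q by linarith+
    then have "R \<noteq> {#}" using q by auto
    then obtain x where x: "x \<in># R" by blast
    have const: "r = res x" if "r \<in># image_mset res R" for r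
    proof (rule zero_sum_free_constant[of q "image_mset res R"])
      fix T assume "T \<subseteq># image_mset res R" "T \<noteq> {#}"
      moreover then have "size T \<le> size W + 1" using size_mset_mono[of T "image_mset res R"] R1 W1 by simp
      ultimately show "\<not> int q dvd sum_mset T" by (intro pull)
    qed (use q R1 that x Rpos in \<open>force+\<close>)
    define v where "v = res x"
    have imR: "image_mset res R = replicate_mset (q - 1) v"
      using const R1 by (metis v_def set_mset_subset_singletonD size_image_mset singleton_iff subsetI)
    have v0: "1 \<le> v" "v < int q" using Rpos[of v] x by (auto simp: v_def)
    \<comment> \<open>\<open>R\<close> alone gives \<open>v\<close> multiplicity
      \<open>q - 1\<close>. Hence \<open>0\<close> is at least as frequent, and since
      \<open>R\<close> contains only \<open>v\<close>, all these zeros lie in \<open>W\<close> and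
      fill it.\<close>
    have "q - 1 \<le> count (image_mset res S) v" by (simp add: SW imR)
    then have "q - 1 \<le> count (image_mset res S) 0" using top[of v] by (simp add: res_def[abs_def])
    then have "q - 1 \<le> count (image_mset res W) 0" using v0 by (simp add: SW imR)
    then have "replicate_mset (q - 1) 0 \<subseteq># image_mset res W" by (simp add: count_le_replicate_mset_subset_eq)
    moreover have "size (replicate_mset (q - 1) (0::int)) = size (image_mset res W)" by (simp add: W1)
    ultimately have "image_mset res W = replicate_mset (q - 1) 0"
      by (metis mset_subset_size nat_neq_iff subset_mset.le_neq_trans)
    then have "image_mset res S = replicate_mset (q - 1) 0 + replicate_mset (q - 1) v"
      by (simp add: SW imR)
    moreover have "v mod int q = v" using v0 by simp
    moreover have "coprime v (int q)"
    proof (rule ccontr)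
      assume nc: "\<not> coprime v (int q)"
      \<comment> \<open>For \<open>d > 1\<close> the \<open>q div d\<close> copies of
        \<open>v\<close> needed for a zero-sum would already fit into \<open>R\<close>.\<close>
      define d where "d = gcd v (int q)"
      have "d \<noteq> 0" "d \<noteq> 1" "0 \<le> d" using nc v0 by (auto simp: d_def coprime_iff_gcd_eq_1)
      then have "1 < d" by linarith
      then have d: "d dvd v" "d dvd int q" "1 < d" by (simp_all add: d_def)
      then obtain e w where e: "int q = d * e" and w: "v = d * w" by blast
      have e0: "0 < e" using e d(3) q by (metis less_numeral_extra(1) nat_2 of_nat_0_less_iff order_less_le_trans order.strict_trans zero_less_mult_pos zero_less_numeral)
      have "2 * e \<le> d * e" using d(3) e0 by (intro mult_right_mono) auto
      then have "e < int q" using e e0 by linarith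
      then have le: "nat e \<le> q - 1" using e0 by linarith
      have "\<not> int q dvd sum_mset (replicate_mset (nat e) v)"
      proof (rule pull)
        show "replicate_mset (nat e) v \<subseteq># image_mset res R"
          unfolding imR using le by (simp add: count_le_replicate_mset_subset_eq[symmetric])
        show "replicate_mset (nat e) v \<noteq> {#}" using e0 by (simp add: replicate_mset_eq_empty_iff)
        show "size (replicate_mset (nat e) v) \<le> size W + 1" using le W1 by simp
      qed
      moreover have "sum_mset (replicate_mset (nat e) v) = int q * w"
        using e0 by (simp add: sum_mset_replicate_mset e w)
      ultimately show False by simp
    qed
    ultimately show "\<exists>v. coprime v (int q) \<and>
      image_mset (\<lambda>x. f x mod int q) S = replicate_mset (q - 1) 0 + replicate_mset (q - 1) (v mod int q)"
      by (intro exI[of _ v]) (simp add: res_def[abs_def])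
  qed
qed


text \<open>Subtracting a constant from all values changes a sum of \<open>q\<close> terms by a
  multiple of \<open>q\<close>, so the most frequent residue can be moved to \<open>0\<close>, as
  \<open>egz_core\<close> requires.\<close>

lemma egz_most_frequent:
  fixes q :: nat and f :: "'a \<Rightarrow> int"
  assumes q: "2 \<le> q" and none: "\<And>T. T \<subseteq># S \<Longrightarrow> size T = q \<Longrightarrow> \<not> zero_sum q f T"
  shows "size S \<le> 2 * q - 2 \<and> (size S = 2 * q - 2 \<longrightarrow> (\<exists>u v. coprime (u - v) (int q) \<and>
    image_mset (\<lambda>x. f x mod int q) S = replicate_mset (q - 1) (u mod int q) + replicate_mset (q - 1) (v mod int q)))"
proof -
  define c where "c g = size (filter_mset (\<lambda>x. int q dvd f x - g) S)" for g
  have "\<exists>g. True \<and> (\<forall>g'. True \<longrightarrow> c g' \<le> c g)"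
    by (rule ex_has_greatest_nat[of _ 0 _ "Suc (size S)"]) (simp_all add: c_def less_Suc_eq_le)
  then obtain g where g: "\<And>g'. c g' \<le> c g" by blast
  define h where "h x = f x - g" for x
  have cnt: "count (image_mset (\<lambda>x. h x mod int q) S) r = size (filter_mset (\<lambda>x. h x mod int q = r) S)" for r
    by (induction S) auto
  have "\<not> zero_sum q h T" if T: "T \<subseteq># S" "size T = q" for T
  proof -
    have "(\<Sum>x\<in>#T. h x) = (\<Sum>x\<in>#T. f x) - int (size T) * g"
      unfolding h_def by (induction T) (auto simp: algebra_simps)
    then have "zero_sum q h T \<longleftrightarrow> zero_sum q f T" using T(2) by (simp add: zero_sum_def dvd_diff_left_iff)
    then show ?thesis using none[OF T] by simp
  qed
  moreover have "count (image_mset (\<lambda>x. h x mod int q) S) r \<le> count (image_mset (\<lambda>x. h x mod int q) S) 0" for r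
  proof -
    have "filter_mset (\<lambda>x. h x mod int q = r) S \<subseteq># filter_mset (\<lambda>x. int q dvd f x - (g + r)) S"
      by (rule filter_mset_mono_strong)
        (auto simp: h_def minus_mod_eq_mult_div simp flip: diff_diff_eq)
    then have "size (filter_mset (\<lambda>x. h x mod int q = r) S) \<le> c (g + r)" unfolding c_def by (rule size_mset_mono)
    also have "\<dots> \<le> c g" by (rule g)
    also have "c g = size (filter_mset (\<lambda>x. h x mod int q = 0) S)" by (simp add: c_def h_def dvd_eq_mod_eq_0)
    finally show ?thesis unfolding cnt .
  qed
  ultimately have core: "size S \<le> 2 * q - 2 \<and> (size S = 2 * q - 2 \<longrightarrow> (\<exists>v. coprime v (int q) \<and>
    image_mset (\<lambda>x. h x mod int q) S = replicate_mset (q - 1) 0 + replicate_mset (q - 1) (v mod int q)))"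
    by (rule egz_core[OF q])
  show ?thesis
  proof (intro conjI impI)
    show "size S \<le> 2 * q - 2" using core by simp
    assume "size S = 2 * q - 2"
    then obtain v where v: "coprime v (int q)"
      "image_mset (\<lambda>x. h x mod int q) S = replicate_mset (q - 1) 0 + replicate_mset (q - 1) (v mod int q)"
      using core by blast
    have shift: "(h x mod int q + g) mod int q = f x mod int q" for x
      unfolding mod_add_left_eq by (simp add: h_def)
    have "image_mset (\<lambda>x. f x mod int q) S = image_mset (\<lambda>r. (r + g) mod int q) (image_mset (\<lambda>x. h x mod int q) S)"
      by (simp add: image_mset.compositionality comp_def shift)
    also have "\<dots> = replicate_mset (q - 1) (g mod int q) + replicate_mset (q - 1) ((v + g) mod int q)"
      unfolding v(2) by (simp add: image_replicate_mset mod_add_left_eq)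
    finally show "\<exists>u v. coprime (u - v) (int q) \<and>
      image_mset (\<lambda>x. f x mod int q) S = replicate_mset (q - 1) (u mod int q) + replicate_mset (q - 1) (v mod int q)"
      using v(1) by (intro exI[of _ "v + g"] exI[of _ g]) (simp add: add.commute union_commute)
  qed
qed

text \<open>The weight \<open>f\<close> is arbitrary because it will be the exponent of a term, a
  halved exponent, or the value of a whole pair or block.\<close>

theorem erdos_ginzburg_ziv:
  fixes q :: nat and f :: "'a \<Rightarrow> int"
  assumes q: "0 < q" and sz: "2 * q - 1 \<le> size S"
  obtains T where "T \<subseteq># S" "size T = q" "zero_sum q f T"
proof (cases "q = 1")
  case True
  then obtain T where "T \<subseteq># S" "size T = 1" using sz obtain_submset_of_size[of 1 S] by auto
  then show ?thesis using that True by (simp add: zero_sum_def)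
next
  case False
  then have "2 \<le> q" using q by simp
  then show ?thesis using egz_most_frequent[of q S f] sz that by fastforce
qed

theorem erdos_ginzburg_ziv_inverse:
  fixes q :: nat and f :: "'a \<Rightarrow> int"
  assumes q: "2 \<le> q" and none: "\<And>T. T \<subseteq># S \<Longrightarrow> size T = q \<Longrightarrow> \<not> zero_sum q f T" and sz: "size S = 2 * q - 2"
  obtains u v where "coprime (u - v) (int q)"
    "image_mset (\<lambda>x. f x mod int q) S = replicate_mset (q - 1) (u mod int q) + replicate_mset (q - 1) (v mod int q)"
  using egz_most_frequent[OF q none] sz that by blast

section \<open>Products of sequences over the group\<close>

text \<open>The generators are parameters, so that every lemma can be reused for another pair
  satisfying the same relations; see \<open>gens_dicyclic_like\<close>.\<close>

locale dicyclic_like = group G for G (structure) +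
  fixes n :: nat and s :: int and x y :: 'a
  assumes gens: "dicyclic_gens G n s x y"
    and fin: "finite (carrier G)" and ord: "card (carrier G) = 2 * n"
    and n8: "8 \<le> n" and n4: "4 dvd n" and s_sq: "s\<^sup>2 mod int n = 1 mod int n"
begin

abbreviation half :: int where "half \<equiv> int (n div 2)"

lemma x_closed [simp]: "x \<in> carrier G" and y_closed [simp]: "y \<in> carrier G"
  using gens by (auto simp: dicyclic_gens_def)

lemma two_half: "2 * half = int n"
  using n4 by auto

lemma even_half: "even half"
  using n4 by auto

lemma s_square: "int n dvd s * s - 1"
  using s_sq by (simp add: mod_eq_dvd_iff power2_eq_square)

lemma s_odd: "odd s"
proof
  assume "even s"
  have "2 dvd int n" using n4 by auto
  then have "2 dvd s * s - 1" using s_square by (rule dvd_trans)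
  then show False using \<open>even s\<close> by simp
qed

lemma y_n: "y [^] int n = \<one>"
  using gens by (simp add: dicyclic_gens_def int_pow_int)

lemma x_x: "x \<otimes> x = y [^] half"
proof -
  have "x [^] (2::nat) = y [^] (n div 2)" using gens by (simp add: dicyclic_gens_def)
  then show ?thesis by (simp add: numeral_2_eq_2 int_pow_int)
qed

lemma y_x: "y \<otimes> x = x \<otimes> y [^] s"
  using gens by (simp add: dicyclic_gens_def)

lemma yy: "y [^] i \<otimes> y [^] j = y [^] (i + j :: int)"
  by (simp add: int_pow_mult)

lemma pow_y_x: "y [^] i \<otimes> x = x \<otimes> y [^] (s * i :: int)"
proof -
  \<comment> \<open>Conjugation by \<open>x\<close> is a homomorphism sending \<open>y\<close> to
    \<open>y [^] s\<close>, which settles all powers of \<open>y\<close> at once.\<close>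
  define c where "c g = inv x \<otimes> (g \<otimes> x)" for g
  have c: "c \<in> hom G G"
  proof (rule homI)
    fix g h assume g: "g \<in> carrier G" and h: "h \<in> carrier G"
    have "(g \<otimes> x) \<otimes> (inv x \<otimes> (h \<otimes> x)) = g \<otimes> (h \<otimes> x)"
      using g h by (simp add: m_assoc inv_solve_left' flip: m_assoc[of x "inv x"])
    then show "c (g \<otimes> h) = c g \<otimes> c h" using g h by (simp add: c_def m_assoc)
  qed (simp add: c_def)
  have "c y = y [^] s" unfolding c_def y_x by (simp flip: m_assoc)
  then have "c (y [^] i) = (y [^] s) [^] i"
    using hom_int_pow[OF c y_closed] by (simp add: is_group)
  then have "inv x \<otimes> (y [^] i \<otimes> x) = y [^] (s * i)" by (simp add: c_def int_pow_pow)
  then have "x \<otimes> (inv x \<otimes> (y [^] i \<otimes> x)) = x \<otimes> y [^] (s * i)" by simp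
  then show ?thesis by (simp flip: m_assoc)
qed

lemma yxy: "y [^] i \<otimes> (x \<otimes> y [^] j) = x \<otimes> y [^] (s * i + j :: int)"
  by (simp add: pow_y_x m_assoc yy flip: m_assoc[of _ x])

lemma xyy: "(x \<otimes> y [^] i) \<otimes> y [^] j = x \<otimes> y [^] (i + j :: int)"
  by (simp add: m_assoc yy)

lemma xyxy: "(x \<otimes> y [^] i) \<otimes> (x \<otimes> y [^] j) = y [^] (half + s * i + j :: int)"
proof -
  have "(x \<otimes> y [^] i) \<otimes> (x \<otimes> y [^] j) = x \<otimes> (x \<otimes> y [^] (s * i + j))" by (simp add: m_assoc yxy)
  also have "\<dots> = y [^] half \<otimes> y [^] (s * i + j)" by (simp add: x_x flip: m_assoc)
  finally show ?thesis by (simp add: yy add.assoc)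
qed

lemma pow_mod: "y [^] (i mod int n) = y [^] (i :: int)"
proof -
  have "y [^] i = y [^] (int n * (i div int n)) \<otimes> y [^] (i mod int n)" by (simp add: yy)
  also have "y [^] (int n * (i div int n)) = \<one>" by (simp add: y_n flip: int_pow_pow)
  finally show ?thesis by simp
qed

section \<open>Normal forms and the cyclic subgroup of index two\<close>

definition H :: "'a set" where "H = range (\<lambda>i::int. y [^] i)"

lemma carrier_eq: "carrier G = H \<union> (\<lambda>h. x \<otimes> h) ` H"
proof
  define M where "M = H \<union> (\<lambda>h. x \<otimes> h) ` H"
  have M: "g \<in> M \<longleftrightarrow> (\<exists>i::int. g = y [^] i \<or> g = x \<otimes> y [^] i)" for g
    by (auto simp: M_def H_def)
  have mult: "g \<otimes> h \<in> M" if "g \<in> M" "h \<in> M" for g h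
    using that unfolding M by (metis yy yxy xyy xyxy)
  have "x = x \<otimes> y [^] (0::int)" "y = y [^] (1::int)" "\<one> = y [^] (0::int)" by simp_all
  then have xy: "x \<in> M" "y \<in> M" "\<one> \<in> M" unfolding M by blast+
  have "inv y = y [^] (- 1 :: int)" by (simp add: int_pow_neg)
  then have iy: "inv y \<in> M" unfolding M by blast
  have "x \<otimes> (x \<otimes> y [^] (- half)) = \<one>" by (simp add: x_x yy flip: m_assoc)
  then have "inv x = x \<otimes> y [^] (- half)" by (intro inv_unique'[symmetric]) (simp_all add: inv_comm)
  then have ix: "inv x \<in> M" unfolding M by blast
  have "g \<in> M" if "g \<in> generate G {x, y}" for g
    using that by (induction rule: generate.induct) (use xy ix iy mult in auto)
  then show "carrier G \<subseteq> H \<union> (\<lambda>h. x \<otimes> h) ` H"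
    using gens by (auto simp: dicyclic_gens_def M_def)
  show "H \<union> (\<lambda>h. x \<otimes> h) ` H \<subseteq> carrier G" by (auto simp: H_def)
qed

lemma H_image: "H = (\<lambda>i. y [^] i) ` {0..<int n}"
proof
  show "H \<subseteq> (\<lambda>i. y [^] i) ` {0..<int n}"
  proof
    fix g assume "g \<in> H"
    then obtain i :: int where "g = y [^] i" by (auto simp: H_def)
    then have "g = y [^] (i mod int n)" by (simp add: pow_mod)
    moreover have "i mod int n \<in> {0..<int n}" using n8 by simp
    ultimately show "g \<in> (\<lambda>i. y [^] i) ` {0..<int n}" by blast
  qed
qed (auto simp: H_def)

lemma finite_H: "finite H" by (simp add: H_image)

text \<open>The normal forms give
  \<open>2 * n = card (carrier G) \<le> 2 * card H \<le> 2 * n\<close>. Equality throughout makes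
  the two cosets disjoint and \<open>y\<close> of order exactly \<open>n\<close>: relations and
  group order together do the work of the abstract presentation.\<close>

lemma card_H: "card H = n" and H_disjoint: "H \<inter> (\<lambda>h. x \<otimes> h) ` H = {}"
proof -
  have le: "card H \<le> n" unfolding H_image using card_image_le[of "{0..<int n}"] by force
  have le': "card ((\<lambda>h. x \<otimes> h) ` H) \<le> card H" by (rule card_image_le[OF finite_H])
  have "card H + card ((\<lambda>h. x \<otimes> h) ` H) = card (carrier G) + card (H \<inter> (\<lambda>h. x \<otimes> h) ` H)"
    unfolding carrier_eq using finite_H by (intro card_Un_Int) auto
  then have "card (H \<inter> (\<lambda>h. x \<otimes> h) ` H) = 0" "card H = n" using le le' ord by linarith+
  then show "card H = n" "H \<inter> (\<lambda>h. x \<otimes> h) ` H = {}" using finite_H by auto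
qed

lemma y_eq_iff: "y [^] i = y [^] j \<longleftrightarrow> int n dvd i - (j :: int)"
proof -
  have inj: "inj_on (\<lambda>i::int. y [^] i) {0..<int n}"
    by (rule eq_card_imp_inj_on) (use card_H in \<open>simp_all add: H_image\<close>)
  have "y [^] i = y [^] j \<longleftrightarrow> y [^] (i mod int n) = y [^] (j mod int n)" by (simp add: pow_mod)
  also have "\<dots> \<longleftrightarrow> i mod int n = j mod int n" using inj n8 by (auto dest: inj_onD)
  finally show ?thesis by (simp add: mod_eq_dvd_iff)
qed

lemma y_eq_one_iff: "y [^] i = \<one> \<longleftrightarrow> int n dvd (i :: int)"
  using y_eq_iff[of i 0] by simp

definition N :: "'a \<Rightarrow> bool" where "N g \<longleftrightarrow> g \<notin> H"

text \<open>An exponent is determined only modulo \<open>n\<close>, so results about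
  \<open>ex\<close> are congruences; its parity is well defined because \<open>n\<close> is
  even.\<close>

definition ex :: "'a \<Rightarrow> int" where "ex g = (SOME i. g = y [^] i \<or> g = x \<otimes> y [^] i)"

lemma not_N_pow [simp]: "\<not> N (y [^] (i::int))" by (auto simp: N_def H_def)

lemma N_x_pow [simp]: "N (x \<otimes> y [^] (i::int))" using H_disjoint by (auto simp: N_def H_def)

lemma ex_cases: "g \<in> carrier G \<Longrightarrow> g = y [^] ex g \<or> g = x \<otimes> y [^] ex g"
  unfolding ex_def by (rule someI_ex) (auto simp: carrier_eq H_def)

lemma H_ex: "g \<in> carrier G \<Longrightarrow> \<not> N g \<Longrightarrow> g = y [^] ex g"
  using ex_cases[of g] by (metis N_x_pow)

lemma N_ex: "g \<in> carrier G \<Longrightarrow> N g \<Longrightarrow> g = x \<otimes> y [^] ex g"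
  using ex_cases[of g] by (metis not_N_pow)

lemma ex_pow: "int n dvd ex (y [^] i) - i"
  using H_ex[of "y [^] i"] by (metis int_pow_closed not_N_pow y_closed y_eq_iff)

lemma ex_x_pow: "int n dvd ex (x \<otimes> y [^] i) - i"
proof -
  have "x \<otimes> y [^] i = x \<otimes> y [^] ex (x \<otimes> y [^] i)" by (rule N_ex) simp_all
  then show ?thesis by (metis int_pow_closed l_cancel x_closed y_closed y_eq_iff)
qed

definition prods :: "'a multiset \<Rightarrow> 'a set" where
  "prods T = {list_prod G xs | xs. mset xs = T}"

text \<open>Exponents are kept as integers, so that congruences modulo divisors of \<open>n\<close>
  can be read off directly. Products outside \<open>H\<close> are not recorded.\<close>

definition exps :: "'a multiset \<Rightarrow> int set" where
  "exps T = {i. y [^] i \<in> prods T}"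

lemma list_prod_closed: "set zs \<subseteq> carrier G \<Longrightarrow> list_prod G zs \<in> carrier G"
  by (induction zs) (auto simp: list_prod_def)

lemma list_prod_Nil [simp]: "list_prod G [] = \<one>"
  and list_prod_Cons [simp]: "list_prod G (z # zs) = z \<otimes> list_prod G zs"
  by (simp_all add: list_prod_def)

lemma list_prod_append:
  "set zs \<subseteq> carrier G \<Longrightarrow> set ws \<subseteq> carrier G \<Longrightarrow> list_prod G (zs @ ws) = list_prod G zs \<otimes> list_prod G ws"
  by (induction zs) (auto simp: list_prod_closed m_assoc)

lemma product_one_iff: "product_one G T \<longleftrightarrow> 0 \<in> exps T"
  unfolding product_one_def exps_def prods_def by (auto intro: sym)

lemma exps_cong: "i \<in> exps T \<Longrightarrow> int n dvd i - j \<Longrightarrow> j \<in> exps T"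
  unfolding exps_def using y_eq_iff[of i j] by auto

lemma product_oneI: "i \<in> exps T \<Longrightarrow> int n dvd i \<Longrightarrow> product_one G T"
  unfolding product_one_iff by (rule exps_cong) auto

lemma exps_empty: "0 \<in> exps {#}"
  by (auto simp: exps_def prods_def)

lemma exps_add:
  assumes "set_mset A \<subseteq> carrier G" "set_mset B \<subseteq> carrier G" "i \<in> exps A" "j \<in> exps B"
  shows "i + j \<in> exps (A + B)"
proof -
  obtain zs ws where "mset zs = A" "y [^] i = list_prod G zs" "mset ws = B" "y [^] j = list_prod G ws"
    using assms(3,4) by (auto simp: exps_def prods_def)
  moreover from this have "list_prod G (zs @ ws) = list_prod G zs \<otimes> list_prod G ws"
    using assms(1,2) by (intro list_prod_append) auto
  ultimately have "mset (zs @ ws) = A + B" "y [^] (i + j) = list_prod G (zs @ ws)" by (simp_all flip: yy)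
  then show ?thesis unfolding exps_def prods_def by blast
qed

lemma exps_single: "h \<in> carrier G \<Longrightarrow> \<not> N h \<Longrightarrow> ex h \<in> exps {#h#}"
  using H_ex[of h] by (auto simp: exps_def prods_def intro!: exI[of _ "[h]"])

lemma exps_add_mset:
  "set_mset T \<subseteq> carrier G \<Longrightarrow> h \<in> carrier G \<Longrightarrow> \<not> N h \<Longrightarrow> i \<in> exps T \<Longrightarrow> i + ex h \<in> exps (add_mset h T)"
  using exps_add[of T "{#h#}" i "ex h"] exps_single[of h] by simp

lemma exps_sum: "set_mset T \<subseteq> carrier G \<Longrightarrow> (\<And>h. h \<in># T \<Longrightarrow> \<not> N h) \<Longrightarrow> (\<Sum>h\<in>#T. ex h) \<in> exps T"
proof (induction T)
  case (add h T)
  then have "(\<Sum>h\<in>#T. ex h) + ex h \<in> exps (add_mset h T)" by (intro exps_add_mset) auto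
  then show ?case by (simp add: add.commute)
qed (simp add: exps_empty)

lemma mult_N_N:
  assumes "b \<in> carrier G" "N b" "b' \<in> carrier G" "N b'"
  shows "b \<otimes> b' = y [^] (half + s * ex b + ex b')"
proof -
  have "(x \<otimes> y [^] ex b) \<otimes> (x \<otimes> y [^] ex b') = y [^] (half + s * ex b + ex b')" by (rule xyxy)
  then show ?thesis using N_ex[OF assms(1,2)] N_ex[OF assms(3,4)] by metis
qed

lemma exps_pair:
  assumes "b \<in> carrier G" "N b" "b' \<in> carrier G" "N b'"
  shows "half + s * ex b + ex b' \<in> exps {#b, b'#}"
  using mult_N_N[OF assms] assms
  by (auto simp: exps_def prods_def intro!: exI[of _ "[b, b']"])

text \<open>A term of \<open>H\<close> inserted directly behind the first term outside \<open>H\<close> contributes its \<open>s\<close>-th power.\<close>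

lemma exps_add_mset_twisted:
  assumes T: "set_mset T \<subseteq> carrier G" "b \<in># T" "N b" and h: "h \<in> carrier G" "\<not> N h" and i: "i \<in> exps T"
  shows "i + s * ex h \<in> exps (add_mset h T)"
proof -
  obtain zs where zs: "mset zs = T" "y [^] i = list_prod G zs" using i by (auto simp: exps_def prods_def)
  have "\<exists>b\<in>set zs. N b" using T zs(1) by (metis set_mset_mset)
  then obtain us c vs where zs_eq: "zs = us @ c # vs" "N c" "\<forall>u\<in>set us. \<not> N u"
    using split_list_first_prop[of zs N] by blast
  have cl: "set us \<subseteq> carrier G" "c \<in> carrier G" "set vs \<subseteq> carrier G"
    using T(1) zs(1) zs_eq(1) by auto
  have "\<exists>a::int. list_prod G us = y [^] a" using cl(1) zs_eq(3)
  proof (induction us)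
    case Nil
    then show ?case by (auto intro: exI[of _ 0])
  next
    case (Cons u us)
    then obtain a :: int where "list_prod G us = y [^] a" by auto
    moreover have "u = y [^] ex u" using Cons.prems by (intro H_ex) auto
    ultimately show ?case using yy[of "ex u" a] by auto
  qed
  then obtain a :: int where a: "list_prod G us = y [^] a" by blast
  define v where "v = list_prod G vs"
  have v: "v \<in> carrier G" unfolding v_def by (rule list_prod_closed[OF cl(3)])
  have prod: "y [^] i = y [^] a \<otimes> (c \<otimes> v)"
    using zs(2) cl a by (simp add: zs_eq(1) list_prod_append v_def)
  \<comment> \<open>The whole product and the product of \<open>us\<close> lie in \<open>H\<close>,
    but \<open>c\<close> does not; so the tail \<open>v\<close> is outside \<open>H\<close>, and
    moving \<open>h\<close> past it raises \<open>h\<close> to its \<open>s\<close>-th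
    power.\<close>
  have "N v"
  proof (rule ccontr)
    assume "\<not> N v"
    then have "c \<otimes> v = x \<otimes> y [^] (ex c + ex v)"
      using H_ex[OF v] N_ex[OF cl(2) zs_eq(2)] by (metis xyy)
    then have "y [^] i = x \<otimes> y [^] (s * a + (ex c + ex v))" using prod yxy by simp
    then show False using N_x_pow not_N_pow by metis
  qed
  then have "h \<otimes> v = v \<otimes> y [^] (s * ex h)"
    using N_ex[OF v] H_ex[OF h] by (metis yxy xyy add.commute)
  then have "list_prod G (us @ c # h # vs) = y [^] a \<otimes> (c \<otimes> (v \<otimes> y [^] (s * ex h)))"
    using cl h a by (simp add: list_prod_append v_def)
  also have "\<dots> = y [^] i \<otimes> y [^] (s * ex h)" using v cl by (simp add: prod m_assoc)
  finally have "y [^] (i + s * ex h) = list_prod G (us @ c # h # vs)" by (simp add: yy)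
  moreover have "mset (us @ c # h # vs) = add_mset h T" using zs(1) zs_eq(1) by simp
  ultimately show ?thesis unfolding exps_def prods_def by blast
qed

end

section \<open>Pairs of terms of equal type\<close>

definition pairs_mset :: "('a \<times> 'a) list \<Rightarrow> 'a multiset" where
  "pairs_mset ps = (\<Sum>(a, b)\<leftarrow>ps. {#a, b#})"

lemma pairs_mset_simps [simp]:
  "pairs_mset [] = {#}" "pairs_mset ((a, b) # ps) = {#a, b#} + pairs_mset ps"
  "pairs_mset (ps @ ps') = pairs_mset ps + pairs_mset ps'"
  by (simp_all add: pairs_mset_def)

lemma size_pairs_mset [simp]: "size (pairs_mset ps) = 2 * length ps"
  by (induction ps) auto

lemma pair_decomposition:
  obtains ps L where "R = pairs_mset ps + L" "\<forall>(a, b)\<in>set ps. f a = f b"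
    "\<forall>t. count (image_mset f L) t \<le> 1"
proof -
  have "\<exists>ps L. R = pairs_mset ps + L \<and> (\<forall>(a, b)\<in>set ps. f a = f b) \<and> (\<forall>t. count (image_mset f L) t \<le> 1)"
  proof (induction R)
    case empty
    show ?case by (intro exI[of _ "[]"] exI[of _ "{#}"]) simp
  next
    case (add r R)
    then obtain ps L where IH: "R = pairs_mset ps + L" "\<forall>(a, b)\<in>set ps. f a = f b"
      "\<forall>t. count (image_mset f L) t \<le> 1" by blast
    show ?case
    proof (cases "f r \<in># image_mset f L")
      case True
      then obtain l where l: "l \<in># L" "f l = f r" by auto
      then obtain L' where L': "L = add_mset l L'" by (metis insert_DiffM)
      have "\<forall>t. count (image_mset f L') t \<le> 1"
      proof
        fix t
        have "count (image_mset f L') t \<le> count (image_mset f L) t" by (simp add: L')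
        then show "count (image_mset f L') t \<le> 1" using IH(3) le_trans by blast
      qed
      then show ?thesis using IH(1,2) l(2)
        by (intro exI[of _ "(r, l) # ps"] exI[of _ L']) (auto simp: L')
    next
      case False
      then have "count (image_mset f L) (f r) = 0" by (simp only: not_in_iff)
      then show ?thesis using IH
        by (intro exI[of _ ps] exI[of _ "add_mset r L"]) auto
    qed
  qed
  then show ?thesis using that by blast
qed

lemma size_le_card_types:
  assumes "\<forall>t. count (image_mset f L) t \<le> 1" "f ` set_mset L \<subseteq> A" "finite A"
  shows "size L \<le> card A"
proof -
  have "size L = size (image_mset f L)" by simp
  also have "\<dots> = (\<Sum>t\<in>f ` set_mset L. count (image_mset f L) t)" unfolding size_multiset_overloaded_eq by simp
  also have "\<dots> \<le> (\<Sum>t\<in>f ` set_mset L. 1)" by (intro sum_mono assms(1)[rule_format])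
  also have "\<dots> \<le> card A" using assms(2,3) by (simp add: card_mono)
  finally show ?thesis .
qed

text \<open>At most \<open>card A\<close> terms stay unpaired, which gives
  \<open>2 * length ps \<ge> 2 * k - 1\<close>; parity supplies the missing one.\<close>

lemma same_type_pairs:
  assumes "f ` set_mset R \<subseteq> A" "finite A" and sz: "2 * k + card A \<le> size R + 1"
  obtains ps where "length ps = k" "pairs_mset ps \<subseteq># R" "\<And>a b. (a, b) \<in> set ps \<Longrightarrow> f a = f b"
proof -
  obtain ps L where d: "R = pairs_mset ps + L" "\<forall>(a, b)\<in>set ps. f a = f b"
    "\<forall>t. count (image_mset f L) t \<le> 1" by (rule pair_decomposition[of R f])
  have "f ` set_mset L \<subseteq> A" using assms(1) d(1) by auto
  then have "size L \<le> card A" by (rule size_le_card_types[OF d(3) _ assms(2)])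
  then have len: "k \<le> length ps" using sz d(1) by simp
  have "pairs_mset ps = pairs_mset (take k ps) + pairs_mset (drop k ps)"
    by (simp flip: pairs_mset_simps(3))
  then have "pairs_mset (take k ps) \<subseteq># R" by (simp add: d(1))
  moreover have "f a = f b" if "(a, b) \<in> set (take k ps)" for a b using d(2) in_set_takeD[OF that] by auto
  ultimately show ?thesis using len that[of "take k ps"] by simp
qed

lemma subseteq_filter_disjoint:
  assumes "A \<subseteq># filter_mset P S" "B \<subseteq># filter_mset Q S" "\<And>x. P x \<Longrightarrow> \<not> Q x"
  shows "A + B \<subseteq># S"
proof (rule mset_subset_eqI)
  fix x
  have "count A x \<le> count (filter_mset P S) x" "count B x \<le> count (filter_mset Q S) x"
    using assms(1,2) by (auto intro: mset_subset_eq_count simp del: count_filter_mset)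
  then show "count (A + B) x \<le> count S x" using assms(3)[of x] by (auto split: if_splits)
qed

lemma obtain_two:
  assumes "2 \<le> size M"
  obtains u v where "{#u, v#} \<subseteq># M"
proof -
  obtain T where T: "T \<subseteq># M" "size T = 2" using assms by (rule obtain_submset_of_size)
  obtain xs where xs: "mset xs = T" using ex_mset by blast
  then obtain u v where "xs = [u, v]" using T(2) by (auto simp: numeral_2_eq_2 length_Suc_conv)
  then have "T = {#u, v#}" using xs by simp
  then show ?thesis using T(1) that by blast
qed

text \<open>Cauchy--Davenport for a two-element summand. Without growth the two translates of
  \<open>A\<close> coincide, so \<open>A\<close> is invariant under \<open>c - d\<close>, which
  generates the residues modulo the prime \<open>p\<close>; then \<open>A\<close> is
  everything.\<close>

lemma shift_two_grow:
  fixes p :: nat and A :: "int set"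
  assumes p: "Factorial_Ring.prime p" and A: "A \<subseteq> {0..<int p}" "A \<noteq> {}" and cd: "\<not> int p dvd c - d"
  shows "min p (card A + 1) \<le> card ((\<lambda>a. (a + c) mod int p) ` A \<union> (\<lambda>a. (a + d) mod int p) ` A)"
proof (rule ccontr)
  assume small: "\<not> ?thesis"
  have p0: "0 < int p" using p prime_gt_0_nat by simp
  define C where "C = (\<lambda>a. (a + c) mod int p) ` A"
  define D where "D = (\<lambda>a. (a + d) mod int p) ` A"
  have fA: "finite A" using A(1) finite_subset by blast
  have inj: "inj_on (\<lambda>a. (a + e) mod int p) A" for e
  proof (rule inj_onI)
    fix a b assume ab: "a \<in> A" "b \<in> A" "(a + e) mod int p = (b + e) mod int p"
    then have "int p dvd a - b" by (simp add: mod_eq_dvd_iff)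
    then have "a mod int p = b mod int p" by (simp add: mod_eq_dvd_iff)
    moreover have "a mod int p = a" "b mod int p = b" using ab(1,2) A(1) by (simp_all add: subset_iff)
    ultimately show "a = b" by simp
  qed
  have cards: "card C = card A" "card D = card A" unfolding C_def D_def by (simp_all add: card_image inj)
  have fin: "finite (C \<union> D)" using fA by (simp add: C_def D_def)
  have "card (C \<union> D) < card A + 1" "card (C \<union> D) < p" using small by (auto simp: C_def D_def)
  then have "C \<union> D = C" "C \<union> D = D"
    using card_subset_eq[OF fin, of C] card_subset_eq[OF fin, of D] cards card_mono[OF fin, of C] by auto
  then have CD: "C = D" by simp
  have step: "(a + (c - d)) mod int p \<in> A" if a: "a \<in> A" for a
  proof -
    have "(a + c) mod int p \<in> D" using a CD by (auto simp: C_def)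
    then obtain b where b: "b \<in> A" "(a + c) mod int p = (b + d) mod int p" by (auto simp: D_def)
    then have "(a + (c - d)) mod int p = b mod int p" by (simp add: mod_eq_dvd_iff algebra_simps)
    also have "b mod int p = b" using b(1) A(1) by (simp add: subset_iff)
    finally show ?thesis using b(1) by simp
  qed
  obtain a where a: "a \<in> A" using A(2) by blast
  have mul: "(a + int k * (c - d)) mod int p \<in> A" for k
  proof (induction k)
    case 0
    have "a mod int p = a" using a A(1) by (simp add: subset_iff)
    then show ?case using a by simp
  next
    case (Suc k)
    have "((a + int k * (c - d)) mod int p + (c - d)) mod int p = (a + int (Suc k) * (c - d)) mod int p"
      unfolding mod_add_left_eq by (simp add: algebra_simps)
    then show ?case using step[OF Suc] by simp
  qed
  have "inj_on (\<lambda>k. (a + int k * (c - d)) mod int p) {..<p}"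
  proof (rule inj_onI)
    fix k l assume kl: "k \<in> {..<p}" "l \<in> {..<p}"
      "(a + int k * (c - d)) mod int p = (a + int l * (c - d)) mod int p"
    then have "int p dvd (int k - int l) * (c - d)" by (simp add: mod_eq_dvd_iff left_diff_distrib)
    then have "int p dvd int k - int l" using cd p by (simp add: prime_dvd_mult_iff)
    then have "int k mod int p = int l mod int p" by (simp add: mod_eq_dvd_iff)
    then show "k = l" using kl(1,2) by simp
  qed
  then have "p = card ((\<lambda>k. (a + int k * (c - d)) mod int p) ` {..<p})" by (simp add: card_image)
  also have "\<dots> \<le> card A" using mul fA by (intro card_mono) auto
  also have "\<dots> \<le> card (C \<union> D)" using cards(1) card_mono[OF fin, of C] by simp
  finally show False using \<open>card (C \<union> D) < p\<close> by simp
qed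

context dicyclic_like
begin

text \<open>The class modulo the subgroup of even powers of \<open>y\<close>. The quotient is a
  Klein four-group, with componentwise exclusive or as its operation
  (\<open>ty_mult\<close>).\<close>

definition ty :: "'a \<Rightarrow> bool \<times> bool" where "ty g = (N g, odd (ex g))"

text \<open>A sequence with this property is a product-one sequence modulo the subgroup generated by the
  \<open>m\<close>-th power of the generator \<open>y\<close>.\<close>

definition block :: "nat \<Rightarrow> 'a multiset \<Rightarrow> bool" where
  "block m T \<longleftrightarrow> (\<exists>i\<in>exps T. int m dvd i)"

lemma block_add:
  "set_mset A \<subseteq> carrier G \<Longrightarrow> set_mset B \<subseteq> carrier G \<Longrightarrow> block m A \<Longrightarrow> block m B \<Longrightarrow> block m (A + B)"
  unfolding block_def using exps_add dvd_add by meson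

lemma block_pairs:
  assumes "\<And>a b. (a, b) \<in> set ps \<Longrightarrow> block m {#a, b#}" "set_mset (pairs_mset ps) \<subseteq> carrier G"
  shows "block m (pairs_mset ps)"
  using assms
proof (induction ps)
  case Nil
  then show ?case using exps_empty by (auto simp: block_def)
next
  case (Cons q ps)
  obtain a b where q: "q = (a, b)" by (cases q)
  show ?case unfolding q pairs_mset_simps
    using Cons by (intro block_add) (auto simp: q)
qed

lemma ty_UNIV: "ty ` A \<subseteq> UNIV" "finite (UNIV :: (bool \<times> bool) set)" "card (UNIV :: (bool \<times> bool) set) = 4"
  by (rule subset_UNIV, simp, simp add: card_UNIV_bool flip: UNIV_Times_UNIV)

end

section \<open>The dihedral quotient of order \<open>4 * p\<close> for an odd prime
  \<open>p\<close>\<close>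

locale odd_base = dicyclic_like +
  fixes p :: nat
  assumes p: "Factorial_Ring.prime p" "odd p" and p_half: "2 * int p dvd half" and p_s: "2 * int p dvd s + 1"
begin

lemma p3: "3 \<le> p"
  using p prime_ge_2_nat[of p] by (cases "p = 2") auto

lemma dvd_2p: "int p dvd i \<Longrightarrow> even i \<Longrightarrow> int (2 * p) dvd i"
proof -
  assume "int p dvd i" "even i"
  moreover have "coprime (2::int) (int p)" using p(2) by simp
  ultimately have "2 * int p dvd i" by (metis divides_mult)
  then show ?thesis by simp
qed

text \<open>Since \<open>s\<close> is \<open>-1\<close> modulo \<open>p\<close>, the factor
  \<open>s - 1\<close> is \<open>-2\<close>, a unit. So \<open>s * i\<close> differs from
  \<open>i\<close> modulo \<open>p\<close> unless \<open>p\<close> divides \<open>i\<close>.\<close>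

lemma p_dvd_twist: "int p dvd (s - 1) * i \<longleftrightarrow> int p dvd i"
proof -
  have ps: "int p dvd s + 1" using p_s by (rule dvd_mult_right)
  have "\<not> int p dvd s - 1"
  proof
    assume "int p dvd s - 1"
    then have "int p dvd (s + 1) - (s - 1)" using ps by (rule dvd_diff[rotated])
    then have "int p dvd 2" by simp
    then show False using p3 by (auto dest: zdvd_imp_le)
  qed
  then show ?thesis using p(1) by (simp add: prime_dvd_mult_iff)
qed

text \<open>A rotation modulo \<open>2 * p\<close> splits into a parity and a residue modulo
  \<open>p\<close>. \<open>Y\<close> keeps the residues of the products of trivial parity; a full
  \<open>Y\<close> contains \<open>0\<close> and so yields a block.\<close>

definition Y :: "'a multiset \<Rightarrow> int set" where
  "Y T = (\<lambda>i. i mod int p) ` {i \<in> exps T. even i}"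

lemma Y_sub: "Y T \<subseteq> {0..<int p}"
  using p3 by (auto simp: Y_def)

lemma finite_Y: "finite (Y T)"
  using Y_sub finite_subset by blast

lemma Y_full: "p \<le> card (Y T) \<Longrightarrow> block (2 * p) T"
proof -
  assume "p \<le> card (Y T)"
  then have "Y T = {0..<int p}" by (intro card_seteq) (use Y_sub in auto)
  then have "0 \<in> Y T" using p3 by simp
  then obtain i where i: "i \<in> exps T" "even i" "i mod int p = 0" by (auto simp: Y_def)
  then have "int (2 * p) dvd i" by (intro dvd_2p) (simp_all add: mod_0_imp_dvd)
  then show ?thesis unfolding block_def using i(1) by blast
qed

lemma Y_shift:
  assumes c: "\<And>i. i \<in> exps T \<Longrightarrow> i + c \<in> exps T'" "even c"
    and d: "\<And>i. i \<in> exps T \<Longrightarrow> i + d \<in> exps T'" "even d"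
  shows "card (Y T) \<le> card (Y T')"
    and "\<not> int p dvd c - d \<Longrightarrow> Y T \<noteq> {} \<Longrightarrow> min p (card (Y T) + 1) \<le> card (Y T')"
proof -
  have sub: "(\<lambda>a. (a + e) mod int p) ` Y T \<subseteq> Y T'"
    if e: "\<And>i. i \<in> exps T \<Longrightarrow> i + e \<in> exps T'" "even e" for e
  proof
    fix a assume "a \<in> (\<lambda>a. (a + e) mod int p) ` Y T"
    then obtain i where i: "i \<in> exps T" "even i" "a = (i mod int p + e) mod int p" by (auto simp: Y_def)
    then have "a = (i + e) mod int p" by (simp add: mod_add_left_eq)
    moreover have "i + e \<in> {i \<in> exps T'. even i}" using i e by simp
    ultimately show "a \<in> Y T'" unfolding Y_def by (rule image_eqI)
  qed
  have "card (Y T) = card ((\<lambda>a. (a + c) mod int p) ` Y T)"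
  proof (rule card_image[symmetric], rule inj_onI)
    fix a b assume ab: "a \<in> Y T" "b \<in> Y T" "(a + c) mod int p = (b + c) mod int p"
    then have "a mod int p = b mod int p" by (simp add: mod_eq_dvd_iff)
    moreover have "a mod int p = a" "b mod int p = b" using ab(1,2) Y_sub by (simp_all add: subset_iff)
    ultimately show "a = b" by simp
  qed
  also have "\<dots> \<le> card (Y T')" using sub[OF c] finite_Y by (simp add: card_mono)
  finally show "card (Y T) \<le> card (Y T')" .
  assume cd: "\<not> int p dvd c - d" "Y T \<noteq> {}"
  then have "min p (card (Y T) + 1) \<le> card ((\<lambda>a. (a + c) mod int p) ` Y T \<union> (\<lambda>a. (a + d) mod int p) ` Y T)"
    by (intro shift_two_grow[OF p(1) Y_sub])
  also have "\<dots> \<le> card (Y T')" using sub[OF c] sub[OF d] finite_Y by (simp add: card_mono)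
  finally show "min p (card (Y T) + 1) \<le> card (Y T')" .
qed

text \<open>Meant for pairs of equal type. Swapping two terms outside \<open>H\<close> changes the
  exponent by \<open>(s - 1) * (ex u - ex v)\<close>, twisting a term of \<open>H\<close> changes it
  by \<open>s - 1\<close> times its exponent; \<open>eff\<close> says that such a change is nonzero
  modulo \<open>p\<close>.\<close>

definition eff :: "'a \<Rightarrow> 'a \<Rightarrow> bool" where
  "eff u v \<longleftrightarrow> (if N u then \<not> int p dvd ex u - ex v else \<not> int p dvd ex u \<or> \<not> int p dvd ex v)"

text \<open>Each way of inserting the pair shifts all exponents by an even constant. An effective
  pair offers two shifts that differ modulo \<open>p\<close>, so \<open>shift_two_grow\<close>
  applies. The term \<open>b\<close> outside \<open>H\<close> is what allows a term of
  \<open>H\<close> to be twisted.\<close>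

lemma Y_pair:
  assumes T: "set_mset T \<subseteq> carrier G" "b \<in># T" "N b" and uv: "u \<in> carrier G" "v \<in> carrier G" "ty u = ty v"
  shows "card (Y T) \<le> card (Y (T + {#u, v#}))"
    and "eff u v \<Longrightarrow> Y T \<noteq> {} \<Longrightarrow> min p (card (Y T) + 1) \<le> card (Y (T + {#u, v#}))"
proof -
  have par: "even (ex u + ex v)" and Nuv: "N u \<longleftrightarrow> N v" using uv(3) by (auto simp: ty_def)
  have par': "even (s * ex u + ex v)" "even (ex u + s * ex v)" "even (half + s * ex u + ex v)" "even (half + s * ex v + ex u)"
    using par s_odd even_half by auto
  have "\<exists>c d. even c \<and> even d \<and> (\<forall>i\<in>exps T. i + c \<in> exps (T + {#u, v#}) \<and> i + d \<in> exps (T + {#u, v#})) \<and>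
      (eff u v \<longrightarrow> \<not> int p dvd c - d)"
  proof (cases "N u")
    case True
    then have Nv: "N v" using Nuv by simp
    have c: "half + s * ex u + ex v \<in> exps {#u, v#}" using exps_pair[OF uv(1) True uv(2) Nv] .
    have d: "half + s * ex v + ex u \<in> exps {#u, v#}" using exps_pair[OF uv(2) Nv uv(1) True] by (simp add: add_mset_commute)
    have df: "(half + s * ex u + ex v) - (half + s * ex v + ex u) = (s - 1) * (ex u - ex v)" by (simp add: algebra_simps)
    have uvc: "set_mset {#u, v#} \<subseteq> carrier G" using uv by simp
    have "\<not> int p dvd (half + s * ex u + ex v) - (half + s * ex v + ex u)" if "eff u v"
      using that True unfolding df p_dvd_twist eff_def by simp
    then show ?thesis using par'(3,4) exps_add[OF T(1) uvc _ c] exps_add[OF T(1) uvc _ d] by blast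
  next
    case False
    then have Nv: "\<not> N v" using Nuv by simp
    have cl: "set_mset (add_mset u T) \<subseteq> carrier G" using T(1) uv(1) by simp
    have c: "i + (ex u + ex v) \<in> exps (T + {#u, v#})" if i: "i \<in> exps T" for i
      using exps_add_mset[OF cl uv(2) Nv exps_add_mset[OF T(1) uv(1) False i]] by (simp add: add_mset_commute add.assoc)
    have d1: "i + (s * ex u + ex v) \<in> exps (T + {#u, v#})" if i: "i \<in> exps T" for i
      using exps_add_mset[OF cl uv(2) Nv exps_add_mset_twisted[OF T uv(1) False i]] by (simp add: add_mset_commute add.assoc)
    have d2: "i + (ex u + s * ex v) \<in> exps (T + {#u, v#})" if i: "i \<in> exps T" for i
      using exps_add_mset_twisted[OF cl _ T(3) uv(2) Nv exps_add_mset[OF T(1) uv(1) False i]] T(2)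
      by (simp add: add_mset_commute add.assoc)
    show ?thesis
    proof (cases "int p dvd ex u")
      case True
      have "(ex u + s * ex v) - (ex u + ex v) = (s - 1) * ex v" by (simp add: algebra_simps)
      then show ?thesis using True False c d2 par par' p_dvd_twist[of "ex v"]
        by (intro exI[of _ "ex u + s * ex v"] exI[of _ "ex u + ex v"]) (auto simp: eff_def)
    next
      case dvd: False
      have "(s * ex u + ex v) - (ex u + ex v) = (s - 1) * ex u" by (simp add: algebra_simps)
      then show ?thesis using dvd False c d1 par par' p_dvd_twist[of "ex u"]
        by (intro exI[of _ "s * ex u + ex v"] exI[of _ "ex u + ex v"]) (auto simp: eff_def)
    qed
  qed
  then obtain c d where cd: "even c" "even d" "\<And>i. i \<in> exps T \<Longrightarrow> i + c \<in> exps (T + {#u, v#})"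
    "\<And>i. i \<in> exps T \<Longrightarrow> i + d \<in> exps (T + {#u, v#})" "eff u v \<Longrightarrow> \<not> int p dvd c - d" by blast
  show "card (Y T) \<le> card (Y (T + {#u, v#}))" by (rule Y_shift(1)[OF cd(3,1,4,2)])
  show "min p (card (Y T) + 1) \<le> card (Y (T + {#u, v#}))" if "eff u v" "Y T \<noteq> {}"
    by (rule Y_shift(2)[OF cd(3,1,4,2) cd(5)[OF that(1)] that(2)])
qed

text \<open>Modulo \<open>2 * p\<close> an ineffective pair consists of two equal reflections, or of
  two equal rotations of order at most two. So running out of effective pairs produces blocks as
  well.\<close>

lemma zero_pair:
  assumes uv: "u \<in> carrier G" "v \<in> carrier G" "ty u = ty v" and ne: "\<not> eff u v"
  shows "block (2 * p) {#u, v#}"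
proof -
  have par: "even (ex u + ex v)" "even (ex v - ex u)" and Nuv: "N u \<longleftrightarrow> N v" using uv(3) by (auto simp: ty_def)
  show ?thesis
  proof (cases "N u")
    case True
    have "int p dvd ex v - ex u" using ne True by (simp add: eff_def dvd_diff_commute)
    then have "2 * int p dvd ex v - ex u" using dvd_2p[OF _ par(2)] by simp
    then have "2 * int p dvd half + (s + 1) * ex u + (ex v - ex u)"
      using dvd_add[OF p_half dvd_mult2[OF p_s, of "ex u"]] by (rule dvd_add[rotated])
    then have "int (2 * p) dvd half + s * ex u + ex v" by (simp add: algebra_simps)
    then show ?thesis unfolding block_def using exps_pair[OF uv(1) True uv(2)] True Nuv by blast
  next
    case False
    have "int p dvd ex u + ex v" using ne False by (simp add: eff_def)
    then have "int (2 * p) dvd ex u + ex v" using dvd_2p par(1) by blast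
    moreover have "ex u + ex v \<in> exps {#u, v#}"
      using exps_sum[of "{#u, v#}"] uv False Nuv by auto
    ultimately show ?thesis unfolding block_def by blast
  qed
qed

text \<open>Each effective pair costs two terms and enlarges \<open>Y\<close>, so \<open>Y\<close> is full before \<open>2 p\<close> terms are spent,
  unless at some stage no effective pair is left.\<close>

lemma greedy:
  assumes S: "set_mset S \<subseteq> carrier G" "size S = 4 * p - 1"
    and T0: "T0 \<subseteq># S" "b \<in># T0" "N b" "size T0 = 2 * t0" "min p (t0 + j) \<le> card (Y T0)" "1 \<le> t0" "t0 \<le> p"
    and stuck: "\<And>T t. T0 \<subseteq># T \<Longrightarrow> T \<subseteq># S \<Longrightarrow> size T = 2 * t \<Longrightarrow> t + j < p \<Longrightarrow>
      (\<And>u v. {#u, v#} \<subseteq># S - T \<Longrightarrow> ty u = ty v \<Longrightarrow> \<not> eff u v) \<Longrightarrow> \<exists>B. B \<subseteq># S \<and> size B = 2 * p \<and> block (2 * p) B"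
  shows "\<exists>B. B \<subseteq># S \<and> size B = 2 * p \<and> block (2 * p) B"
proof (rule ccontr)
  assume none: "\<not> ?thesis"
  have "\<exists>T. T0 \<subseteq># T \<and> T \<subseteq># S \<and> size T = 2 * t \<and> min p (t + j) \<le> card (Y T)" if "t0 \<le> t" "t \<le> p" for t
    using that
  proof (induction t rule: dec_induct)
    case base
    then show ?case using T0 by blast
  next
    case (step t)
    then obtain T where T: "T0 \<subseteq># T" "T \<subseteq># S" "size T = 2 * t" "min p (t + j) \<le> card (Y T)" by auto
    have Tc: "set_mset T \<subseteq> carrier G" and bT: "b \<in># T"
      using T(1,2) S(1) T0(2) by (meson mset_subset_eqD subset_iff set_mset_mono)+
    have "card (Y T) \<noteq> 0" using T(4) step T0(6) p3 by (auto simp: min_def split: if_splits)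
    then have ne: "Y T \<noteq> {}" by auto
    \<comment> \<open>Once \<open>Y\<close> is full, any pair of equal type serves to reach length
      \<open>2 * p\<close>; at least \<open>2 * p + 1\<close> terms remain, and they contain
      one.\<close>
    have "\<exists>u v. {#u, v#} \<subseteq># S - T \<and> ty u = ty v \<and> (eff u v \<or> p \<le> card (Y T))"
    proof (cases "p \<le> card (Y T)")
      case True
      have "2 * 1 + card (UNIV :: (bool \<times> bool) set) \<le> size (S - T) + 1"
        using S(2) T(2,3) step ty_UNIV(3) p3 by (simp add: size_Diff_submset)
      then obtain ps where ps: "length ps = 1" "pairs_mset ps \<subseteq># S - T" "\<And>a b. (a, b) \<in> set ps \<Longrightarrow> ty a = ty b"
        using same_type_pairs[of ty "S - T" UNIV 1] ty_UNIV(2) by blast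
      then obtain u v where "ps = [(u, v)]" by (metis length_0_conv length_Suc_conv One_nat_def surj_pair)
      then show ?thesis using ps True by auto
    next
      case False
      then have "t + j < p" using T(4) by linarith
      then show ?thesis using stuck[OF T(1-3)] none by blast
    qed
    then obtain u v where uv: "{#u, v#} \<subseteq># S - T" "ty u = ty v" "eff u v \<or> p \<le> card (Y T)" by blast
    have "T + {#u, v#} \<subseteq># T + (S - T)" using uv(1) by (simp only: mset_subset_eq_mono_add_left_cancel)
    then have sub: "T + {#u, v#} \<subseteq># S" using T(2) by simp
    have uvc: "u \<in> carrier G" "v \<in> carrier G" using set_mset_mono[OF sub] S(1) by auto
    have "min p (Suc t + j) \<le> card (Y (T + {#u, v#}))"
      using uv(3) Y_pair[OF Tc bT T0(3) uvc uv(2)] ne T(4) by (auto simp: min_def split: if_splits)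
    moreover have "T0 \<subseteq># T + {#u, v#}" using T(1) subset_mset.order_trans mset_subset_eq_add_left by blast
    moreover have "size (T + {#u, v#}) = 2 * Suc t" using T(3) by simp
    ultimately show ?case using sub by blast
  qed
  from this[of p] obtain T where "T \<subseteq># S" "size T = 2 * p" "p \<le> card (Y T)" using T0(7) by auto
  then show False using none Y_full by blast
qed

end

section \<open>Sequences over dihedral quotients\<close>

context odd_base
begin

lemma zero_pairs_block:
  assumes S: "set_mset S \<subseteq> carrier G" and ps: "pairs_mset ps \<subseteq># S" "\<forall>(a, b)\<in>set ps. ty a = ty b"
    and none: "\<And>u v. {#u, v#} \<subseteq># S \<Longrightarrow> ty u = ty v \<Longrightarrow> \<not> eff u v"
  shows "block (2 * p) (pairs_mset ps)"
proof (rule block_pairs)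
  show cl: "set_mset (pairs_mset ps) \<subseteq> carrier G" using set_mset_mono[OF ps(1)] S by blast
  fix a b assume ab: "(a, b) \<in> set ps"
  have "{#a, b#} \<subseteq># pairs_mset ps" using ab
  proof (induction ps)
    case (Cons q ps)
    show ?case
    proof (cases "q = (a, b)")
      case True
      then show ?thesis by simp
    next
      case False
      then have "{#a, b#} \<subseteq># pairs_mset ps" using Cons by simp
      moreover have "pairs_mset ps \<subseteq># pairs_mset (q # ps)" by (cases q) simp
      ultimately show ?thesis by (rule subset_mset.order_trans)
    qed
  qed simp
  then have sub: "{#a, b#} \<subseteq># S" using ps(1) by (rule subset_mset.order_trans)
  have "ty a = ty b" using ps(2) ab by auto
  then show "block (2 * p) {#a, b#}" using zero_pair[of a b] none[OF sub] set_mset_mono[OF sub] S by auto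
qed

lemma base_same_type:
  assumes S: "set_mset S \<subseteq> carrier G" "size S = 4 * p - 1"
    and bb: "{#b, b'#} \<subseteq># S" "N b" "ty b = ty b'"
  shows "\<exists>B. B \<subseteq># S \<and> size B = 2 * p \<and> block (2 * p) B"
proof -
  \<comment> \<open>The lead of \<open>card (Y T)\<close> over the number of pairs: an effective
    first pair already gives two residues. With this lead a standstill comes while enough terms
    remain for \<open>p\<close> ineffective pairs; without it only \<open>p - 1\<close> are
    guaranteed, and \<open>{#b, b'#}\<close> is the missing one.\<close>
  define j :: nat where "j = (if eff b b' then 1 else 0)"
  have bc: "b \<in> carrier G" "b' \<in> carrier G" using set_mset_mono[OF bb(1)] S(1) by auto
  have Nb': "N b'" using bb(2,3) by (simp add: ty_def)
  have ev: "even (half + s * ex b + ex b')" "even (half + s * ex b' + ex b)"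
    using bb(3) even_half s_odd by (auto simp: ty_def)
  have e1: "half + s * ex b + ex b' \<in> exps {#b, b'#}" using exps_pair[OF bc(1) bb(2) bc(2) Nb'] .
  have e2: "half + s * ex b' + ex b \<in> exps {#b, b'#}"
    using exps_pair[OF bc(2) Nb' bc(1) bb(2)] by (simp add: add_mset_commute)
  define c where "c = (half + s * ex b + ex b') mod int p"
  define d where "d = (half + s * ex b' + ex b) mod int p"
  have cd: "c \<in> Y {#b, b'#}" "d \<in> Y {#b, b'#}" using e1 e2 ev by (auto simp: Y_def c_def d_def)
  have card: "min p (1 + j) \<le> card (Y {#b, b'#})"
  proof (cases "eff b b'")
    case True
    have "(half + s * ex b + ex b') - (half + s * ex b' + ex b) = (s - 1) * (ex b - ex b')" by (simp add: algebra_simps)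
    then have "c \<noteq> d" using True bb(2) p_dvd_twist[of "ex b - ex b'"]
      unfolding c_def d_def by (simp add: mod_eq_dvd_iff eff_def)
    then have "card {c, d} = 2" by simp
    moreover have "card {c, d} \<le> card (Y {#b, b'#})" using cd finite_Y by (intro card_mono) auto
    ultimately show ?thesis using True by (simp add: j_def min.coboundedI2)
  next
    case False
    have "card {c} \<le> card (Y {#b, b'#})" using cd finite_Y by (intro card_mono) auto
    then show ?thesis using False by (simp add: j_def)
  qed
  show ?thesis
  proof (rule greedy[OF S bb(1) _ bb(2) _ card])
    fix T t
    assume T: "{#b, b'#} \<subseteq># T" "T \<subseteq># S" "size T = 2 * t" "t + j < p"
      and none: "\<And>u v. {#u, v#} \<subseteq># S - T \<Longrightarrow> ty u = ty v \<Longrightarrow> \<not> eff u v"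
    have szR: "size (S - T) = 4 * p - 1 - 2 * t" using S(2) T(2,3) by (simp add: size_Diff_submset)
    have clR: "set_mset (S - T) \<subseteq> carrier G" using S(1) by (meson in_diffD subset_iff)
    obtain ps where ps: "length ps = p - 1 + j" "pairs_mset ps \<subseteq># S - T" "\<And>a b. (a, b) \<in> set ps \<Longrightarrow> ty a = ty b"
    proof (rule same_type_pairs[of ty "S - T" UNIV "p - 1 + j"])
      show "2 * (p - 1 + j) + card (UNIV :: (bool \<times> bool) set) \<le> size (S - T) + 1"
        using szR T(4) p3 ty_UNIV(3) by (simp add: j_def split: if_splits)
    qed (use ty_UNIV(2) in auto)
    have blk: "block (2 * p) (pairs_mset ps)" by (rule zero_pairs_block[OF clR ps(2)]) (use ps(3) none in auto)
    show "\<exists>B. B \<subseteq># S \<and> size B = 2 * p \<and> block (2 * p) B"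
    proof (cases "eff b b'")
      case True
      then have "size (pairs_mset ps) = 2 * p" using ps(1) p3 by (simp add: j_def)
      moreover have "pairs_mset ps \<subseteq># S" using ps(2) by (rule subset_mset.order_trans) (rule diff_subset_eq_self)
      ultimately show ?thesis using blk by blast
    next
      case False
      have "block (2 * p) {#b, b'#}" by (rule zero_pair[OF bc bb(3) False])
      then have "block (2 * p) ({#b, b'#} + pairs_mset ps)"
        using blk set_mset_mono[OF ps(2)] clR bc by (intro block_add) auto
      moreover have "{#b, b'#} + pairs_mset ps \<subseteq># T + (S - T)" using T(1) ps(2) by (rule subset_mset.add_mono)
      moreover have "size ({#b, b'#} + pairs_mset ps) = 2 * p" using ps(1) False p3 by (simp add: j_def)
      ultimately show ?thesis using T(2) by (metis subset_mset.add_diff_inverse)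
    qed
  qed (use p3 in auto)
qed

text \<open>As the types differ, \<open>b\<close> and \<open>b'\<close> have a product of odd
  exponent in either order. Two terms of \<open>H\<close> of different parity repair this, provided
  one of them can be twisted effectively; if there are none, the terms of \<open>H\<close> alone
  suffice.\<close>

lemma base_few_N:
  assumes S: "set_mset S \<subseteq> carrier G" "size S = 4 * p - 1"
    and NN: "filter_mset N S = {#b, b'#}" and ty: "ty b \<noteq> ty b'"
  shows "\<exists>B. B \<subseteq># S \<and> size B = 2 * p \<and> block (2 * p) B"
proof -
  define R where "R = filter_mset (\<lambda>g. \<not> N g) S"
  have SR: "S = {#b, b'#} + R" using multiset_partition[of S N] NN by (simp add: R_def)
  have RS: "R \<subseteq># S" by (simp add: R_def)
  have bN: "N b" "N b'" using NN by (metis filter_mset_eq_conv union_single_eq_member add_mset_commute)+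
  have bc: "b \<in> carrier G" "b' \<in> carrier G" "set_mset R \<subseteq> carrier G" using S(1) by (auto simp: SR)
  have RH: "\<not> N g" if "g \<in># R" for g using that by (simp add: R_def)
  have szR: "size R = 4 * p - 3" using S(2) by (simp add: SR)
  define A where "A = {(False, False), (False, True)}"
  have tyR: "ty ` set_mset R' \<subseteq> A" if "R' \<subseteq># R" for R'
    using RH mset_subset_eqD[OF that] by (auto simp: ty_def A_def)
  have A: "finite A" "card A = 2" by (auto simp: A_def)
  show ?thesis
  proof (cases "\<exists>h h'. h \<in># R \<and> h' \<in># R \<and> \<not> int p dvd ex h \<and> ty h \<noteq> ty h'")
    case True
    then obtain h h' where h: "h \<in># R" "h' \<in># R" "\<not> int p dvd ex h" "ty h \<noteq> ty h'" by blast
    have "h' \<in># R - {#h#}" using h(2,4) by (metis in_diff_count count_greater_zero_iff count_single diff_zero)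
    then have hh: "{#h, h'#} \<subseteq># R" using h(1)
      by (metis insert_subset_eq_iff single_subset_iff)
    have hc: "h \<in> carrier G" "h' \<in> carrier G" using h bc by auto
    define T0 where "T0 = add_mset h' (add_mset h {#b, b'#})"
    have T0S: "T0 \<subseteq># S"
    proof -
      have "{#b, b'#} + {#h, h'#} \<subseteq># S" unfolding SR using hh by simp
      then show ?thesis by (simp add: T0_def add_mset_commute)
    qed
    define i where "i = half + s * ex b + ex b'"
    have i: "i \<in> exps {#b, b'#}" unfolding i_def by (rule exps_pair[OF bc(1) bN(1) bc(2) bN(2)])
    have odd_i: "odd i" using ty bN even_half s_odd by (auto simp: i_def ty_def)
    have odd_h: "odd (ex h + ex h')" using h(4) RH h(1,2) by (auto simp: ty_def)
    have cl: "set_mset {#b, b'#} \<subseteq> carrier G" "set_mset (add_mset h {#b, b'#}) \<subseteq> carrier G" using bc hc by auto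
    have c: "i + ex h + ex h' \<in> exps T0" unfolding T0_def
      by (rule exps_add_mset[OF cl(2) hc(2) RH[OF h(2)] exps_add_mset[OF cl(1) hc(1) RH[OF h(1)] i]])
    have d: "i + s * ex h + ex h' \<in> exps T0" unfolding T0_def
      by (rule exps_add_mset[OF cl(2) hc(2) RH[OF h(2)] exps_add_mset_twisted[OF cl(1) _ bN(1) hc(1) RH[OF h(1)] i]]) simp
    have "even (i + ex h + ex h')" "even (i + s * ex h + ex h')" using odd_i odd_h s_odd by auto
    then have in_Y: "(i + ex h + ex h') mod int p \<in> Y T0" "(i + s * ex h + ex h') mod int p \<in> Y T0"
      using c d by (auto simp: Y_def)
    have "(i + s * ex h + ex h') - (i + ex h + ex h') = (s - 1) * ex h" by (simp add: algebra_simps)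
    then have "(i + s * ex h + ex h') mod int p \<noteq> (i + ex h + ex h') mod int p"
      using h(3) p_dvd_twist[of "ex h"] by (simp only: mod_eq_dvd_iff) simp
    then have "card {(i + ex h + ex h') mod int p, (i + s * ex h + ex h') mod int p} = 2" by auto
    moreover have "card {(i + ex h + ex h') mod int p, (i + s * ex h + ex h') mod int p} \<le> card (Y T0)"
      using in_Y finite_Y by (intro card_mono) auto
    \<comment> \<open>Four terms give two residues, so there is no lead here. But all remaining
      terms lie in \<open>H\<close> and have only two types, which saves the missing pair.\<close>
    ultimately have card: "min p (2 + 0) \<le> card (Y T0)" by linarith
    show ?thesis
    proof (rule greedy[OF S T0S _ bN(1) _ card])
      fix T t
      assume T: "T0 \<subseteq># T" "T \<subseteq># S" "size T = 2 * t" "t + 0 < p"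
        and none: "\<And>u v. {#u, v#} \<subseteq># S - T \<Longrightarrow> ty u = ty v \<Longrightarrow> \<not> eff u v"
      have szR: "size (S - T) = 4 * p - 1 - 2 * t" using S(2) T(2,3) by (simp add: size_Diff_submset)
      have clR: "set_mset (S - T) \<subseteq> carrier G" using S(1) by (meson in_diffD subset_iff)
      have "{#b, b'#} \<subseteq># T0" by (simp add: T0_def)
      then have "{#b, b'#} \<subseteq># T" using T(1) by (rule subset_mset.order_trans)
      then have subR: "S - T \<subseteq># R" using SR by (metis subset_eq_diff_conv subset_mset.add_left_mono union_commute)
      obtain ps where ps: "length ps = p" "pairs_mset ps \<subseteq># S - T" "\<And>a b. (a, b) \<in> set ps \<Longrightarrow> ty a = ty b"
        by (rule same_type_pairs[OF tyR[OF subR] A(1), of p]) (use szR T(4) A(2) in auto)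
      have "block (2 * p) (pairs_mset ps)" by (rule zero_pairs_block[OF clR ps(2)]) (use ps(3) none in auto)
      moreover have "pairs_mset ps \<subseteq># S" using ps(2) by (rule subset_mset.order_trans) (rule diff_subset_eq_self)
      ultimately show "\<exists>B. B \<subseteq># S \<and> size B = 2 * p \<and> block (2 * p) B" using ps(1) by auto
    qed (use p3 in \<open>auto simp: T0_def\<close>)
  next
    case none: False
    show ?thesis
    proof (cases "\<exists>h\<in>#R. \<not> int p dvd ex h")
      case False
      obtain ps where ps: "length ps = p" "pairs_mset ps \<subseteq># R" "\<And>a b. (a, b) \<in> set ps \<Longrightarrow> ty a = ty b"
        by (rule same_type_pairs[OF tyR[OF subset_mset.order_refl] A(1), of p]) (use szR p3 A(2) in auto)
      have "block (2 * p) (pairs_mset ps)"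
      proof (rule zero_pairs_block[OF bc(3) ps(2)])
        fix u v assume "{#u, v#} \<subseteq># R"
        then have "u \<in># R" "v \<in># R" by (auto dest: mset_subset_eqD)
        then show "\<not> eff u v" using False RH by (auto simp: eff_def)
      qed (use ps(3) in auto)
      moreover have "pairs_mset ps \<subseteq># S" using ps(2) RS by (rule subset_mset.order_trans)
      ultimately show ?thesis using ps(1) by auto
    next
      case True
      then obtain h where h: "h \<in># R" "\<not> int p dvd ex h" by blast
      \<comment> \<open>All terms of \<open>H\<close> share the parity of \<open>h\<close>. Two
        disjoint zero-sums modulo \<open>p\<close> of length \<open>p\<close> have
        \<open>2 * p\<close> terms together and hence an even sum.\<close>
      have same: "even (ex g - ex h)" if "g \<in># R" for g
        using none h that RH by (auto simp: ty_def)
      obtain T1 where T1: "T1 \<subseteq># R" "size T1 = p" "zero_sum p ex T1"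
        by (rule erdos_ginzburg_ziv[of p R ex]) (use szR p3 in auto)
      obtain T2 where T2: "T2 \<subseteq># R - T1" "size T2 = p" "zero_sum p ex T2"
        by (rule erdos_ginzburg_ziv[of p "R - T1" ex]) (use szR p3 T1 in \<open>auto simp: size_Diff_submset\<close>)
      have sub: "T1 + T2 \<subseteq># R" using T1(1) T2(1) by (metis subset_mset.add_diff_inverse subset_mset.add_left_mono)
      have par: "even ((\<Sum>g\<in>#T. ex g) - int (size T) * ex h)" if "T \<subseteq># R" for T
        using that
      proof (induction T)
        case (add g T)
        have "g \<in># R" "T \<subseteq># R" using add.prems by (auto dest: mset_subset_eqD mset_subset_eq_insertD subset_mset.less_imp_le)
        then show ?case using add.IH same by (simp add: algebra_simps) 
      qed simp
      have "even (\<Sum>g\<in>#T1 + T2. ex g)" using par[OF sub] T1(2) T2(2) by simp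
      moreover have "int p dvd (\<Sum>g\<in>#T1 + T2. ex g)" using zero_sum_union[OF T1(3) T2(3)] by (simp add: zero_sum_def)
      ultimately have "int (2 * p) dvd (\<Sum>g\<in>#T1 + T2. ex g)" by (intro dvd_2p)
      moreover have "(\<Sum>g\<in>#T1 + T2. ex g) \<in> exps (T1 + T2)"
        by (rule exps_sum) (use mset_subset_eqD[OF sub] bc(3) RH in auto)
      ultimately have "block (2 * p) (T1 + T2)" unfolding block_def by blast
      moreover have "T1 + T2 \<subseteq># S" using sub RS by (rule subset_mset.order_trans)
      ultimately show ?thesis using T1(2) T2(2) by (intro exI[of _ "T1 + T2"]) simp
    qed
  qed
qed

lemma base_odd:
  assumes S: "set_mset S \<subseteq> carrier G" "size S = 4 * p - 1" and NN: "2 \<le> size (filter_mset N S)"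
  shows "\<exists>B. B \<subseteq># S \<and> size B = 2 * p \<and> block (2 * p) B"
proof (cases "\<exists>b b'. {#b, b'#} \<subseteq># filter_mset N S \<and> ty b = ty b'")
  case True
  then obtain b b' where bb: "{#b, b'#} \<subseteq># filter_mset N S" "ty b = ty b'" by blast
  then have "N b" by (auto dest: mset_subset_eqD)
  moreover have "{#b, b'#} \<subseteq># S" using bb(1) by (rule subset_mset.order_trans) simp
  ultimately show ?thesis using base_same_type[OF S] bb(2) by blast
next
  case False
  have tyN: "ty ` set_mset (filter_mset N S) \<subseteq> {(True, False), (True, True)}" by (auto simp: ty_def)
  have "size (filter_mset N S) \<le> 2"
  proof (rule ccontr)
    assume "\<not> ?thesis"
    then obtain ps where ps: "length ps = 1" "pairs_mset ps \<subseteq># filter_mset N S" "\<And>a b. (a, b) \<in> set ps \<Longrightarrow> ty a = ty b"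
      using same_type_pairs[OF tyN, of 1] by auto
    then obtain u v where "ps = [(u, v)]" by (metis length_0_conv length_Suc_conv One_nat_def surj_pair)
    then show False using ps False by auto
  qed
  then have two: "size (filter_mset N S) = 2" using NN by simp
  then obtain b b' where "{#b, b'#} \<subseteq># filter_mset N S" using obtain_two[of "filter_mset N S"] by auto
  then obtain C where C: "filter_mset N S = {#b, b'#} + C" by (auto simp: subset_mset.le_iff_add)
  then have bb: "filter_mset N S = {#b, b'#}" using two by (simp add: C)
  then show ?thesis using base_few_N[OF S bb] False by auto
qed

end

context dicyclic_like
begin

lemma exps_pair_two_N:
  assumes b: "b \<in> carrier G" "N b" "b' \<in> carrier G" "N b'" and T: "set_mset T \<subseteq> carrier G" "i \<in> exps T"
  shows "i + (half + s * ex b + ex b') \<in> exps (T + {#b, b'#})" "i + (half + s * ex b' + ex b) \<in> exps (T + {#b, b'#})"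
proof -
  have cl: "set_mset {#b, b'#} \<subseteq> carrier G" using b by simp
  have "half + s * ex b' + ex b \<in> exps {#b, b'#}" using exps_pair[OF b(3,4,1,2)] by (simp add: add_mset_commute)
  then show "i + (half + s * ex b + ex b') \<in> exps (T + {#b, b'#})" "i + (half + s * ex b' + ex b) \<in> exps (T + {#b, b'#})"
    using exps_add[OF T(1) cl T(2)] exps_pair[OF b] by auto
qed

end

section \<open>The dihedral quotient of order eight\<close>

locale four_base = dicyclic_like +
  assumes four_half: "4 dvd half" and four_s: "4 dvd s + 1"
begin

lemma dvd4_cases:
  assumes "even i" "4 dvd (i - j) - 2"
  shows "(4::int) dvd i \<or> 4 dvd j"
  using assms by presburger

lemma block4I: "i \<in> exps T \<Longrightarrow> 4 dvd i \<Longrightarrow> block 4 T"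
  unfolding block_def by auto

text \<open>As \<open>s\<close> is \<open>-1\<close> modulo \<open>4\<close>, twisting an odd
  \<open>i\<close> moves it by \<open>-2 * i\<close>, which is \<open>2\<close> modulo
  \<open>4\<close>. By \<open>dvd4_cases\<close> one of two even exponents related in this way is
  divisible by \<open>4\<close>; all blocks that need a change of order arise so.\<close>

lemma twist4: "odd i \<Longrightarrow> 4 dvd (s * i - i) - 2" "4 dvd s * i + i"
proof -
  obtain k where k: "s + 1 = 4 * k" using four_s by blast
  then have s: "s = 4 * k - 1" by linarith
  show "4 dvd s * i + i" unfolding s by (simp add: left_diff_distrib)
  assume "odd i"
  then obtain l where "i = 2 * l + 1" by (rule oddE)
  then have "(s * i - i) - 2 = 4 * (k * i - l - 1)" unfolding s by (simp add: algebra_simps)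
  then show "4 dvd (s * i - i) - 2" by (metis dvd_triv_left)
qed

text \<open>The products of \<open>b'\<close>, \<open>c'\<close> and of \<open>b\<close>,
  \<open>c\<close> both have odd exponent, so the total is even; swapping \<open>b\<close> and
  \<open>c\<close> changes it by \<open>2\<close> modulo \<open>4\<close>.\<close>

lemma block_NN_NN:
  assumes cl: "set_mset {#b, b', c, c'#} \<subseteq> carrier G" and N: "N b" "N b'" "N c" "N c'"
    and par: "odd (ex b - ex c)" "odd (ex b' - ex c')"
  shows "block 4 {#b, b', c, c'#}"
proof -
  have eq: "{#b', c'#} + {#b, c#} = {#b, b', c, c'#}" by (simp add: add_mset_commute)
  have cl': "b \<in> carrier G" "b' \<in> carrier G" "c \<in> carrier G" "c' \<in> carrier G" "set_mset {#b', c'#} \<subseteq> carrier G" using cl by auto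
  define i where "i = half + s * ex b' + ex c'"
  have i: "i \<in> exps {#b', c'#}" unfolding i_def using cl' N by (intro exps_pair)
  have m: "i + (half + s * ex b + ex c) \<in> exps {#b, b', c, c'#}" "i + (half + s * ex c + ex b) \<in> exps {#b, b', c, c'#}"
    using exps_pair_two_N[OF cl'(1) N(1) cl'(3) N(3) cl'(5) i] unfolding eq by auto
  have "even (i + (half + s * ex b + ex c))" using par s_odd even_half by (auto simp: i_def)
  moreover have "4 dvd ((i + (half + s * ex b + ex c)) - (i + (half + s * ex c + ex b))) - 2"
    using twist4(1)[OF par(1)] by (simp add: algebra_simps)
  ultimately show ?thesis using dvd4_cases m block4I by blast
qed

lemma block_NN_HH:
  assumes cl: "set_mset {#b, b', h, h'#} \<subseteq> carrier G" and N: "N b" "N b'" "\<not> N h" "\<not> N h'"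
    and par: "odd (ex h)" "even (ex b + ex b' + ex h + ex h')"
  shows "block 4 {#b, b', h, h'#}"
proof -
  have eq: "add_mset h (add_mset h' {#b, b'#}) = {#b, b', h, h'#}" by (simp add: add_mset_commute)
  have cl': "b \<in> carrier G" "b' \<in> carrier G" "h \<in> carrier G" "h' \<in> carrier G" "set_mset {#b, b'#} \<subseteq> carrier G"
    "set_mset (add_mset h' {#b, b'#}) \<subseteq> carrier G" using cl by auto
  define i where "i = half + s * ex b + ex b' + ex h'"
  have "half + s * ex b + ex b' \<in> exps {#b, b'#}" using cl' N by (intro exps_pair)
  then have i: "i \<in> exps (add_mset h' {#b, b'#})" unfolding i_def using cl' N by (intro exps_add_mset)
  have m: "i + ex h \<in> exps {#b, b', h, h'#}" unfolding eq[symmetric] using cl' N i by (intro exps_add_mset)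
  have m': "i + s * ex h \<in> exps {#b, b', h, h'#}" unfolding eq[symmetric]
    by (rule exps_add_mset_twisted[OF cl'(6) _ N(1) cl'(3) N(3) i]) simp
  have "even (i + s * ex h)" using par s_odd even_half by (auto simp: i_def)
  moreover have "4 dvd ((i + s * ex h) - (i + ex h)) - 2" using twist4(1)[OF par(1)] by simp
  ultimately show ?thesis using dvd4_cases m m' block4I by blast
qed

text \<open>In the Klein four-group formed, modulo fourth powers, by the even powers of \<open>y\<close> and by one coset
  outside \<open>H\<close>, squares and the product of all four elements are trivial.\<close>

lemma block_klein:
  assumes S: "set_mset S \<subseteq> carrier G" and sz: "6 \<le> size S \<or> 5 \<le> size S \<and> (\<forall>g\<in>#S. N g = c)"
    and par: "\<And>g. g \<in># S \<Longrightarrow> \<not> N g \<Longrightarrow> even (ex g)" "\<And>g. g \<in># S \<Longrightarrow> N g \<Longrightarrow> odd (ex g) = e"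
  shows "\<exists>B. B \<subseteq># S \<and> size B = 4 \<and> block 4 B"
proof -
  define f where "f g = (N g, ex g mod 4)" for g
  obtain ps L where d: "S = pairs_mset ps + L" "\<forall>(a, b)\<in>set ps. f a = f b" "\<forall>t. count (image_mset f L) t \<le> 1"
    by (rule pair_decomposition)
  define k :: int where "k = (if e then 1 else 0)"
  have LS: "g \<in># S" if "g \<in># L" for g using that d(1) by simp
  have rng: "f g = (False, 0) \<or> f g = (False, 2) \<or> f g = (True, k) \<or> f g = (True, k + 2)" if "g \<in># S" for g
  proof (cases "N g")
    case True
    then have "odd (ex g) = e" using par(2) that by blast
    then have "ex g mod 4 = k \<or> ex g mod 4 = k + 2" unfolding k_def by (cases e) (simp, presburger)+
    then show ?thesis using True by (auto simp: f_def)
  next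
    case False
    then have "even (ex g)" using par(1) that by blast
    then have "ex g mod 4 = 0 \<or> ex g mod 4 = 2" by presburger
    then show ?thesis using False by (auto simp: f_def)
  qed
  define A where "A = {(False, 0), (False, 2), (True, k), (True, k + 2)}"
  have "f g \<in> A" if "g \<in># L" for g using rng[OF LS[OF that]] unfolding A_def by blast
  then have fL: "f ` set_mset L \<subseteq> A" by blast
  have A: "finite A" "card A = 4" by (auto simp: A_def)
  have L4: "size L \<le> 4" using size_le_card_types[OF d(3) fL A(1)] A(2) by simp
  have szd: "size S = 2 * length ps + size L" by (simp add: d(1))
  show ?thesis
  proof (cases "2 \<le> length ps")
    case True
    then obtain q1 q2 qs where "ps = q1 # q2 # qs" by (metis Suc_le_length_iff numeral_2_eq_2)
    then obtain a b a' b' where ps: "ps = (a, b) # (a', b') # qs" by (metis surj_pair)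
    have zp: "block 4 {#a, b#}" if "f a = f b" "a \<in> carrier G" "b \<in> carrier G" "a \<in># S" for a b
    proof (cases "N a")
      case True
      have Nb: "N b" and dv: "4 dvd ex b - ex a" using that(1) True by (auto simp: f_def mod_eq_dvd_iff dvd_diff_commute)
      have "4 dvd half + (s * ex a + ex a) + (ex b - ex a)" by (rule dvd_add[OF dvd_add[OF four_half twist4(2)] dv])
      then have "4 dvd half + s * ex a + ex b" by (simp add: algebra_simps)
      then show ?thesis by (rule block4I[OF exps_pair[OF that(2) True that(3) Nb]])
    next
      case False
      have Nb: "\<not> N b" and dv: "4 dvd ex b - ex a" using that(1) False by (auto simp: f_def mod_eq_dvd_iff dvd_diff_commute)
      have "even (ex a)" using par(1) that(4) False by blast
      then have "4 dvd ex a + ex b" using dv by presburger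
      moreover have "ex a + ex b \<in> exps {#a, b#}" using exps_sum[of "{#a, b#}"] that False Nb by auto
      ultimately show ?thesis by (intro block4I)
    qed
    have "a \<in># S" "a' \<in># S" by (simp_all add: d(1) ps)
    then have "block 4 ({#a, b#} + {#a', b'#})" using d(2) S
      by (intro block_add zp) (auto simp: d(1) ps)
    moreover have "{#a, b#} + {#a', b'#} \<subseteq># S" by (simp add: d(1) ps)
    ultimately show ?thesis by (intro exI[of _ "{#a, b#} + {#a', b'#}"]) simp
  next
    case False
    \<comment> \<open>There are fewer than two equal pairs. Five terms in one coset have only two
      values and exclude this; six terms force one pair and four distinct leftovers, the whole Klein
      group.\<close>
    have mixed: "6 \<le> size S"
    proof (rule ccontr)
      assume "\<not> ?thesis"
      then have Nc: "\<forall>g\<in>#S. N g = c" and "5 \<le> size S" using sz by auto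
      define A' where "A' = (if c then {(True, k), (True, k + 2)} else {(False, 0), (False, 2)})"
      have "f ` set_mset L \<subseteq> A'"
      proof
        fix t assume "t \<in> f ` set_mset L"
        then obtain g where g: "g \<in># L" "t = f g" by auto
        have "fst t = c" using g LS Nc by (simp add: f_def)
        then show "t \<in> A'" using rng[OF LS[OF g(1)]] g(2) by (auto simp: A'_def)
      qed
      moreover have "finite A'" "card A' = 2" by (auto simp: A'_def)
      ultimately have "size L \<le> 2" using size_le_card_types[OF d(3)] by metis
      then show False using szd \<open>5 \<le> size S\<close> False by simp
    qed
    then have szL: "size L = 4" using szd False L4 by linarith
    have inj: "image_mset f L = mset_set A"
    proof -
      have "image_mset f L \<subseteq># mset_set A"
      proof (rule mset_subset_eqI)
        fix t show "count (image_mset f L) t \<le> count (mset_set A) t"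
        proof (cases "t \<in> A")
          case True
          then show ?thesis using d(3)[rule_format, of t] A(1) by simp
        next
          case False
          then have "t \<notin># image_mset f L" using fL by auto
          then have "count (image_mset f L) t = 0" by (simp only: not_in_iff)
          then show ?thesis by simp
        qed
      qed
      moreover have "size (image_mset f L) = size (mset_set A)" using szL A by simp
      ultimately show ?thesis by (metis mset_subset_size nat_neq_iff subset_mset.le_neq_trans)
    qed
    have "image_mset f L = {#(False, 0), (False, 2), (True, k), (True, k + 2)#}" unfolding inj A_def by simp
    then obtain g1 g2 g3 g4 where L: "L = {#g1, g2, g3, g4#}" and
      g: "f g1 = (False, 0)" "f g2 = (False, 2)" "f g3 = (True, k)" "f g4 = (True, k + 2)"
      by (auto simp: msed_map_invR dest!: msed_map_invR)
    have cl: "set_mset L \<subseteq> carrier G" using LS S by auto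
    have Ng: "\<not> N g1" "\<not> N g2" "N g3" "N g4" using g by (auto simp: f_def)
    have m: "ex g1 mod 4 = 0" "ex g2 mod 4 = 2" "ex g3 mod 4 = k" "ex g4 mod 4 = k + 2" using g by (auto simp: f_def)
    have "ex g1 + ex g2 \<in> exps {#g1, g2#}" using exps_sum[of "{#g1, g2#}"] cl Ng by (auto simp: L)
    then have mem: "(ex g1 + ex g2) + (half + s * ex g3 + ex g4) \<in> exps ({#g1, g2#} + {#g3, g4#})"
      using cl Ng by (intro exps_pair_two_N) (auto simp: L)
    have d1: "4 dvd ex g1" using m(1) by presburger
    have d2: "4 dvd ex g2 + (ex g4 - ex g3)" using m by presburger
    have "4 dvd ex g1 + (ex g2 + (ex g4 - ex g3)) + half + (s * ex g3 + ex g3)"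
      by (rule dvd_add[OF dvd_add[OF dvd_add[OF d1 d2] four_half] twist4(2)])
    then have "4 dvd (ex g1 + ex g2) + (half + s * ex g3 + ex g4)" by (simp add: algebra_simps)
    then have "block 4 ({#g1, g2#} + {#g3, g4#})" by (rule block4I[OF mem])
    moreover have "{#g1, g2#} + {#g3, g4#} = L" by (rule multiset_eqI) (simp add: L)
    ultimately have "block 4 L" by metis
    then show ?thesis using szL d(1) by (intro exI[of _ L]) simp
  qed
qed

text \<open>Each configuration known to contain a block limits the numbers of terms of the four
  types. Seven terms, at least two of them outside \<open>H\<close>, cannot respect all limits,
  which is a matter of linear inequalities.\<close>

lemma base_four:
  assumes S: "set_mset S \<subseteq> carrier G" "size S = 7" and NN: "2 \<le> size (filter_mset N S)"
  shows "\<exists>B. B \<subseteq># S \<and> size B = 4 \<and> block 4 B"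
proof (rule ccontr)
  assume none: "\<not> ?thesis"
  have size4: "size {#u, v, w, z#} = 4" for u v w z :: 'a by simp
  define F where "F t = filter_mset (\<lambda>g. ty g = t) S" for t
  have F: "N g = fst t \<and> odd (ex g) = snd t \<and> g \<in> carrier G \<and> g \<in># S" if "g \<in># F t" for g t
    using that S(1) by (auto simp: F_def ty_def)
  have split: "S = F (False, False) + F (False, True) + F (True, False) + F (True, True)"
    by (rule multiset_eqI) (auto simp: F_def ty_def)
  have splitN: "filter_mset N S = F (True, False) + F (True, True)"
    by (rule multiset_eqI) (auto simp: F_def ty_def)
  have FF: "A + B \<subseteq># S" if "A \<subseteq># F t" "B \<subseteq># F t'" "t \<noteq> t'" for A B t t'
    by (rule subseteq_filter_disjoint[OF that(1,2)[unfolded F_def]]) (use that(3) in auto)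
  have szS: "size (F (False, False)) + size (F (False, True)) + size (F (True, False)) + size (F (True, True)) = 7"
    using split S(2) by (metis size_union)
  have szN: "2 \<le> size (F (True, False)) + size (F (True, True))" using NN splitN by simp
  have not1: "\<not> (2 \<le> size (F (True, False)) \<and> 2 \<le> size (F (True, True)))"
  proof
    assume "2 \<le> size (F (True, False)) \<and> 2 \<le> size (F (True, True))"
    then obtain b b' c c' where bc: "{#b, b'#} \<subseteq># F (True, False)" "{#c, c'#} \<subseteq># F (True, True)"
      using obtain_two by meson
    then have "b \<in># F (True, False)" "b' \<in># F (True, False)" "c \<in># F (True, True)" "c' \<in># F (True, True)"
      by (auto dest: mset_subset_eqD)
    note m = this[THEN F]
    have "block 4 {#b, b', c, c'#}" by (rule block_NN_NN) (use m in auto)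
    moreover have "{#b, b'#} + {#c, c'#} \<subseteq># S" by (rule FF[OF bc]) simp
    moreover have "{#b, b'#} + {#c, c'#} = {#b, b', c, c'#}" by (rule multiset_eqI) simp
    ultimately show False using none by (metis size4)
  qed
  have not2: "\<not> (2 \<le> size (F (True, e)) \<and> 2 \<le> size (F (False, True)))" for e
  proof
    assume "2 \<le> size (F (True, e)) \<and> 2 \<le> size (F (False, True))"
    then obtain b b' c c' where bc: "{#b, b'#} \<subseteq># F (True, e)" "{#c, c'#} \<subseteq># F (False, True)"
      using obtain_two by meson
    then have "b \<in># F (True, e)" "b' \<in># F (True, e)" "c \<in># F (False, True)" "c' \<in># F (False, True)"
      by (auto dest: mset_subset_eqD)
    note m = this[THEN F]
    have "block 4 {#b, b', c, c'#}" by (rule block_NN_HH) (use m in auto)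
    moreover have "{#b, b'#} + {#c, c'#} \<subseteq># S" by (rule FF[OF bc]) simp
    moreover have "{#b, b'#} + {#c, c'#} = {#b, b', c, c'#}" by (rule multiset_eqI) simp
    ultimately show False using none by (metis size4)
  qed
  have not3: "size (F (True, False)) = 0 \<or> size (F (True, True)) = 0 \<or> size (F (False, False)) = 0 \<or> size (F (False, True)) = 0"
  proof (rule ccontr)
    assume "\<not> ?thesis"
    then obtain b c h h' where m: "b \<in># F (True, False)" "c \<in># F (True, True)" "h \<in># F (False, True)" "h' \<in># F (False, False)"
      by (metis multiset_nonemptyE size_empty)
    note f = m[THEN F]
    have "block 4 {#b, c, h, h'#}" by (rule block_NN_HH) (use f in auto)
    moreover have "{#b, c, h, h'#} \<subseteq># S"
    proof -
      have "{#h'#} + {#h#} + {#b#} + {#c#} \<subseteq># S" unfolding split using m by (intro subset_mset.add_mono) auto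
      moreover have "{#h'#} + {#h#} + {#b#} + {#c#} = {#b, c, h, h'#}" by (rule multiset_eqI) simp
      ultimately show ?thesis by metis
    qed
    ultimately show False using none by (metis size4)
  qed
  have klein: "size (F (False, False)) + size (F (True, e)) \<le> 5 \<and> (size (F (False, False)) = 0 \<longrightarrow> size (F (True, e)) \<le> 4) \<and>
     (size (F (True, e)) = 0 \<longrightarrow> size (F (False, False)) \<le> 4)" for e
  proof (rule ccontr)
    assume big: "\<not> ?thesis"
    define K where "K = F (False, False) + F (True, e)"
    have KS: "K \<subseteq># S" unfolding K_def by (rule FF[of _ "(False, False)" _ "(True, e)"]) auto
    have "\<exists>B. B \<subseteq># K \<and> size B = 4 \<and> block 4 B"
    proof (rule block_klein[of K "size (F (False, False)) = 0" e])
      show "set_mset K \<subseteq> carrier G" using set_mset_mono[OF KS] S(1) by blast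
      show "6 \<le> size K \<or> 5 \<le> size K \<and> (\<forall>g\<in>#K. N g = (size (F (False, False)) = 0))"
        using big F by (auto simp: K_def)
      fix g assume g: "g \<in># K"
      show "\<not> N g \<Longrightarrow> even (ex g)" "N g \<Longrightarrow> odd (ex g) = e"
        using g F[of g "(False, False)"] F[of g "(True, e)"] by (auto simp: K_def)
    qed
    then show False using none KS subset_mset.order_trans by blast
  qed
  have odd_H: "size (F (False, True)) \<le> 4"
  proof (rule ccontr)
    assume big: "\<not> ?thesis"
    \<comment> \<open>For odd exponents, \<open>4\<close> divides a sum of four of them exactly if
      their \<open>w\<close> have an even sum, so two disjoint pairs with even sums of
      \<open>w\<close> are enough.\<close>
    define w where "w g = (ex g - 1) div 2" for g
    obtain T1 where T1: "T1 \<subseteq># F (False, True)" "size T1 = 2" "zero_sum 2 w T1"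
      by (rule erdos_ginzburg_ziv[of 2 "F (False, True)" w]) (use big in auto)
    obtain T2 where T2: "T2 \<subseteq># F (False, True) - T1" "size T2 = 2" "zero_sum 2 w T2"
      by (rule erdos_ginzburg_ziv[of 2 "F (False, True) - T1" w]) (use big T1 in \<open>auto simp: size_Diff_submset\<close>)
    have sub: "T1 + T2 \<subseteq># F (False, True)"
      using T1(1) T2(1) by (metis subset_mset.add_diff_inverse subset_mset.add_left_mono)
    have FS: "F (False, True) \<subseteq># S" by (simp add: F_def)
    have FT: "\<not> N g \<and> odd (ex g) \<and> g \<in> carrier G" if "g \<in># T1 + T2" for g
      using F[OF mset_subset_eqD[OF sub that]] by simp
    have sum: "(\<Sum>g\<in>#T. ex g) = int (size T) + 2 * (\<Sum>g\<in>#T. w g)" if "\<forall>g\<in>#T. odd (ex g)" for T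
      using that by (induction T) (auto simp: w_def elim!: oddE)
    have eq: "(\<Sum>g\<in>#T1 + T2. ex g) = int (size (T1 + T2)) + 2 * (\<Sum>g\<in>#T1 + T2. w g)"
      by (rule sum) (use FT in blast)
    obtain k where k: "(\<Sum>g\<in>#T1 + T2. w g) = int 2 * k"
      using zero_sum_union[OF T1(3) T2(3)] unfolding zero_sum_def by (rule dvdE)
    have "int (size (T1 + T2)) = 4" using T1(2) T2(2) by simp
    then have "(\<Sum>g\<in>#T1 + T2. ex g) = 4 * (1 + k)" unfolding eq k by simp
    then have "4 dvd (\<Sum>g\<in>#T1 + T2. ex g)" by (metis dvd_triv_left)
    moreover have "(\<Sum>g\<in>#T1 + T2. ex g) \<in> exps (T1 + T2)" by (rule exps_sum) (use FT in auto)
    ultimately have "block 4 (T1 + T2)" by (intro block4I)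
    moreover have "T1 + T2 \<subseteq># S" using sub FS by (rule subset_mset.order_trans)
    ultimately show False using none T1(2) T2(2) by (metis size_union numeral_Bit0)
  qed
  show False
    using szS szN not1 not2[of False] not2[of True] not3 klein[of False] klein[of True] odd_H by linarith
qed

end

section \<open>Lifting from the dihedral quotient\<close>

lemma sum_mset_mono_subseteq: "T \<subseteq># M \<Longrightarrow> \<Sum>\<^sub># T \<subseteq># \<Sum>\<^sub># (M :: 'a multiset multiset)"
  by (auto simp: subset_mset.le_iff_add)

context dicyclic_like
begin

lemma coprime_s_plus_one:
  assumes none: "\<And>p. Factorial_Ring.prime p \<Longrightarrow> odd p \<Longrightarrow> \<not> (int p dvd int n \<and> int p dvd s + 1)"
    and c: "odd c" "c dvd a" "a = int n \<and> d = s + 1 \<or> a = s + 1 \<and> d = int n"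
  shows "coprime c d"
proof (rule ccontr)
  assume "\<not> coprime c d"
  then have "gcd c d \<noteq> 1" by (simp add: coprime_iff_gcd_eq_1)
  then have "nat (gcd c d) \<noteq> 1" by simp
  then obtain p where p: "Factorial_Ring.prime p" "p dvd nat (gcd c d)" using prime_factor_nat by blast
  have "int p dvd int (nat (gcd c d))" using p(2) by (simp only: int_dvd_int_iff)
  then have pg: "int p dvd gcd c d" by simp
  then have pc: "int p dvd c" and pd: "int p dvd d" by simp_all
  have "odd p"
  proof
    assume "even p"
    then have "2 dvd int p" by simp
    then have "2 dvd c" using pc by (rule dvd_trans)
    then show False using c(1) by simp
  qed
  moreover have "int p dvd a" using pc c(2) by (rule dvd_trans)
  ultimately show False using none[OF p(1)] pd c(3) by auto
qed

text \<open>By contraposition: without such a modulus, \<open>n\<close> and \<open>s + 1\<close>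
  share no odd prime, and \<open>s + 1\<close> or \<open>half\<close> is twice an odd number. That
  odd part is prime to the other side, so it can be cancelled, and \<open>n\<close> dividing
  \<open>(s - 1) * (s + 1)\<close> yields that \<open>half\<close> divides
  \<open>s - 1\<close>.\<close>

lemma choose_modulus:
  assumes ne: "\<not> half dvd s - 1"
  shows "(4 dvd half \<and> 4 dvd s + 1) \<or>
    (\<exists>p. Factorial_Ring.prime p \<and> odd p \<and> 2 * int p dvd half \<and> 2 * int p dvd s + 1)"
proof (rule ccontr)
  assume neg: "\<not> ?thesis"
  have none: "\<not> (int p dvd int n \<and> int p dvd s + 1)" if p: "Factorial_Ring.prime p" "odd p" for p
  proof
    assume "int p dvd int n \<and> int p dvd s + 1"
    moreover obtain k where k: "int n = 4 * k" using n4 by (metis dvd_def int_dvd_int_iff of_nat_numeral)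
    moreover have cop: "coprime (int p) 2" and cop2: "coprime 2 (int p)" using p(2) by simp_all
    moreover have "4 * k = 2 * (2 * k)" by simp
    ultimately have pk: "int p dvd k" and ps: "int p dvd s + 1"
      by (simp_all only: coprime_dvd_mult_right_iff[OF cop])
    moreover have "half = 2 * k" using k two_half by simp
    ultimately have "2 * int p dvd half" "2 * int p dvd s + 1"
      using cop2 s_odd pk ps by (simp_all add: divides_mult)
    then show False using neg p by blast
  qed
  have nd: "int n dvd (s - 1) * (s + 1)" using s_square by (simp add: algebra_simps)
  have half_dvd: "half dvd k" if "int n dvd 2 * k" for k
    using that two_half by (metis dvd_times_left_cancel_iff zero_neq_numeral)
  show False
  proof (cases "4 dvd s + 1")
    case False
    define c where "c = (s + 1) div 2"
    have c: "s + 1 = 2 * c" "odd c" using False s_odd unfolding c_def by presburger+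
    have "coprime c (int n)" by (rule coprime_s_plus_one[OF none c(2), of "s + 1"]) (use c(1) in auto)
    then have "coprime (int n) c" by (simp add: coprime_commute)
    moreover have "int n dvd (2 * (s - 1)) * c" using nd unfolding c(1) by (metis mult.assoc mult.commute)
    ultimately have "int n dvd 2 * (s - 1)" by (simp add: coprime_dvd_mult_left_iff)
    then show False using half_dvd ne by blast
  next
    case True
    then have "\<not> 4 dvd half" using neg by blast
    define h where "h = half div 2"
    have h: "half = 2 * h" "odd h" using \<open>\<not> 4 dvd half\<close> even_half unfolding h_def by presburger+
    have "int n = h * 4" using two_half h(1) by simp
    then have hn: "h dvd int n" by simp
    have "coprime h (s + 1)" by (rule coprime_s_plus_one[OF none h(2) hn]) auto
    moreover have "h dvd (s - 1) * (s + 1)" using hn nd by (rule dvd_trans)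
    ultimately have "h dvd s - 1" by (simp add: coprime_dvd_mult_left_iff)
    moreover have "coprime 2 h" using h(2) by simp
    ultimately have "half dvd s - 1" unfolding h(1) using s_odd by (simp add: divides_mult)
    then show False using ne by blast
  qed
qed

lemma blocks_product_one:
  assumes Q: "\<And>B. B \<in># Q \<Longrightarrow> set_mset B \<subseteq> carrier G \<and> int m * w B \<in> exps B"
  shows "(\<Sum>B\<in>#Q. int m * w B) \<in> exps (\<Sum>\<^sub># Q)"
  using Q
proof (induction Q)
  case (add B Q)
  have "set_mset (\<Sum>\<^sub># Q) \<subseteq> carrier G" using add.prems by fastforce
  then have "int m * w B + (\<Sum>B\<in>#Q. int m * w B) \<in> exps (B + \<Sum>\<^sub># Q)" using add by (intro exps_add) auto
  then show ?case by simp
qed (simp add: exps_empty)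

text \<open>Two terms outside \<open>H\<close> are kept aside while blocks are removed, so that the hypothesis still applies to
  the last \<open>2 m - 1\<close> terms.\<close>

lemma extraction:
  assumes m: "4 \<le> m" "n = q * m" "2 \<le> q"
    and base: "\<And>S. set_mset S \<subseteq> carrier G \<Longrightarrow> size S = 2 * m - 1 \<Longrightarrow> 2 \<le> size (filter_mset N S) \<Longrightarrow>
      \<exists>B. B \<subseteq># S \<and> size B = m \<and> block m B"
    and S: "set_mset S \<subseteq> carrier G" "size S = 2 * n - 1" and NN: "2 \<le> size (filter_mset N S)"
  shows "has_m_product_one_subseq G n S"
proof -
  \<comment> \<open>If at most one term is outside \<open>H\<close>, the other
    \<open>2 * m - 1\<close> need only Erdos--Ginzburg--Ziv modulo \<open>m\<close>. Otherwise two
    terms outside \<open>H\<close> are completed to length \<open>2 * m - 1\<close>.\<close>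
  have find: "\<exists>B. B \<subseteq># R \<and> size B = m \<and> block m B" if R: "set_mset R \<subseteq> carrier G" "2 * m \<le> size R" for R
  proof (cases "2 \<le> size (filter_mset N R)")
    case True
    then obtain b b' where bb: "{#b, b'#} \<subseteq># filter_mset N R" by (rule obtain_two)
    have bR: "{#b, b'#} \<subseteq># R" using bb by (rule subset_mset.order_trans) simp
    have "2 * m - 3 \<le> size (R - {#b, b'#})" using R(2) bR by (simp add: size_Diff_submset)
    then obtain R1 where R1: "R1 \<subseteq># R - {#b, b'#}" "size R1 = 2 * m - 3" by (rule obtain_submset_of_size)
    define R2 where "R2 = {#b, b'#} + R1"
    have sub: "R2 \<subseteq># R" unfolding R2_def using bR R1(1)
      by (metis subset_mset.add_diff_inverse subset_mset.add_left_mono)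
    have "N b" "N b'" using bb by (auto dest: mset_subset_eqD)
    then have "2 \<le> size (filter_mset N R2)" by (simp add: R2_def)
    moreover have "size R2 = 2 * m - 1" using R1(2) m(1) by (simp add: R2_def)
    moreover have "set_mset R2 \<subseteq> carrier G" using set_mset_mono[OF sub] R(1) by blast
    ultimately obtain B where "B \<subseteq># R2" "size B = m" "block m B" using base by blast
    then show ?thesis using sub subset_mset.order_trans by blast
  next
    case False
    have "size R = size (filter_mset N R) + size (filter_mset (\<lambda>g. \<not> N g) R)"
      using multiset_partition[of R N] by (metis size_union)
    then have "2 * m - 1 \<le> size (filter_mset (\<lambda>g. \<not> N g) R)" using False R(2) by linarith
    then obtain T where T: "T \<subseteq># filter_mset (\<lambda>g. \<not> N g) R" "size T = m" "zero_sum m ex T"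
      using erdos_ginzburg_ziv[of m _ ex] m(1) by (metis gr0I not_numeral_le_zero)
    have TR: "T \<subseteq># R" using T(1) by (rule subset_mset.order_trans) simp
    have "(\<Sum>g\<in>#T. ex g) \<in> exps T"
      by (rule exps_sum) (use set_mset_mono[OF T(1)] R(1) in auto)
    then have "block m T" using T(3) by (auto simp: block_def zero_sum_def)
    then show ?thesis using TR T(2) by blast
  qed
  obtain b1 b2 where bb: "{#b1, b2#} \<subseteq># filter_mset N S" using NN by (rule obtain_two)
  have bN: "N b1" "N b2" using bb by (auto dest: mset_subset_eqD)
  have bS: "{#b1, b2#} \<subseteq># S" using bb by (rule subset_mset.order_trans) simp
  define ok where "ok Bs \<longleftrightarrow> (\<forall>B\<in>set Bs. size B = m \<and> block m B)" for Bs
  have size_sum: "size (sum_list Bs) = m * length Bs" if "ok Bs" for Bs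
    using that by (induction Bs) (auto simp: ok_def)
  \<comment> \<open>After \<open>2 * q - 2\<close> blocks exactly \<open>2 * m - 1\<close> terms are
    left, \<open>b1\<close> and \<open>b2\<close> among them, so \<open>base\<close> gives one more
    block. Before that at least \<open>3 * m - 3 \<ge> 2 * m\<close> terms remain besides
    \<open>b1\<close> and \<open>b2\<close>.\<close>
  have "\<exists>Bs. length Bs = j \<and> ok Bs \<and> {#b1, b2#} + sum_list Bs \<subseteq># S" if "j \<le> 2 * q - 2" for j
    using that
  proof (induction j)
    case 0
    then show ?case using bS by (intro exI[of _ "[]"]) (simp add: ok_def)
  next
    case (Suc j)
    then obtain Bs where Bs: "length Bs = j" "ok Bs" "{#b1, b2#} + sum_list Bs \<subseteq># S" by auto
    define R where "R = S - ({#b1, b2#} + sum_list Bs)"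
    have "j \<le> 2 * q - 3" using Suc.prems by linarith
    then have "m * j \<le> m * (2 * q - 3)" by (rule mult_le_mono2)
    moreover have "m * (2 * q - 3) + 3 * m = 2 * (q * m)" using m(3) by (simp add: algebra_simps diff_mult_distrib2)
    moreover have "size R = 2 * (q * m) - 1 - (2 + m * j)"
      unfolding R_def using Bs S(2) m(2) size_sum[OF Bs(2)] by (subst size_Diff_submset) auto
    ultimately have "2 * m \<le> size R" using m(1) by linarith
    moreover have "set_mset R \<subseteq> carrier G" using S(1) unfolding R_def by (meson in_diffD subset_iff)
    ultimately obtain B where B: "B \<subseteq># R" "size B = m" "block m B" using find by blast
    have "{#b1, b2#} + sum_list Bs + B \<subseteq># {#b1, b2#} + sum_list Bs + R" using B(1) by (rule subset_mset.add_left_mono)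
    also have "{#b1, b2#} + sum_list Bs + R = S" unfolding R_def using Bs(3) by (rule subset_mset.add_diff_inverse)
    also have "{#b1, b2#} + sum_list Bs + B = {#b1, b2#} + sum_list (B # Bs)" by (simp add: add.commute)
    finally have "{#b1, b2#} + sum_list (B # Bs) \<subseteq># S" .
    then show ?case using B Bs(1,2) by (intro exI[of _ "B # Bs"]) (auto simp: ok_def)
  qed
  from this[of "2 * q - 2"] obtain Bs where Bs: "length Bs = 2 * q - 2" "ok Bs" "{#b1, b2#} + sum_list Bs \<subseteq># S" by auto
  have BsS: "sum_list Bs \<subseteq># S" using Bs(3) by (rule subset_mset.order_trans[rotated]) simp
  define R where "R = S - sum_list Bs"
  have "m * (2 * q - 2) + 2 * m = 2 * (q * m)" using m(3) by (simp add: algebra_simps diff_mult_distrib2)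
  moreover have "size R = 2 * (q * m) - 1 - m * (2 * q - 2)"
    unfolding R_def using Bs(1) BsS S(2) m(2) size_sum[OF Bs(2)] by (subst size_Diff_submset) auto
  ultimately have szR: "size R = 2 * m - 1" using m(1) by linarith
  have bR: "{#b1, b2#} \<subseteq># R" unfolding R_def using Bs(3) by (simp add: subset_mset.le_diff_conv2[OF BsS])
  have "filter_mset N {#b1, b2#} \<subseteq># filter_mset N R" using bR by (rule multiset_filter_mono)
  then have "2 \<le> size (filter_mset N R)" using bN size_mset_mono by fastforce
  moreover have "set_mset R \<subseteq> carrier G" using S(1) unfolding R_def by (meson in_diffD subset_iff)
  ultimately obtain B where B: "B \<subseteq># R" "size B = m" "block m B" using base szR by blast
  define Cs where "Cs = B # Bs"
  have Cs: "length Cs = 2 * q - 1" "ok Cs" using B Bs(1,2) m(3) by (auto simp: Cs_def ok_def)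
  have "sum_list Bs + B \<subseteq># sum_list Bs + R" using B(1) by (rule subset_mset.add_left_mono)
  also have "sum_list Bs + R = S" unfolding R_def using BsS by (rule subset_mset.add_diff_inverse)
  also have "sum_list Bs + B = \<Sum>\<^sub># (mset Cs)" by (simp add: Cs_def sum_mset_sum_list add.commute)
  finally have CsS: "\<Sum>\<^sub># (mset Cs) \<subseteq># S" .
  define w where "w C = (SOME k. int m * k \<in> exps C)" for C
  have w: "int m * w C \<in> exps C" if "C \<in> set Cs" for C
    unfolding w_def by (rule someI_ex) (use that Cs(2) in \<open>auto simp: ok_def block_def elim!: dvdE\<close>)
  obtain Q where Q: "Q \<subseteq># mset Cs" "size Q = q" "zero_sum q w Q"
    by (rule erdos_ginzburg_ziv[of q "mset Cs" w]) (use m(3) Cs(1) in auto)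
  have QC: "C \<in> set Cs" if "C \<in># Q" for C using mset_subset_eqD[OF Q(1) that] by simp
  define T where "T = \<Sum>\<^sub># Q"
  have TS: "T \<subseteq># S" unfolding T_def using sum_mset_mono_subseteq[OF Q(1)] CsS by (rule subset_mset.order_trans)
  have CT: "C \<subseteq># T" if "C \<in># Q" for C
    unfolding T_def using that by (metis insert_DiffM mset_subset_eq_add_left sum_mset.add_mset)
  have "size T = (\<Sum>C\<in>#Q. size C)" unfolding T_def by (induction Q) auto
  also have "\<dots> = (\<Sum>C\<in>#Q. m)" by (rule arg_cong[where f = sum_mset], rule image_mset_cong) (use QC Cs(2) in \<open>auto simp: ok_def\<close>)
  finally have "size T = n" using Q(2) m(2) by (simp add: sum_mset_constant)
  moreover have "product_one G T"
  proof (rule product_oneI)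
    show "(\<Sum>C\<in>#Q. int m * w C) \<in> exps T" unfolding T_def
    proof (rule blocks_product_one)
      fix C assume C: "C \<in># Q"
      show "set_mset C \<subseteq> carrier G \<and> int m * w C \<in> exps C"
        using w[OF QC[OF C]] set_mset_mono[OF CT[OF C]] set_mset_mono[OF TS] S(1) by blast
    qed
    have "(\<Sum>C\<in>#Q. int m * w C) = int m * (\<Sum>C\<in>#Q. w C)" by (simp add: sum_mset_distrib_left)
    moreover have "int m * int q dvd int m * (\<Sum>C\<in>#Q. w C)" using Q(3) by (simp add: zero_sum_def)
    ultimately show "int n dvd (\<Sum>C\<in>#Q. int m * w C)" using m(2) by (simp add: mult.commute)
  qed
  ultimately show ?thesis unfolding has_m_product_one_subseq_def using TS by blast
qed

theorem two_outside_product_one: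
  assumes ne: "\<not> half dvd s - 1" and S: "set_mset S \<subseteq> carrier G" "size S = 2 * n - 1"
    and NN: "2 \<le> size (filter_mset N S)"
  shows "has_m_product_one_subseq G n S"
  using choose_modulus[OF ne]
proof (elim disjE exE conjE)
  assume four: "4 dvd half" "4 dvd s + 1"
  interpret four_base G n s x y by unfold_locales (use four in auto)
  obtain k where k: "half = 4 * k" using four(1) by blast
  then have "n = (2 * nat k) * 4" "2 \<le> 2 * nat k" using two_half n8 by linarith+
  then show ?thesis using S NN base_four by (intro extraction[of 4 "2 * nat k"]) auto
next
  fix p assume pp: "Factorial_Ring.prime p" "odd p" "2 * int p dvd half" "2 * int p dvd s + 1"
  interpret odd_base G n s x y p by unfold_locales (use pp in auto)
  obtain k where k: "half = 2 * int p * k" using pp(3) by blast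
  have "0 < half" using n8 by simp
  then have k0: "0 < k" using k p3 by (simp add: zero_less_mult_iff)
  have "int n = int ((2 * nat k) * (2 * p))" using k two_half k0 by (simp add: mult.commute)
  then have "n = (2 * nat k) * (2 * p)" by (simp only: of_nat_eq_iff)
  moreover have "2 \<le> 2 * nat k" using k0 by linarith
  ultimately show ?thesis using S NN base_odd p3 by (intro extraction[of "2 * p" "2 * nat k"]) auto
qed

end

section \<open>Commutator subgroup of order two\<close>

lemma pair_up:
  assumes "image_mset f A = image_mset f B"
  obtains ps where "pairs_mset ps = A + B" "\<forall>(a, b)\<in>set ps. f a = f b" "length ps = size A"
proof -
  have "\<exists>ps. pairs_mset ps = A + B \<and> (\<forall>(a, b)\<in>set ps. f a = f b) \<and> length ps = size A"
    using assms
  proof (induction A arbitrary: B)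
    case empty
    then show ?case by (intro exI[of _ "[]"]) auto
  next
    case (add a A)
    then have "f a \<in># image_mset f B" by (metis image_mset_add_mset union_single_eq_member)
    then obtain b where b: "b \<in># B" "f b = f a" by auto
    then obtain B' where B': "B = add_mset b B'" by (metis insert_DiffM)
    then have "image_mset f A = image_mset f B'" using add.prems b(2) by simp
    then obtain ps where "pairs_mset ps = A + B'" "\<forall>(a, b)\<in>set ps. f a = f b" "length ps = size A"
      using add.IH by blast
    then show ?case using b(2) by (intro exI[of _ "(a, b) # ps"]) (auto simp: B')
  qed
  then show ?thesis using that by blast
qed

lemma even_count_pairs: "\<forall>(a, b)\<in>set ps. f a = f b \<Longrightarrow> even (count (image_mset f (pairs_mset ps)) t)"
  by (induction ps) auto

text \<open>After the inverse theorem a sum depends only on how many terms of each value it takes.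
  \<open>P\<close> forces in the pairs whose factors are to be reordered.\<close>

lemma select_two_values:
  fixes w :: "'b \<Rightarrow> int"
  assumes "P \<subseteq># M" and ne: "u mod int z \<noteq> v mod int z"
    and i: "size (filter_mset (\<lambda>q. w q mod int z = u mod int z) P) \<le> i" "i \<le> size (filter_mset (\<lambda>q. w q mod int z = u mod int z) M)"
    and j: "size (filter_mset (\<lambda>q. w q mod int z = v mod int z) P) \<le> j" "j \<le> size (filter_mset (\<lambda>q. w q mod int z = v mod int z) M)"
    and P: "\<forall>q\<in>#P. w q mod int z = u mod int z \<or> w q mod int z = v mod int z"
  obtains T where "P \<subseteq># T" "T \<subseteq># M" "size T = i + j" "int z dvd (\<Sum>q\<in>#T. w q) - (int i * u + int j * v)"
proof -
  have part: "\<exists>T. filter_mset (\<lambda>q. w q mod int z = c mod int z) P \<subseteq># T \<and> T \<subseteq># filter_mset (\<lambda>q. w q mod int z = c mod int z) M \<and>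
      size T = k \<and> int z dvd (\<Sum>q\<in>#T. w q) - int k * c"
    if k: "size (filter_mset (\<lambda>q. w q mod int z = c mod int z) P) \<le> k"
      "k \<le> size (filter_mset (\<lambda>q. w q mod int z = c mod int z) M)" for c k
  proof -
    define Pc where "Pc = filter_mset (\<lambda>q. w q mod int z = c mod int z) P"
    define Mc where "Mc = filter_mset (\<lambda>q. w q mod int z = c mod int z) M"
    have PM: "Pc \<subseteq># Mc" unfolding Pc_def Mc_def using assms(1) by (rule multiset_filter_mono)
    have "k - size Pc \<le> size (Mc - Pc)" using k PM by (simp add: size_Diff_submset Mc_def Pc_def)
    then obtain T where T: "T \<subseteq># Mc - Pc" "size T = k - size Pc" by (rule obtain_submset_of_size)
    have TM: "Pc + T \<subseteq># Mc" using PM T(1) by (metis subset_mset.add_diff_inverse subset_mset.add_left_mono)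
    have sz: "size (Pc + T) = k" using T(2) k(1) by (simp add: Pc_def)
    have "int z dvd (\<Sum>q\<in>#Q. w q) - int (size Q) * c" if Q: "\<forall>q\<in>#Q. w q mod int z = c mod int z" for Q
      using Q
    proof (induction Q)
      case (add q Q)
      have "int z dvd w q - c" using add.prems by (simp add: mod_eq_dvd_iff)
      then have "int z dvd (w q - c) + ((\<Sum>q\<in>#Q. w q) - int (size Q) * c)" using add by (intro dvd_add) auto
      then show ?case by (simp add: algebra_simps)
    qed simp
    moreover have "\<forall>q\<in>#Pc + T. w q mod int z = c mod int z"
      using set_mset_mono[OF TM] by (auto simp: Mc_def)
    ultimately have "int z dvd (\<Sum>q\<in>#Pc + T. w q) - int k * c" using sz by metis
    then show ?thesis using TM sz unfolding Pc_def Mc_def by (intro exI[of _ "Pc + T"]) (simp add: Pc_def)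
  qed
  obtain A where A: "filter_mset (\<lambda>q. w q mod int z = u mod int z) P \<subseteq># A"
    "A \<subseteq># filter_mset (\<lambda>q. w q mod int z = u mod int z) M" "size A = i" "int z dvd (\<Sum>q\<in>#A. w q) - int i * u"
    using part[OF i] by blast
  obtain B where B: "filter_mset (\<lambda>q. w q mod int z = v mod int z) P \<subseteq># B"
    "B \<subseteq># filter_mset (\<lambda>q. w q mod int z = v mod int z) M" "size B = j" "int z dvd (\<Sum>q\<in>#B. w q) - int j * v"
    using part[OF j] by blast
  have "P = filter_mset (\<lambda>q. w q mod int z = u mod int z) P + filter_mset (\<lambda>q. w q mod int z = v mod int z) P"
    using P ne by (intro multiset_eqI) (auto simp: not_in_iff)
  then have "P \<subseteq># A + B" using subset_mset.add_mono[OF A(1) B(1)] by metis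
  moreover have "A + B \<subseteq># M" by (rule subseteq_filter_disjoint[OF A(2) B(2)]) (use ne in auto)
  moreover have "int z dvd ((\<Sum>q\<in>#A. w q) - int i * u) + ((\<Sum>q\<in>#B. w q) - int j * v)" using A(4) B(4) by (rule dvd_add)
  then have "int z dvd (\<Sum>q\<in>#A + B. w q) - (int i * u + int j * v)" by (simp add: algebra_simps)
  ultimately show ?thesis using that[of "A + B"] A(3) B(3) by simp
qed

text \<open>Taking one copy from \<open>k\<close> copies each of two values leaves just the removed
  value with multiplicity \<open>k - 1\<close>, which differs from \<open>0\<close> and
  \<open>k\<close> once \<open>k \<ge> 2\<close>.\<close>

lemma exchange_value:
  assumes "add_mset \<alpha> Z = replicate_mset k u + replicate_mset k v" "add_mset \<beta> Z = replicate_mset k u' + replicate_mset k v'"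
    and "u \<noteq> v" "u' \<noteq> v'" "2 \<le> k"
  shows "\<alpha> = \<beta>"
proof (rule ccontr)
  assume "\<alpha> \<noteq> \<beta>"
  have "count (add_mset \<alpha> Z) \<alpha> = 0 \<or> count (add_mset \<alpha> Z) \<alpha> = k" using assms(3) unfolding assms(1) by auto
  then have "count Z \<alpha> = k - 1" by auto
  then have "count (add_mset \<beta> Z) \<alpha> = k - 1" using \<open>\<alpha> \<noteq> \<beta>\<close> by simp
  moreover have "count (add_mset \<beta> Z) \<alpha> = 0 \<or> count (add_mset \<beta> Z) \<alpha> = k" using assms(4) unfolding assms(2) by auto
  ultimately show False using assms(5) by linarith
qed

context dicyclic_like
begin

lemma n_even: "even (int n)"
  using two_half by (metis dvd_triv_left)

lemma ty_pow: "ty (y [^] (i::int)) = (False, odd i)"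
proof -
  have "2 dvd ex (y [^] i) - i" using n_even ex_pow by (rule dvd_trans)
  then show ?thesis by (simp add: ty_def)
qed

lemma ty_x_pow: "ty (x \<otimes> y [^] (i::int)) = (True, odd i)"
proof -
  have "2 dvd ex (x \<otimes> y [^] i) - i" using n_even ex_x_pow by (rule dvd_trans)
  then show ?thesis by (simp add: ty_def)
qed

lemma elem_cases:
  assumes "g \<in> carrier G"
  obtains (H) i :: int where "g = y [^] i" | (N) i :: int where "g = x \<otimes> y [^] i"
  using ex_cases[OF assms] by blast

lemma ty_mult:
  assumes "u \<in> carrier G" "v \<in> carrier G"
  shows "ty (u \<otimes> v) = (fst (ty u) \<noteq> fst (ty v), snd (ty u) \<noteq> snd (ty v))"
  using assms(1)
proof (cases rule: elem_cases)
  case (H i)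
  note u = this
  show ?thesis using assms(2)
    by (cases rule: elem_cases) (use s_odd in \<open>auto simp: u yy yxy ty_pow ty_x_pow\<close>)
next
  case (N i)
  note u = this
  show ?thesis using assms(2)
    by (cases rule: elem_cases) (use s_odd even_half in \<open>auto simp: u xyy xyxy ty_pow ty_x_pow\<close>)
qed

lemma trivial_type: "g \<in> carrier G \<Longrightarrow> ty g = (False, False) \<Longrightarrow> \<exists>j. g = y [^] (2 * j :: int)"
  by (erule elem_cases) (auto simp: ty_pow ty_x_pow elim!: evenE)

end

section \<open>The exceptional case: \<open>s\<close> is \<open>1 + half\<close> modulo
  \<open>n\<close>\<close>

locale exceptional = dicyclic_like +
  assumes exc: "half dvd s - 1" and s_ne: "\<not> int n dvd s - 1"
begin

lemma s_eq: obtains k where "s - 1 = half * k" "odd k"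
proof -
  obtain k where k: "s - 1 = half * k" using exc by blast
  have "odd k"
  proof
    assume "even k"
    then obtain l where "k = 2 * l" by blast
    then have "s - 1 = int n * l" using k two_half by (metis mult.assoc mult.commute)
    then show False using s_ne by simp
  qed
  then show ?thesis using that k by blast
qed

lemma y_twist: "y [^] (i + (s - 1) * j) = y [^] (i :: int) \<otimes> (if odd j then y [^] half else \<one>)"
proof -
  obtain k where k: "s - 1 = half * k" "odd k" by (rule s_eq)
  define c :: int where "c = (if odd j then half else 0)"
  have "even (k * j - (if odd j then 1 else 0))" using k(2) by auto
  then obtain l where l: "k * j - (if odd j then 1 else 0) = 2 * l" by blast
  have "(i + (s - 1) * j) - (i + c) = half * (k * j - (if odd j then 1 else 0))"
    unfolding k(1) c_def by (simp add: algebra_simps)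
  also have "\<dots> = (2 * half) * l" unfolding l by simp
  also have "\<dots> = int n * l" by (simp only: two_half)
  finally have "int n dvd (i + (s - 1) * j) - (i + c)" by simp
  then have "y [^] (i + (s - 1) * j) = y [^] (i + c)" by (simp only: y_eq_iff)
  then show ?thesis by (simp add: c_def flip: yy)
qed

text \<open>Interchanging the factors costs \<open>y [^] ((s - 1) * j)\<close> for some
  \<open>j\<close> that is odd exactly if the types are distinct and nontrivial; by
  \<open>y_twist\<close> only the parity of \<open>j\<close> counts.\<close>

lemma commute:
  assumes "u \<in> carrier G" "v \<in> carrier G"
  shows "u \<otimes> v = (v \<otimes> u) \<otimes> (if ty u \<noteq> ty v \<and> ty u \<noteq> (False, False) \<and> ty v \<noteq> (False, False) then y [^] half else \<one>)"
proof -
  define c where "c j = (if odd (j::int) then y [^] half else \<one>)" for j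
  have c: "c j \<in> carrier G" for j by (simp add: c_def)
  have tw: "y [^] (i + (s - 1) * j) = y [^] i \<otimes> c j" for i j :: int unfolding c_def by (rule y_twist)
  have "\<exists>j. u \<otimes> v = (v \<otimes> u) \<otimes> c j \<and> (odd j \<longleftrightarrow> ty u \<noteq> ty v \<and> ty u \<noteq> (False, False) \<and> ty v \<noteq> (False, False))"
    using assms(1)
  proof (cases rule: elem_cases)
    case (H i)
    note u = this
    show ?thesis using assms(2)
    proof (cases rule: elem_cases)
      case (H j)
      then show ?thesis by (intro exI[of _ 0]) (auto simp: u yy ty_pow add.commute c_def)
    next
      case (N j)
      have "x \<otimes> y [^] (s * i + j) = x \<otimes> (y [^] (j + i) \<otimes> c i)"
        using tw[of "j + i" i] by (simp add: algebra_simps)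
      then show ?thesis using N c by (intro exI[of _ i]) (auto simp: u yxy xyy ty_pow ty_x_pow m_assoc)
    qed
  next
    case (N i)
    note u = this
    show ?thesis using assms(2)
    proof (cases rule: elem_cases)
      case (H j)
      have "x \<otimes> y [^] (i + j) = x \<otimes> (y [^] (i + j + (s - 1) * j) \<otimes> c j)"
        unfolding tw using c by (simp add: m_assoc) (simp add: c_def yy two_half y_n flip: mult_2)
      then show ?thesis using H c by (intro exI[of _ j]) (auto simp: u yxy xyy ty_pow ty_x_pow m_assoc algebra_simps)
    next
      case (N j)
      have "y [^] (half + s * i + j) = y [^] (half + s * j + i) \<otimes> c (i - j)"
        using tw[of "half + s * j + i" "i - j"] by (simp add: algebra_simps)
      then show ?thesis using N by (intro exI[of _ "i - j"]) (auto simp: u xyxy ty_x_pow)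
    qed
  qed
  then show ?thesis by (auto simp: c_def)
qed

lemma commute_same: "u \<in> carrier G \<Longrightarrow> v \<in> carrier G \<Longrightarrow> ty u = ty v \<Longrightarrow> u \<otimes> v = v \<otimes> u"
  using commute[of u v] by simp

lemma commute_trivial: "u \<in> carrier G \<Longrightarrow> v \<in> carrier G \<Longrightarrow> ty u = (False, False) \<Longrightarrow> u \<otimes> v = v \<otimes> u"
  using commute[of u v] by simp

lemma commute_twist: "u \<in> carrier G \<Longrightarrow> v \<in> carrier G \<Longrightarrow> ty u \<noteq> ty v \<Longrightarrow> ty u \<noteq> (False, False) \<Longrightarrow>
    ty v \<noteq> (False, False) \<Longrightarrow> u \<otimes> v = (v \<otimes> u) \<otimes> y [^] half"
  using commute[of u v] by simp

text \<open>For terms of equal type the product is an even power of \<open>y\<close>, and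
  \<open>val\<close> is half its exponent, meaningful modulo \<open>half\<close>: an element of the
  cyclic group of order \<open>half\<close>.\<close>

definition val :: "'a \<times> 'a \<Rightarrow> int" where "val q = (SOME j. fst q \<otimes> snd q = y [^] (2 * j))"

lemma val:
  assumes "a \<in> carrier G" "b \<in> carrier G" "ty a = ty b"
  shows "a \<otimes> b = y [^] (2 * val (a, b))"
proof -
  have "\<exists>j. a \<otimes> b = y [^] (2 * j :: int)" using assms ty_mult[of a b] by (intro trivial_type) auto
  then show ?thesis unfolding val_def fst_conv snd_conv by (rule someI_ex)
qed

lemma exps_listI: "list_prod G us = y [^] i \<Longrightarrow> mset us = T \<Longrightarrow> i \<in> exps T"
  by (auto simp: exps_def prods_def) metis

definition union_pairs :: "('a \<times> 'a) multiset \<Rightarrow> 'a multiset" where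
  "union_pairs Q = (\<Sum>q\<in>#Q. {#fst q, snd q#})"

lemma union_pairs_mset: "union_pairs (mset ps) = pairs_mset ps"
  by (induction ps) (auto simp: union_pairs_def)

lemma union_pairs_add: "union_pairs (Q + Q') = union_pairs Q + union_pairs Q'"
  by (simp add: union_pairs_def)

lemma union_pairs_mono: "Q \<subseteq># Q' \<Longrightarrow> union_pairs Q \<subseteq># union_pairs Q'"
  by (auto simp: subset_mset.le_iff_add union_pairs_add)

lemma size_union_pairs: "size (union_pairs Q) = 2 * size Q"
  by (induction Q) (auto simp: union_pairs_def)

lemma exps_union_pairs:
  assumes "\<forall>(a, b)\<in>#Q. a \<in> carrier G \<and> b \<in> carrier G \<and> ty a = ty b"
  shows "set_mset (union_pairs Q) \<subseteq> carrier G \<and> 2 * (\<Sum>q\<in>#Q. val q) \<in> exps (union_pairs Q)"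
  using assms
proof (induction Q)
  case empty
  then show ?case using exps_empty by (simp add: union_pairs_def)
next
  case (add q Q)
  obtain a b where q: "q = (a, b)" by (cases q)
  have ab: "a \<in> carrier G" "b \<in> carrier G" "ty a = ty b" using add.prems by (auto simp: q)
  have "2 * val q \<in> exps {#a, b#}" by (rule exps_listI[of "[a, b]"]) (use val[OF ab] ab in \<open>simp_all add: q\<close>)
  moreover have IH: "set_mset (union_pairs Q) \<subseteq> carrier G" "2 * (\<Sum>q\<in>#Q. val q) \<in> exps (union_pairs Q)"
    using add by auto
  ultimately have "2 * val q + 2 * (\<Sum>q\<in>#Q. val q) \<in> exps ({#a, b#} + union_pairs Q)"
    using ab by (intro exps_add) auto
  moreover have "union_pairs (add_mset q Q) = {#a, b#} + union_pairs Q" by (simp add: union_pairs_def q)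
  ultimately show ?case using IH(1) ab by (simp add: distrib_left)
qed

lemma half_ge: "4 \<le> half"
  using n8 by linarith

end

section \<open>Structure of the exceptional sequences without product-one subsequence of length
  \<open>n\<close>\<close>

locale exceptional_sequence = exceptional +
  fixes S :: "'a multiset"
  assumes S: "set_mset S \<subseteq> carrier G" and szS: "size S = 2 * n - 1"
    and none: "\<not> has_m_product_one_subseq G n S"
begin

lemma no_product_one: "T \<subseteq># S \<Longrightarrow> size T = n \<Longrightarrow> i \<in> exps T \<Longrightarrow> \<not> int n dvd i"
  using none product_oneI unfolding has_m_product_one_subseq_def by blast

lemma pairs_ok:
  assumes "S = pairs_mset ps + L" "\<forall>(a, b)\<in>set ps. ty a = ty b"
  shows "\<forall>(a, b)\<in>#mset ps. a \<in> carrier G \<and> b \<in> carrier G \<and> ty a = ty b"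
proof -
  have "fst q \<in># pairs_mset ps \<and> snd q \<in># pairs_mset ps" if "q \<in> set ps" for q
    using that by (induction ps) auto
  then show ?thesis using assms S by fastforce
qed

text \<open>A zero-sum of \<open>n div 2\<close> values would be a product-one subsequence of length
  \<open>n\<close>. A single leftover term would mean \<open>n - 1\<close> pairs, enough for
  Erdos--Ginzburg--Ziv modulo \<open>n div 2\<close>; so by parity three terms are left, and the
  \<open>n - 2\<close> pairs fall under the inverse theorem.\<close>

lemma decomposition:
  assumes d: "S = pairs_mset ps + L" "\<forall>(a, b)\<in>set ps. ty a = ty b" and L: "\<forall>t. count (image_mset ty L) t \<le> 1"
  shows "size L = 3" "length ps = 2 * (n div 2) - 2"
    "\<exists>u v. coprime (u - v) half \<and> image_mset (\<lambda>q. val q mod half) (mset ps) =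
      replicate_mset (n div 2 - 1) (u mod half) + replicate_mset (n div 2 - 1) (v mod half)"
proof -
  have n2: "n = 2 * (n div 2)" using n4 by auto
  have free: "\<not> zero_sum (n div 2) val T" if T: "T \<subseteq># mset ps" "size T = n div 2" for T
  proof
    assume z: "zero_sum (n div 2) val T"
    have "\<forall>(a, b)\<in>#T. a \<in> carrier G \<and> b \<in> carrier G \<and> ty a = ty b"
      using pairs_ok[OF d] set_mset_mono[OF T(1)] by blast
    then have "2 * (\<Sum>q\<in>#T. val q) \<in> exps (union_pairs T)" using exps_union_pairs by blast
    moreover have "union_pairs T \<subseteq># S"
      using union_pairs_mono[OF T(1)] by (simp add: d(1) union_pairs_mset subset_mset.add_increasing2)
    moreover have "size (union_pairs T) = n" using T(2) n2 by (simp add: size_union_pairs)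
    moreover have "2 * half dvd 2 * (\<Sum>q\<in>#T. val q)" using z by (simp add: zero_sum_def)
    ultimately show False using no_product_one two_half by metis
  qed
  have L4: "size L \<le> 4" using size_le_card_types[OF L ty_UNIV(1,2)] ty_UNIV(3) by simp
  have sz: "2 * length ps + size L = 2 * n - 1" using szS d(1) by simp
  have "size L \<noteq> 1"
  proof
    assume "size L = 1"
    then have "2 * (n div 2) - 1 \<le> size (mset ps)" using sz n2 by simp
    then show False using erdos_ginzburg_ziv[of "n div 2" "mset ps" val] free n8 by auto
  qed
  moreover have "odd (size L)"
  proof
    assume "even (size L)"
    then have "even (2 * n - 1)" unfolding sz[symmetric] by simp
    then show False using n8 by simp
  qed
  ultimately show L3: "size L = 3" using L4 by presburger
  then show len: "length ps = 2 * (n div 2) - 2" using sz n2 by linarith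
  have "2 \<le> n div 2" using n8 by simp
  moreover have "size (mset ps) = 2 * (n div 2) - 2" using len by simp
  ultimately show "\<exists>u v. coprime (u - v) half \<and> image_mset (\<lambda>q. val q mod half) (mset ps) =
      replicate_mset (n div 2 - 1) (u mod half) + replicate_mset (n div 2 - 1) (v mod half)"
    using erdos_ginzburg_ziv_inverse[of "n div 2" "mset ps" val] free by metis
qed

lemma values_differ: "coprime (u - v) half \<Longrightarrow> u mod half \<noteq> v mod half"
proof
  assume "coprime (u - v) half" "u mod half = v mod half"
  then have "half dvd u - v" "coprime half (u - v)" by (simp_all add: mod_eq_dvd_iff coprime_commute)
  then have "is_unit half" by (metis coprime_absorb_left)
  then show False using half_ge by auto
qed

lemma filter_value:
  assumes "image_mset (\<lambda>q. val q mod half) Q = Z"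
  shows "size (filter_mset (\<lambda>q. val q mod half = c) Q) = count Z c"
  unfolding assms[symmetric] by (induction Q) auto

end

lemma sum_count_types:
  fixes f :: "'b \<Rightarrow> bool \<times> bool"
  shows "count (image_mset f M) (False, False) + count (image_mset f M) (True, False) +
    count (image_mset f M) (False, True) + count (image_mset f M) (True, True) = size M"
proof (induction M)
  case (add x M)
  obtain p q where "f x = (p, q)" by (cases "f x")
  then show ?case using add by (cases p; cases q) simp_all
qed simp

context exceptional_sequence
begin

definition part :: "bool \<times> bool \<Rightarrow> 'a multiset" where "part t = filter_mset (\<lambda>g. ty g = t) S"

lemma part_elem: "g \<in># part t \<Longrightarrow> g \<in> carrier G \<and> ty g = t \<and> g \<in># S"
  using S by (auto simp: part_def)

lemma size_part: "size (part t) = count (image_mset ty S) t"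
  unfolding part_def by (induction S) auto

lemma part_sub: "part t \<subseteq># S"
  by (simp add: part_def)

lemma quarter: obtains m where "n div 2 = 2 * m" "2 \<le> m" "half = 2 * int m" "n = 4 * m"
proof -
  obtain m where "n = 4 * m" using n4 by blast
  then show ?thesis using n8 by (intro that[of m]) auto
qed

lemma odd_difference: "coprime (u - v) half \<Longrightarrow> odd (u - v)"
  using even_half by (metis coprime_common_divisor odd_one)

text \<open>Two pairs from different nontrivial types can be multiplied to either of two values differing by
  \<open>y [^] half\<close>, and \<open>z = n div 2\<close> of the paired products, half of them \<open>u\<close> and half of them \<open>v\<close>, miss the
  identity exactly by this factor.\<close>

lemma pairs_in_one_type:
  assumes t: "t \<noteq> t'" "t \<noteq> (False, False)" "t' \<noteq> (False, False)"
    and two: "2 \<le> size (part t)" "2 \<le> size (part t')"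
  shows False
proof -
  obtain a a' where a: "{#a, a'#} \<subseteq># part t" using two(1) by (rule obtain_two)
  obtain b b' where b: "{#b, b'#} \<subseteq># part t'" using two(2) by (rule obtain_two)
  have "a \<in># part t" "a' \<in># part t" "b \<in># part t'" "b' \<in># part t'" using a b by (auto dest: mset_subset_eqD)
  note e = this[THEN part_elem]
  have c: "a \<in> carrier G" "a' \<in> carrier G" "b \<in> carrier G" "b' \<in> carrier G"
    and tys: "ty a = t" "ty a' = t" "ty b = t'" "ty b' = t'" using e by auto
  have sub: "{#a, a'#} + {#b, b'#} \<subseteq># S"
    by (rule subseteq_filter_disjoint[OF a[unfolded part_def] b[unfolded part_def]]) (use t(1) in auto)
  define R where "R = S - ({#a, a'#} + {#b, b'#})"
  obtain ps L where d: "R = pairs_mset ps + L" "\<forall>(a, b)\<in>set ps. ty a = ty b" "\<forall>t. count (image_mset ty L) t \<le> 1"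
    by (rule pair_decomposition)
  define qs where "qs = (a, a') # (b, b') # ps"
  have "S = ({#a, a'#} + {#b, b'#}) + R" unfolding R_def using sub by (rule subset_mset.add_diff_inverse[symmetric])
  then have Sqs: "S = pairs_mset qs + L" by (simp add: qs_def d(1))
  have tqs: "\<forall>(a, b)\<in>set qs. ty a = ty b" using d(2) tys by (simp add: qs_def)
  obtain u v where uv: "coprime (u - v) half" "image_mset (\<lambda>q. val q mod half) (mset qs) =
      replicate_mset (n div 2 - 1) (u mod half) + replicate_mset (n div 2 - 1) (v mod half)"
    using decomposition(3)[OF Sqs tqs d(3)] by blast
  note ne = values_differ[OF uv(1)]
  obtain m where m: "n div 2 = 2 * m" "2 \<le> m" "half = 2 * int m" "n = 4 * m" by (rule quarter)
  define P where "P = {#(a, a'), (b, b')#}"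
  have PM: "P \<subseteq># mset qs" by (simp add: P_def qs_def)
  have small: "size (filter_mset c P) \<le> m" for c
    using size_filter_mset_lesseq[of c P] m(2) by (simp add: P_def)
  have vals: "val q mod half = u mod half \<or> val q mod half = v mod half" if "q \<in># mset qs" for q
  proof -
    have "val q mod half \<in># image_mset (\<lambda>q. val q mod half) (mset qs)" using that by simp
    then show ?thesis unfolding uv(2) by (auto simp: in_replicate_mset split: if_splits)
  qed
  \<comment> \<open>Since \<open>m = n div 4\<close> is at least \<open>2\<close>, both special
    pairs fit in, whichever values they have.\<close>
  obtain T where T: "P \<subseteq># T" "T \<subseteq># mset qs" "size T = m + m" "half dvd (\<Sum>q\<in>#T. val q) - (int m * u + int m * v)"
  proof (rule select_two_values[OF PM ne, of val m m])
    show "m \<le> size (filter_mset (\<lambda>q. val q mod half = u mod half) (mset qs))"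
      "m \<le> size (filter_mset (\<lambda>q. val q mod half = v mod half) (mset qs))"
      unfolding filter_value[OF uv(2)] using m ne by auto
    show "\<forall>q\<in>#P. val q mod half = u mod half \<or> val q mod half = v mod half"
      using vals set_mset_mono[OF PM] by blast
  qed (use small in auto)
  obtain T' where T': "T = P + T'" using T(1) by (auto simp: subset_mset.le_iff_add)
  have T'qs: "T' \<subseteq># mset qs" using T(2) unfolding T' by (rule subset_mset.order_trans[rotated]) simp
  have "\<forall>(a, b)\<in>#T'. a \<in> carrier G \<and> b \<in> carrier G \<and> ty a = ty b"
    using pairs_ok[OF Sqs tqs] set_mset_mono[OF T'qs] by blast
  then have ex': "set_mset (union_pairs T') \<subseteq> carrier G" "2 * (\<Sum>q\<in>#T'. val q) \<in> exps (union_pairs T')"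
    using exps_union_pairs by blast+
  have va: "a \<otimes> a' = y [^] (2 * val (a, a'))" and vb: "b \<otimes> b' = y [^] (2 * val (b, b'))"
    using val c tys by auto
  have tyh: "ty (y [^] half) = (False, False)" using even_half by (simp add: ty_pow)
  \<comment> \<open>Interleaving the pairs amounts to one swap of \<open>b\<close> and
    \<open>a'\<close>, which contributes the factor \<open>y [^] half\<close>.\<close>
  have "list_prod G [a, b, a', b'] = a \<otimes> ((b \<otimes> a') \<otimes> b')" using c by (simp add: m_assoc)
  also have "b \<otimes> a' = (a' \<otimes> b) \<otimes> y [^] half" using commute_twist[of b a'] c tys t by auto
  also have "a \<otimes> (((a' \<otimes> b) \<otimes> y [^] half) \<otimes> b') = (a \<otimes> a') \<otimes> (b \<otimes> (y [^] half \<otimes> b'))" using c by (simp add: m_assoc)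
  also have "y [^] half \<otimes> b' = b' \<otimes> y [^] half" using commute_trivial[of "y [^] half" b'] c tyh by simp
  also have "(a \<otimes> a') \<otimes> (b \<otimes> (b' \<otimes> y [^] half)) = ((a \<otimes> a') \<otimes> (b \<otimes> b')) \<otimes> y [^] half" using c by (simp add: m_assoc)
  finally have "list_prod G [a, b, a', b'] = y [^] (2 * val (a, a') + 2 * val (b, b') + half)" by (simp add: va vb yy)
  then have "2 * val (a, a') + 2 * val (b, b') + half \<in> exps {#a, b, a', b'#}" by (rule exps_listI) simp
  moreover have "{#a, b, a', b'#} = union_pairs P" by (rule multiset_eqI) (simp add: P_def union_pairs_def)
  ultimately have "2 * val (a, a') + 2 * val (b, b') + half \<in> exps (union_pairs P)" by metis
  moreover have "set_mset (union_pairs P) \<subseteq> carrier G" using c by (simp add: P_def union_pairs_def)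
  ultimately have "(2 * val (a, a') + 2 * val (b, b') + half) + 2 * (\<Sum>q\<in>#T'. val q) \<in> exps (union_pairs P + union_pairs T')"
    using ex' by (intro exps_add)
  moreover have "(2 * val (a, a') + 2 * val (b, b') + half) + 2 * (\<Sum>q\<in>#T'. val q) = 2 * (\<Sum>q\<in>#T. val q) + half"
    by (simp add: T' P_def)
  ultimately have ex: "2 * (\<Sum>q\<in>#T. val q) + half \<in> exps (union_pairs T)" by (simp add: T' union_pairs_add)
  have "union_pairs T \<subseteq># S" using union_pairs_mono[OF T(2)]
    by (rule subset_mset.order_trans) (simp add: Sqs union_pairs_mset)
  moreover have "size (union_pairs T) = n" using T(3) m(4) by (simp add: size_union_pairs)
  ultimately have "\<not> int n dvd 2 * (\<Sum>q\<in>#T. val q) + half" using no_product_one ex by blast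
  moreover have "int n dvd 2 * (\<Sum>q\<in>#T. val q) + half"
  proof -
    \<comment> \<open>As \<open>u - v\<close> is odd, \<open>m * u + m * v\<close> is
      \<open>m\<close> modulo \<open>half = 2 * m\<close>; doubled, this is \<open>half\<close>
      modulo \<open>n\<close> and cancels the extra factor.\<close>
    obtain r where r: "u - v = 2 * r + 1" using odd_difference[OF uv(1)] by (rule oddE)
    obtain l where l: "(\<Sum>q\<in>#T. val q) - (int m * u + int m * v) = half * l" using T(4) by blast
    have u: "u = v + 2 * r + 1" using r by simp
    have "(\<Sum>q\<in>#T. val q) = half * (l + r + v) + int m" using l unfolding u m(3) by (simp add: algebra_simps)
    then have "2 * (\<Sum>q\<in>#T. val q) + half = int n * (l + r + v + 1)" using m(3) two_half by (simp add: algebra_simps)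
    then show ?thesis by simp
  qed
  ultimately show False by blast
qed

text \<open>Four terms of different types again have two product values differing by \<open>y [^] half\<close>, while the sums of
  \<open>z - 2\<close> values out of \<open>u\<close> and \<open>v\<close> miss at most one residue modulo \<open>z\<close>.\<close>

lemma some_type_missing:
  assumes all: "\<And>t. part t \<noteq> {#}"
  shows False
proof -
  obtain a b c d where m: "a \<in># part (True, False)" "b \<in># part (False, True)" "c \<in># part (True, True)" "d \<in># part (False, False)"
    using all by (metis multiset_nonemptyE)
  note e = m[THEN part_elem]
  have cl: "a \<in> carrier G" "b \<in> carrier G" "c \<in> carrier G" "d \<in> carrier G"
    and tys: "ty a = (True, False)" "ty b = (False, True)" "ty c = (True, True)" "ty d = (False, False)" using e by auto
  have dist: "a \<noteq> b" "a \<noteq> c" "a \<noteq> d" "b \<noteq> c" "b \<noteq> d" "c \<noteq> d" using tys by auto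
  define K where "K = {#a, b, c, d#}"
  have "1 \<le> count S a" "1 \<le> count S b" "1 \<le> count S c" "1 \<le> count S d" using e by (simp_all add: Suc_le_eq)
  then have KS: "K \<subseteq># S" unfolding K_def using dist by (intro mset_subset_eqI) auto
  have imK: "count (image_mset ty K) t = 1" for t
    by (cases t; cases "fst t"; cases "snd t") (auto simp: K_def tys)
  define R where "R = S - K"
  obtain ps L where d: "R = pairs_mset ps + L" "\<forall>(a, b)\<in>set ps. ty a = ty b" "\<forall>t. count (image_mset ty L) t \<le> 1"
    by (rule pair_decomposition)
  \<comment> \<open>\<open>K\<close> has one term of each type, so whatever is left over in
    \<open>R\<close> can be paired with terms of \<open>K\<close>. By \<open>decomposition\<close>
    three terms of \<open>K\<close> stay unpaired; hence one pair meets \<open>K\<close>, and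
    \<open>n - 3\<close> pairs avoid it.\<close>
  have "image_mset ty L \<subseteq># image_mset ty K" using d(3) imK by (intro mset_subset_eqI) metis
  then obtain K1 where K1: "K1 \<subseteq># K" "image_mset ty K1 = image_mset ty L" by (rule subseteq_image_mset_pullback)
  obtain ps1 where ps1: "pairs_mset ps1 = K1 + L" "\<forall>(a, b)\<in>set ps1. ty a = ty b" "length ps1 = size K1"
    using K1(2) by (rule pair_up)
  define K2 where "K2 = K - K1"
  have KK: "K = K1 + K2" unfolding K2_def using K1(1) by (simp add: subset_mset.add_diff_inverse)
  have SKR: "S = K + R" unfolding R_def using KS by (simp add: subset_mset.add_diff_inverse)
  then have Sd: "S = pairs_mset (ps1 @ ps) + K2" using ps1(1) d(1) KK by (simp add: add.commute add.left_commute)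
  have td: "\<forall>(a, b)\<in>set (ps1 @ ps). ty a = ty b" using ps1(2) d(2) by auto
  have "\<forall>t. count (image_mset ty K2) t \<le> 1"
  proof
    fix t have "count (image_mset ty K2) t \<le> count (image_mset ty K) t" by (simp add: KK)
    then show "count (image_mset ty K2) t \<le> 1" using imK by simp
  qed
  note dec = decomposition[OF Sd td this]
  have "size K1 = 1" using dec(1) KK by (metis K_def add_right_cancel eval_nat_numeral(3) numeral_3_eq_3 One_nat_def plus_1_eq_Suc size_add_mset size_empty size_union)
  then obtain q where q: "ps1 = [q]" using ps1(3) by (metis One_nat_def length_0_conv length_Suc_conv)
  have lenps: "length ps = 2 * (n div 2) - 3" using dec(2) q by simp
  obtain u v where uv: "coprime (u - v) half" "image_mset (\<lambda>q. val q mod half) (mset (ps1 @ ps)) =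
      replicate_mset (n div 2 - 1) (u mod half) + replicate_mset (n div 2 - 1) (v mod half)"
    using dec(3) by blast
  note ne = values_differ[OF uv(1)]
  obtain m where m: "n div 2 = 2 * m" "2 \<le> m" "half = 2 * int m" "n = 4 * m" by (rule quarter)
  define Z where "Z = image_mset (\<lambda>q. val q mod half) (mset ps)"
  have Z: "add_mset (val q mod half) Z = replicate_mset (n div 2 - 1) (u mod half) + replicate_mset (n div 2 - 1) (v mod half)"
    using uv(2) by (simp add: Z_def q)
  have cnt: "2 * m - 2 \<le> count Z (u mod half)" "2 * m - 2 \<le> count Z (v mod half)"
  proof -
    have "count (add_mset (val q mod half) Z) (u mod half) = 2 * m - 1" unfolding Z using ne m(1) by simp
    moreover have "count (add_mset (val q mod half) Z) (v mod half) = 2 * m - 1" unfolding Z using ne m(1) by simp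
    ultimately show "2 * m - 2 \<le> count Z (u mod half)" "2 * m - 2 \<le> count Z (v mod half)"
      by (auto split: if_splits)
  qed
  \<comment> \<open>The four terms of \<open>K\<close> and \<open>2 * m - 2\<close> pairs make
    \<open>n\<close> terms. Each value still occurs at least \<open>2 * m - 2\<close> times, so
    \<open>i\<close> ranges over \<open>0\<close> to \<open>half - 2\<close>.\<close>
  have sel: "\<exists>T. T \<subseteq># mset ps \<and> size T = 2 * m - 2 \<and> half dvd (\<Sum>q\<in>#T. val q) - (int i * (u - v) + (half - 2) * v)"
    if i: "i \<le> 2 * m - 2" for i
  proof -
    obtain T where T: "{#} \<subseteq># T" "T \<subseteq># mset ps" "size T = i + (2 * m - 2 - i)"
      "half dvd (\<Sum>q\<in>#T. val q) - (int i * u + int (2 * m - 2 - i) * v)"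
    proof (rule select_two_values[of "{#}" "mset ps" u "n div 2" v val i "2 * m - 2 - i"])
      show "i \<le> size (filter_mset (\<lambda>q. val q mod half = u mod half) (mset ps))"
        unfolding filter_value[OF Z_def[symmetric]] using cnt(1) i by linarith
      show "2 * m - 2 - i \<le> size (filter_mset (\<lambda>q. val q mod half = v mod half) (mset ps))"
        unfolding filter_value[OF Z_def[symmetric]] using cnt(2) by linarith
    qed (use ne in auto)
    have k: "int (2 * m - 2 - i) = half - 2 - int i" using i m by linarith
    have "int i * u + int (2 * m - 2 - i) * v = int i * (u - v) + (half - 2) * v" unfolding k by (simp add: algebra_simps)
    then show ?thesis using T i by (intro exI[of _ T]) auto
  qed
  have "\<exists>j. (a \<otimes> b) \<otimes> (c \<otimes> d) = y [^] (2 * j :: int)"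
    by (rule trivial_type) (use cl tys in \<open>auto simp: ty_mult\<close>)
  then obtain t where t: "(a \<otimes> b) \<otimes> (c \<otimes> d) = y [^] (2 * t :: int)" by blast
  have e1: "2 * t \<in> exps K" unfolding K_def
    by (rule exps_listI[of "[a, b, c, d]"]) (use cl t in \<open>simp_all add: m_assoc\<close>)
  have tyh: "ty (y [^] half) = (False, False)" using even_half by (simp add: ty_pow)
  have e2: "2 * t + half \<in> exps K"
  proof (rule exps_listI[of "[b, a, c, d]"])
    have "list_prod G [b, a, c, d] = (b \<otimes> a) \<otimes> (c \<otimes> d)" using cl by (simp add: m_assoc)
    also have "b \<otimes> a = (a \<otimes> b) \<otimes> y [^] half" by (rule commute_twist) (use cl tys in auto)
    also have "((a \<otimes> b) \<otimes> y [^] half) \<otimes> (c \<otimes> d) = (a \<otimes> b) \<otimes> (y [^] half \<otimes> (c \<otimes> d))" using cl by (simp add: m_assoc)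
    also have "y [^] half \<otimes> (c \<otimes> d) = (c \<otimes> d) \<otimes> y [^] half" using commute_trivial[of "y [^] half" "c \<otimes> d"] cl tyh by simp
    also have "(a \<otimes> b) \<otimes> ((c \<otimes> d) \<otimes> y [^] half) = ((a \<otimes> b) \<otimes> (c \<otimes> d)) \<otimes> y [^] half" using cl by (simp add: m_assoc)
    finally show "list_prod G [b, a, c, d] = y [^] (2 * t + half)" by (simp add: t yy)
  qed (simp add: K_def add_mset_commute)
  have fin: False if T: "T \<subseteq># mset ps" "size T = 2 * m - 2" and e: "2 * e \<in> exps K" "half dvd e + (\<Sum>q\<in>#T. val q)" for T e
  proof -
    have "\<forall>(a, b)\<in>#T. a \<in> carrier G \<and> b \<in> carrier G \<and> ty a = ty b"
      using pairs_ok[OF Sd td] set_mset_mono[OF T(1)] by auto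
    then have "set_mset (union_pairs T) \<subseteq> carrier G" "2 * (\<Sum>q\<in>#T. val q) \<in> exps (union_pairs T)"
      using exps_union_pairs by blast+
    then have "2 * e + 2 * (\<Sum>q\<in>#T. val q) \<in> exps (K + union_pairs T)"
      using e(1) cl by (intro exps_add) (auto simp: K_def)
    moreover have "K + union_pairs T \<subseteq># S"
    proof -
      have "union_pairs T \<subseteq># R" using union_pairs_mono[OF T(1)]
        by (rule subset_mset.order_trans) (simp add: d(1) union_pairs_mset)
      then show ?thesis unfolding SKR by simp
    qed
    moreover have "size (K + union_pairs T) = n"
    proof -
      have "size (K + union_pairs T) = 4 + 2 * (2 * m - 2)" using T(2) by (simp add: size_union_pairs K_def)
      then show ?thesis using m(2,4) by linarith
    qed
    moreover have "2 * half dvd 2 * (e + (\<Sum>q\<in>#T. val q))" using e(2) by (rule mult_dvd_mono[OF dvd_refl])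
    then have "int n dvd 2 * e + 2 * (\<Sum>q\<in>#T. val q)" unfolding two_half distrib_left .
    ultimately show False using no_product_one by blast
  qed
  \<comment> \<open>As \<open>u - v\<close> is a unit modulo \<open>half\<close>, a residue
    \<open>i0\<close> makes the total vanish. Only \<open>i0 = half - 1\<close> is out of range;
    then \<open>i0 - m\<close> works with the second product of \<open>K\<close>, because
    \<open>m * (u - v)\<close> is \<open>m\<close> modulo \<open>half\<close>.\<close>
  obtain w l where w: "w * (u - v) + l * half = 1"
    using bezout_int[of "u - v" half] uv(1) by (auto simp: coprime_iff_gcd_eq_1)
  define c0 where "c0 = - t - (half - 2) * v"
  define i0 where "i0 = (w * c0) mod half"
  have i0: "0 \<le> i0" "i0 < half" using half_ge by (auto simp: i0_def)
  have key: "half dvd t + (i0 * (u - v) + (half - 2) * v)"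
  proof -
    define k where "k = (w * c0) div half"
    have i0_eq: "i0 = w * c0 - half * k" unfolding i0_def k_def by (simp add: minus_mult_div_eq_mod)
    have w': "w * (u - v) = 1 - l * half" using w by linarith
    have "i0 * (u - v) = c0 * (w * (u - v)) - half * (k * (u - v))" unfolding i0_eq by (simp add: algebra_simps)
    also have "\<dots> = c0 - half * (c0 * l + k * (u - v))" unfolding w' by (simp add: algebra_simps)
    finally have "t + (i0 * (u - v) + (half - 2) * v) = half * (- (c0 * l + k * (u - v)))" unfolding c0_def by linarith
    then show ?thesis by simp
  qed
  show False
  proof (cases "i0 \<le> half - 2")
    case True
    then have "nat i0 \<le> 2 * m - 2" "int (nat i0) = i0" using i0 m by linarith+
    then obtain T where T: "T \<subseteq># mset ps" "size T = 2 * m - 2" "half dvd (\<Sum>q\<in>#T. val q) - (i0 * (u - v) + (half - 2) * v)"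
      using sel[of "nat i0"] by auto
    have "half dvd ((\<Sum>q\<in>#T. val q) - (i0 * (u - v) + (half - 2) * v)) + (t + (i0 * (u - v) + (half - 2) * v))"
      using T(3) key by (rule dvd_add)
    then have "half dvd t + (\<Sum>q\<in>#T. val q)" by (simp add: algebra_simps)
    then show False using fin[OF T(1,2) e1] by blast
  next
    case False
    have i0': "i0 - int m \<ge> 0" "nat (i0 - int m) \<le> 2 * m - 2" using False i0 m by linarith+
    then have eq: "int (nat (i0 - int m)) = i0 - int m" by simp
    obtain T where T: "T \<subseteq># mset ps" "size T = 2 * m - 2"
      "half dvd (\<Sum>q\<in>#T. val q) - ((i0 - int m) * (u - v) + (half - 2) * v)"
      using sel[OF i0'(2)] unfolding eq by auto
    obtain r where r: "u - v = 2 * r + 1" using odd_difference[OF uv(1)] by (rule oddE)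
    have "half dvd ((\<Sum>q\<in>#T. val q) - ((i0 - int m) * (u - v) + (half - 2) * v)) + (t + (i0 * (u - v) + (half - 2) * v))"
      using T(3) key by (rule dvd_add)
    then have "half dvd (\<Sum>q\<in>#T. val q) + t + int m * (u - v)" by (simp add: algebra_simps)
    moreover have "int m * (u - v) = int m + half * r" unfolding r m(3) by (simp add: algebra_simps)
    ultimately have "half dvd ((\<Sum>q\<in>#T. val q) + t + int m) + half * r" by (simp add: add.assoc)
    then have "half dvd (\<Sum>q\<in>#T. val q) + t + int m" by (metis dvd_add_left_iff dvd_triv_left)
    then have "half dvd (t + int m) + (\<Sum>q\<in>#T. val q)" by (simp add: add_ac)
    moreover have "2 * (t + int m) \<in> exps K" using e2 m(3) by simp
    ultimately show False using fin[OF T(1,2)] by blast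
  qed
qed

text \<open>Either \<open>e0\<close> or \<open>e2\<close> can be the unpaired term, all other pairs
  being kept. Both families of values are extremal, so \<open>exchange_value\<close> gives
  \<open>e1 \<otimes> e2 = e0 \<otimes> e1\<close>, and terms of equal type commute. Oddness
  guarantees that no other term of type \<open>t\<close> is left over.\<close>

lemma exchange:
  assumes sub: "{#e0, e1, e2#} \<subseteq># part t" and odd: "odd (size (part t))"
  shows "e0 = e2"
proof -
  have "e0 \<in># part t" "e1 \<in># part t" "e2 \<in># part t" using sub by (auto dest: mset_subset_eqD)
  note e = this[THEN part_elem]
  have c: "e0 \<in> carrier G" "e1 \<in> carrier G" "e2 \<in> carrier G" and tys: "ty e0 = t" "ty e1 = t" "ty e2 = t" using e by auto
  define R where "R = S - {#e0, e1, e2#}"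
  have "{#e0, e1, e2#} \<subseteq># S" using sub part_sub by (rule subset_mset.order_trans)
  then have SR: "S = {#e0, e1, e2#} + R" unfolding R_def by (rule subset_mset.add_diff_inverse[symmetric])
  obtain ps L where d: "R = pairs_mset ps + L" "\<forall>(a, b)\<in>set ps. ty a = ty b" "\<forall>t. count (image_mset ty L) t \<le> 1"
    by (rule pair_decomposition)
  have "image_mset ty S = {#t, t, t#} + (image_mset ty (pairs_mset ps) + image_mset ty L)"
    using arg_cong[OF SR, of "image_mset ty"] by (simp add: tys d(1))
  then have "size (part t) = 3 + (count (image_mset ty (pairs_mset ps)) t + count (image_mset ty L) t)"
    by (simp add: size_part)
  then have "even (count (image_mset ty L) t)" using odd even_count_pairs[OF d(2), of t] by simp
  moreover have "count (image_mset ty L) t \<le> 1" using d(3) by blast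
  ultimately have L0: "count (image_mset ty L) t = 0" by (cases "count (image_mset ty L) t") auto
  have dec: "\<exists>u v. u mod half \<noteq> v mod half \<and> add_mset (val (f, g) mod half) (image_mset (\<lambda>q. val q mod half) (mset ps)) =
      replicate_mset (n div 2 - 1) (u mod half) + replicate_mset (n div 2 - 1) (v mod half)"
    if "{#e0, e1, e2#} = {#f, g, h#}" "ty f = t" "ty g = t" "ty h = t" for f g h
  proof -
    have "S = {#f, g, h#} + R" using SR unfolding that(1) .
    then have 1: "S = pairs_mset ((f, g) # ps) + add_mset h L" by (simp add: d(1))
    have 2: "\<forall>(a, b)\<in>set ((f, g) # ps). ty a = ty b" using d(2) that by simp
    have 3: "\<forall>t. count (image_mset ty (add_mset h L)) t \<le> 1"
    proof
      fix t'
      show "count (image_mset ty (add_mset h L)) t' \<le> 1"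
        using d(3)[rule_format, of t'] L0 that(4) by (cases "t' = t") simp_all
    qed
    show ?thesis using decomposition(3)[OF 1 2 3] values_differ by fastforce
  qed
  obtain u v where 1: "u mod half \<noteq> v mod half" "add_mset (val (e1, e2) mod half) (image_mset (\<lambda>q. val q mod half) (mset ps)) =
      replicate_mset (n div 2 - 1) (u mod half) + replicate_mset (n div 2 - 1) (v mod half)"
    using dec[of e1 e2 e0] tys by (auto simp: add_mset_commute)
  obtain u' v' where 2: "u' mod half \<noteq> v' mod half" "add_mset (val (e0, e1) mod half) (image_mset (\<lambda>q. val q mod half) (mset ps)) =
      replicate_mset (n div 2 - 1) (u' mod half) + replicate_mset (n div 2 - 1) (v' mod half)"
    using dec[of e0 e1 e2] tys by auto
  have "val (e1, e2) mod half = val (e0, e1) mod half"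
    by (rule exchange_value[OF 1(2) 2(2) 1(1) 2(1)]) (use n8 in linarith)
  then have "half dvd val (e1, e2) - val (e0, e1)" by (simp add: mod_eq_dvd_iff)
  then have "2 * half dvd 2 * (val (e1, e2) - val (e0, e1))" by (rule mult_dvd_mono[OF dvd_refl])
  then have "int n dvd 2 * val (e1, e2) - 2 * val (e0, e1)" unfolding two_half right_diff_distrib .
  then have "e1 \<otimes> e2 = e0 \<otimes> e1" using val[OF c(2,3)] val[OF c(1,2)] tys by (simp add: y_eq_iff)
  also have "\<dots> = e1 \<otimes> e0" using commute_same[OF c(1,2)] tys by simp
  finally show ?thesis using c by simp
qed

lemma odd_part_constant:
  assumes "odd (size (part t))"
  obtains c where "part t = replicate_mset (size (part t)) c" "ty c = t" "c \<in> carrier G"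
proof -
  have "part t \<noteq> {#}" using assms by auto
  then obtain c where c: "c \<in># part t" by blast
  have "g = c" if g: "g \<in># part t" for g
  proof (rule ccontr)
    assume "g \<noteq> c"
    then have "g \<in># part t - {#c#}" using g by (simp add: in_diff_count)
    then obtain R where R: "part t = {#c, g#} + R" using c by (metis add_mset_add_single insert_DiffM union_commute union_mset_add_mset_left)
    then have "R \<noteq> {#}" using assms by auto
    then obtain e where "e \<in># R" by blast
    then have "{#c, e, g#} \<subseteq># part t" by (simp add: R add_mset_commute)
    then show False using exchange assms \<open>g \<noteq> c\<close> by blast
  qed
  then have "set_mset (part t) \<subseteq> {c}" by blast
  then have "part t = replicate_mset (size (part t)) c" by (rule set_mset_subset_singletonD)
  then show ?thesis using that part_elem[OF c] by blast
qed

lemma replicate_bound: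
  assumes "replicate_mset k c \<subseteq># S" "c \<in> carrier G"
  shows "k \<le> n - 1"
proof (rule ccontr)
  assume "\<not> ?thesis"
  then have "n \<le> k" by linarith
  then have "replicate_mset n c \<subseteq># replicate_mset k c" by (metis count_le_replicate_mset_subset_eq count_replicate_mset)
  then have sub: "replicate_mset n c \<subseteq># S" using assms(1) by (rule subset_mset.order_trans)
  have "union_pairs (replicate_mset j (c, c)) = replicate_mset (2 * j) c" for j
    by (induction j) (auto simp: union_pairs_def)
  then have "union_pairs (replicate_mset (n div 2) (c, c)) = replicate_mset n c" using n4 by auto
  moreover have "2 * (\<Sum>q\<in>#replicate_mset (n div 2) (c, c). val q) \<in> exps (union_pairs (replicate_mset (n div 2) (c, c)))"
    using exps_union_pairs[of "replicate_mset (n div 2) (c, c)"] assms(2) by (auto simp: in_replicate_mset split: if_splits)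
  ultimately have "2 * (half * val (c, c)) \<in> exps (replicate_mset n c)"
    by (simp add: image_replicate_mset sum_mset_replicate_mset)
  moreover have "int n dvd 2 * (half * val (c, c))" by (simp add: two_half flip: mult.assoc)
  ultimately show False using no_product_one[OF sub] by simp
qed

text \<open>The three leftover terms have distinct types, so three types occur an odd number of
  times and the fourth is the empty one. Each of the three is constant with multiplicity at most
  \<open>n - 1\<close>, and of two nontrivial ones one has a single term. This reaches
  \<open>2 * n - 1\<close> only as \<open>(n - 1) + (n - 1) + 1\<close>.\<close>

lemma two_value_structure:
  obtains c a b where "S = replicate_mset (n - 1) c + replicate_mset (n - 1) a + {#b#}"
    "c \<in> carrier G" "a \<in> carrier G" "b \<in> carrier G" "ty c = (False, False)" "ty a \<noteq> (False, False)"
    "ty b \<noteq> (False, False)" "ty b \<noteq> ty a"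
proof -
  obtain ps L where d: "S = pairs_mset ps + L" "\<forall>(a, b)\<in>set ps. ty a = ty b" "\<forall>t. count (image_mset ty L) t \<le> 1"
    by (rule pair_decomposition)
  have L3: "size L = 3" by (rule decomposition(1)[OF d])
  have par: "odd (size (part t)) \<longleftrightarrow> count (image_mset ty L) t = 1" for t
  proof -
    have "image_mset ty S = image_mset ty (pairs_mset ps) + image_mset ty L"
      using arg_cong[OF d(1), of "image_mset ty"] by simp
    then have "size (part t) = count (image_mset ty (pairs_mset ps)) t + count (image_mset ty L) t"
      by (simp add: size_part)
    moreover have "count (image_mset ty L) t \<le> 1" using d(3) by blast
    ultimately show ?thesis using even_count_pairs[OF d(2), of t] by (cases "count (image_mset ty L) t") auto
  qed
  have univ: "t = (False, False) \<or> t = (True, False) \<or> t = (False, True) \<or> t = (True, True)" for t :: "bool \<times> bool"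
    by (cases t) auto
  have sumL: "count (image_mset ty L) (False, False) + count (image_mset ty L) (True, False) +
      count (image_mset ty L) (False, True) + count (image_mset ty L) (True, True) = size L"
    by (rule sum_count_types)
  have sumS: "size (part (False, False)) + size (part (True, False)) + size (part (False, True)) + size (part (True, True)) = size S"
    unfolding size_part by (rule sum_count_types)
  obtain t0 where t0: "part t0 = {#}" using some_type_missing by blast
  have odd: "odd (size (part t))" if "t \<noteq> t0" for t
  proof (rule ccontr)
    assume "\<not> ?thesis"
    then have "count (image_mset ty L) t = 0" using par d(3)[rule_format, of t] by (cases "count (image_mset ty L) t") auto
    moreover have "count (image_mset ty L) t0 = 0" using par[of t0] d(3)[rule_format, of t0] t0
      by (cases "count (image_mset ty L) t0") auto
    ultimately show False using univ[of t] univ[of t0] that sumL L3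
        d(3)[rule_format, of "(False, False)"] d(3)[rule_format, of "(True, False)"]
        d(3)[rule_format, of "(False, True)"] d(3)[rule_format, of "(True, True)"]
      by (elim disjE) simp_all
  qed
  have single: "size (part t) = 1 \<or> size (part t') = 1"
    if "t \<noteq> t'" "t \<noteq> (False, False)" "t' \<noteq> (False, False)" "t \<noteq> t0" "t' \<noteq> t0" for t t'
  proof -
    have "\<not> (2 \<le> size (part t) \<and> 2 \<le> size (part t'))" using pairs_in_one_type[of t t'] that by blast
    moreover have "odd (size (part t))" "odd (size (part t'))" using odd that by blast+
    ultimately show ?thesis by presburger
  qed
  have bound: "size (part t) \<le> n - 1" if tt: "t \<noteq> t0" for t
  proof -
    obtain c where c: "part t = replicate_mset (size (part t)) c" "ty c = t" "c \<in> carrier G"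
      using odd_part_constant[OF odd[OF tt]] by blast
    then show ?thesis using replicate_bound[of "size (part t)" c] part_sub[of t] by simp
  qed
  \<comment> \<open>Three nontrivial types would account for at most \<open>(n - 1) + 1 + 1\<close>
    terms.\<close>
  have "t0 \<noteq> (False, False)"
  proof
    assume eq: "t0 = (False, False)"
    show False using single[of "(True, False)" "(False, True)"] single[of "(True, False)" "(True, True)"]
      single[of "(False, True)" "(True, True)"] bound[of "(True, False)"] bound[of "(False, True)"] bound[of "(True, True)"]
      sumS t0 szS n8 unfolding eq by auto
  qed
  then obtain t1 t2 where t12: "t1 \<noteq> t2" "t1 \<noteq> (False, False)" "t2 \<noteq> (False, False)" "t1 \<noteq> t0" "t2 \<noteq> t0"
    "size (part (False, False)) + size (part t1) + size (part t2) = size S"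
    using univ[of t0] t0 sumS
    by (elim disjE) (auto intro: that[of "(False, True)" "(True, True)"] that[of "(True, False)" "(True, True)"] that[of "(True, False)" "(False, True)"])
  have "\<exists>t1 t2. t1 \<noteq> t2 \<and> t1 \<noteq> (False, False) \<and> t2 \<noteq> (False, False) \<and> t1 \<noteq> t0 \<and> t2 \<noteq> t0 \<and> size (part t2) = 1 \<and>
    size (part (False, False)) + size (part t1) + size (part t2) = size S"
  proof (cases "size (part t2) = 1")
    case True
    then show ?thesis using t12 by blast
  next
    case False
    then have "size (part t1) = 1" using single[OF t12(1-5)] by blast
    then show ?thesis using t12 by (intro exI[of _ t2] exI[of _ t1]) auto
  qed
  then obtain t1 t2 where t: "t1 \<noteq> t2" "t1 \<noteq> (False, False)" "t2 \<noteq> (False, False)" "t1 \<noteq> t0" "t2 \<noteq> t0" "size (part t2) = 1"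
    "size (part (False, False)) + size (part t1) + size (part t2) = size S" by blast
  have s0: "size (part (False, False)) = n - 1" and s1: "size (part t1) = n - 1"
    using bound[of "(False, False)"] bound[OF t(4)] t(6,7) szS \<open>t0 \<noteq> (False, False)\<close> n8 by auto
  obtain c where c: "part (False, False) = replicate_mset (n - 1) c" "ty c = (False, False)" "c \<in> carrier G"
    using odd_part_constant[OF odd[of "(False, False)"]] s0 \<open>t0 \<noteq> (False, False)\<close> by metis
  obtain a where a: "part t1 = replicate_mset (n - 1) a" "ty a = t1" "a \<in> carrier G"
    using odd_part_constant[OF odd[OF t(4)]] s1 by metis
  obtain b where b: "part t2 = {#b#}" using t(6) size_1_singleton_mset by blast
  have bb: "b \<in> carrier G" "ty b = t2" using part_elem[of b t2] b by auto
  have "part (False, False) + part t1 + part t2 \<subseteq># S"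
  proof -
    have "part (False, False) + part t1 \<subseteq># filter_mset (\<lambda>g. ty g = (False, False) \<or> ty g = t1) S"
      using t(2) by (intro mset_subset_eqI) (auto simp: part_def)
    then show ?thesis by (rule subseteq_filter_disjoint[of _ _ _ _ "\<lambda>g. ty g = t2"]) (use t in \<open>auto simp: part_def\<close>)
  qed
  moreover have "size (part (False, False) + part t1 + part t2) = size S" using t(7) by simp
  ultimately have "S = part (False, False) + part t1 + part t2"
    by (metis mset_subset_size nat_neq_iff subset_mset.le_neq_trans)
  then have "S = replicate_mset (n - 1) c + replicate_mset (n - 1) a + {#b#}" unfolding c(1) a(1) b .
  then show ?thesis using that c(2,3) a(2,3) bb t by metis
qed

end

section \<open>Sequences without product-one subsequence of prescribed length\<close>

context dicyclic_like
begin

lemma square_even_power: "g \<in> carrier G \<Longrightarrow> \<exists>k. g \<otimes> g = y [^] (2 * k :: int)"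
  using ty_mult[of g g] by (intro trivial_type) auto

lemma product_one_replicate:
  assumes g: "g \<in> carrier G"
  shows "product_one G (replicate_mset n g)"
proof -
  have "\<exists>i\<in>exps (replicate_mset n g). int n dvd i"
  proof (cases "N g")
    case True
    obtain k :: int where k: "g \<otimes> g = y [^] (2 * k)" using square_even_power[OF g] by blast
    have "2 * k * int j \<in> exps (replicate_mset (2 * j) g)" for j
    proof (induction j)
      case 0
      then show ?case by (simp add: exps_empty)
    next
      case (Suc j)
      have "2 * k \<in> exps {#g, g#}" using k g by (auto simp: exps_def prods_def intro!: exI[of _ "[g, g]"])
      then have "2 * k + 2 * k * int j \<in> exps ({#g, g#} + replicate_mset (2 * j) g)"
        using Suc g by (intro exps_add) (auto simp: in_replicate_mset split: if_splits)
      then show ?case by (simp add: algebra_simps)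
    qed
    from this[of "n div 2"] have "2 * k * half \<in> exps (replicate_mset n g)" using n4 by auto
    moreover have "2 * k * half = int n * k" using two_half by (simp add: mult.assoc mult.left_commute)
    ultimately show ?thesis by (metis dvd_triv_left)
  next
    case False
    have "(\<Sum>h\<in>#replicate_mset n g. ex h) \<in> exps (replicate_mset n g)"
      by (rule exps_sum) (use False g in \<open>auto simp: in_replicate_mset split: if_splits\<close>)
    then have "int n * ex g \<in> exps (replicate_mset n g)" by (simp add: sum_mset_replicate_mset image_replicate_mset)
    then show ?thesis by (metis dvd_triv_left)
  qed
  then show ?thesis using product_oneI by blast
qed

lemma product_one_add:
  assumes "set_mset A \<subseteq> carrier G" "set_mset B \<subseteq> carrier G" "product_one G A" "product_one G B"
  shows "product_one G (A + B)"
  using exps_add[OF assms(1,2), of 0 0] assms(3,4) by (simp add: product_one_iff)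

section \<open>Converse direction: the listed sequences lack the forbidden subsequences\<close>

lemma list_prod_H:
  assumes "set us \<subseteq> carrier G" "\<forall>u\<in>set us. \<not> N u"
  shows "list_prod G us = y [^] (\<Sum>u\<leftarrow>us. ex u)"
  using assms
proof (induction us)
  case (Cons u us)
  then have "u = y [^] ex u" "list_prod G us = y [^] (\<Sum>u\<leftarrow>us. ex u)" using H_ex by auto
  then show ?case using yy[of "ex u" "\<Sum>u\<leftarrow>us. ex u"] by simp
qed simp

lemma N_list_prod: "set us \<subseteq> carrier G \<Longrightarrow> N (list_prod G us) \<longleftrightarrow> odd (length (filter N us))"
proof (induction us)
  case Nil
  show ?case using not_N_pow[of 0] by simp
next
  case (Cons u us)
  have "N (u \<otimes> list_prod G us) \<longleftrightarrow> N u \<noteq> N (list_prod G us)"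
    using ty_mult[of u "list_prod G us"] Cons.prems list_prod_closed[of us] by (simp add: ty_def)
  then show ?case using Cons by simp
qed

text \<open>A product-one sequence has an even number of terms outside \<open>H\<close>, so the
  single such term cannot be used, and only a congruence between exponents remains. All three
  converses rest on this.\<close>

lemma product_one_two_powers:
  fixes t1 t2 t3 :: int
  assumes T: "T \<subseteq># replicate_mset A (y [^] t1) + replicate_mset B (y [^] t2) + {#x \<otimes> y [^] t3#}"
    and one: "product_one G T"
  obtains i j where "T = replicate_mset i (y [^] (t1 :: int)) + replicate_mset j (y [^] (t2 :: int))"
    "i \<le> A" "j \<le> B" "int n dvd int i * t1 + int j * t2"
proof -
  define M where "M = replicate_mset A (y [^] t1) + replicate_mset B (y [^] t2)"
  have MH: "g \<in> carrier G \<and> \<not> N g" if "g \<in># M" for g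
    using that by (auto simp: M_def in_replicate_mset split: if_splits)
  have cT: "set_mset T \<subseteq> carrier G"
  proof
    fix g assume "g \<in># T"
    then have "g \<in># M + {#x \<otimes> y [^] t3#}" using T unfolding M_def by (rule mset_subset_eqD[rotated])
    then show "g \<in> carrier G" using MH by auto
  qed
  obtain us where us: "mset us = T" "list_prod G us = \<one>" using one by (auto simp: product_one_def)
  have "filter_mset N M = {#}" using MH by (simp add: filter_mset_eq_conv)
  then have "filter_mset N (M + {#x \<otimes> y [^] t3#}) = {#x \<otimes> y [^] t3#}" by simp
  then have "filter_mset N T \<subseteq># {#x \<otimes> y [^] t3#}"
    using multiset_filter_mono[OF T, of N] unfolding M_def by metis
  then have "size (filter_mset N T) \<le> 1" using size_mset_mono by fastforce
  moreover have "\<not> N (list_prod G us)" using us(2) not_N_pow[of 0] by simp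
  then have "even (size (filter_mset N T))" using N_list_prod[of us] us(1) cT by (metis mset_filter set_mset_mset size_mset)
  ultimately have "size (filter_mset N T) = 0" by (cases "size (filter_mset N T)") auto
  then have empty: "filter_mset N T = {#}" by simp
  have TH: "\<not> N g" if "g \<in># T" for g
  proof
    assume "N g"
    then have "g \<in># filter_mset N T" using that by simp
    then show False unfolding empty by simp
  qed
  then have e0: "count T (x \<otimes> y [^] t3) = 0" using N_x_pow not_in_iff by metis
  have TM: "T \<subseteq># M"
  proof (rule mset_subset_eqI)
    fix g
    have "count T g \<le> count (M + {#x \<otimes> y [^] t3#}) g" using T unfolding M_def by (rule mset_subset_eq_count)
    then show "count T g \<le> count M g" using e0 by (cases "g = x \<otimes> y [^] t3") simp_all
  qed
  have "\<exists>i j. T = replicate_mset i (y [^] t1) + replicate_mset j (y [^] t2) \<and> i \<le> A \<and> j \<le> B"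
  proof (cases "y [^] t1 = y [^] t2")
    \<comment> \<open>If the powers coincide, only the total multiplicity is determined; the first
      \<open>A\<close> copies are assigned to \<open>t1\<close>.\<close>
    case True
    then have "M = replicate_mset (A + B) (y [^] t1)" by (intro multiset_eqI) (simp add: M_def)
    then have "set_mset T \<subseteq> {y [^] t1}" using set_mset_mono[OF TM] by (auto simp: in_replicate_mset split: if_splits)
    then have Teq: "T = replicate_mset (size T) (y [^] t1)" by (rule set_mset_subset_singletonD)
    have "size T \<le> A + B" using size_mset_mono[OF TM] by (simp add: M_def)
    then have "size T = min (size T) A + (size T - A)" "size T - A \<le> B" by linarith+
    moreover have "replicate_mset (min (size T) A + (size T - A)) (y [^] t1) =
        replicate_mset (min (size T) A) (y [^] t1) + replicate_mset (size T - A) (y [^] t1)"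
      by (rule multiset_eqI) simp
    ultimately have "T = replicate_mset (min (size T) A) (y [^] t1) + replicate_mset (size T - A) (y [^] t2)"
      using Teq True by metis
    then show ?thesis using \<open>size T - A \<le> B\<close> min.cobounded2 by blast
  next
    case False
    have le: "count T g \<le> count M g" for g using TM by (rule mset_subset_eq_count)
    have "T = replicate_mset (count T (y [^] t1)) (y [^] t1) + replicate_mset (count T (y [^] t2)) (y [^] t2)"
    proof (rule multiset_eqI)
      fix g show "count T g = count (replicate_mset (count T (y [^] t1)) (y [^] t1) + replicate_mset (count T (y [^] t2)) (y [^] t2)) g"
        using le[of g] False by (auto simp: M_def)
    qed
    moreover have "count T (y [^] t1) \<le> A" "count T (y [^] t2) \<le> B"
      using le[of "y [^] t1"] le[of "y [^] t2"] False by (auto simp: M_def)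
    ultimately show ?thesis by blast
  qed
  then obtain i j where ij: "T = replicate_mset i (y [^] t1) + replicate_mset j (y [^] t2)" "i \<le> A" "j \<le> B" by blast
  have "list_prod G us = y [^] (\<Sum>u\<leftarrow>us. ex u)" by (rule list_prod_H) (use us(1) cT TH in auto)
  then have "int n dvd (\<Sum>u\<leftarrow>us. ex u)" using us(2) y_eq_one_iff by metis
  also have "(\<Sum>u\<leftarrow>us. ex u) = (\<Sum>g\<in>#T. ex g)" by (simp flip: us(1) sum_mset_sum_list)
  also have "\<dots> = int i * ex (y [^] t1) + int j * ex (y [^] t2)"
    by (simp add: ij(1) image_replicate_mset sum_mset_replicate_mset)
  finally have "int n dvd int i * ex (y [^] t1) + int j * ex (y [^] t2)" .
  moreover have "int n dvd int i * (ex (y [^] t1) - t1) + int j * (ex (y [^] t2) - t2)"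
    using ex_pow by (intro dvd_add dvd_mult) auto
  ultimately have "int n dvd (int i * ex (y [^] t1) + int j * ex (y [^] t2)) - (int i * (ex (y [^] t1) - t1) + int j * (ex (y [^] t2) - t2))"
    by (rule dvd_diff)
  then have "int n dvd int i * t1 + int j * t2" by (simp add: algebra_simps)
  then show ?thesis using that ij by blast
qed

text \<open>With \<open>i + j = k * n\<close> the congruence becomes \<open>n\<close> dividing
  \<open>j * (t1 - t2)\<close>, hence \<open>j\<close>; but \<open>0 < j < n\<close>. Length
  \<open>n\<close> is \<open>k = 1\<close>, length \<open>2 * n\<close> is
  \<open>k = 2\<close>.\<close>

lemma two_powers_no_product_one:
  fixes t1 t2 t3 :: int
  assumes cop: "gcd (t1 - t2) (int n) = 1"
    and T: "T \<subseteq># replicate_mset A (y [^] t1) + replicate_mset B (y [^] t2) + {#x \<otimes> y [^] t3#}"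
    and one: "product_one G T" and sz: "size T = k * n" and A: "A < k * n" "k * n \<le> A + n" and B: "B \<le> n - 1"
  shows False
proof -
  obtain i j where ij: "T = replicate_mset i (y [^] (t1 :: int)) + replicate_mset j (y [^] (t2 :: int))"
    "i \<le> A" "j \<le> B" "int n dvd int i * t1 + int j * t2"
    using T one by (rule product_one_two_powers)
  have "i + j = k * n" using sz ij(1) by simp
  then have j: "int i = int k * int n - int j" "0 < j" using ij(2) A by (simp_all flip: of_nat_mult)
  have "int n dvd int i * t1 + int j * t2" by (rule ij(4))
  also have "int i * t1 + int j * t2 = int n * (int k * t1) - int j * (t1 - t2)" unfolding j(1) by (simp add: algebra_simps)
  finally have "int n dvd int j * (t1 - t2)" by (metis dvd_diff_right_iff dvd_triv_left)
  then have "int n dvd int j" using cop by (metis coprime_dvd_mult_left_iff coprime_iff_gcd_eq_1 gcd.commute)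
  then have "n dvd j" by simp
  then have "n \<le> j" using j(2) by (rule dvd_imp_le)
  then show False using ij(3) B n8 by linarith
qed

lemma two_powers_distinct:
  fixes t1 t2 t3 :: int
  assumes "gcd (t1 - t2) (int n) = 1"
  shows "y [^] t1 \<noteq> y [^] (t2 :: int)" "x \<otimes> y [^] (t3 :: int) \<noteq> y [^] t1" "x \<otimes> y [^] t3 \<noteq> y [^] t2"
proof -
  show "y [^] t1 \<noteq> y [^] t2"
  proof
    assume "y [^] t1 = y [^] t2"
    then have "int n dvd t1 - t2" by (simp add: y_eq_iff)
    then have "int n dvd 1" using assms by (metis gcd_greatest dvd_refl)
    then show False using n8 by (auto dest: zdvd_imp_le)
  qed
  show "x \<otimes> y [^] t3 \<noteq> y [^] t1" "x \<otimes> y [^] t3 \<noteq> y [^] t2" by (metis N_x_pow not_N_pow)+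
qed

text \<open>As \<open>n\<close> is even, \<open>t\<close> is odd, so
  \<open>y [^] (t * half) = y [^] half\<close> and the square of \<open>x\<close> fits the new
  generator. This is for product-one free sequences, whose repeated term is at first only a power of
  a generator.\<close>

lemma gens_power:
  assumes t: "coprime t (int n)"
  shows "dicyclic_gens G n s x (y [^] t)" and "\<exists>w::int. y [^] (r::int) = (y [^] t) [^] w"
proof -
  obtain w l where w: "w * t + l * int n = 1"
    using bezout_int[of t "int n"] t by (auto simp: coprime_iff_gcd_eq_1)
  have pw: "y [^] r = (y [^] t) [^] (w * r)" for r :: int
  proof -
    have wt: "w * t = 1 - l * int n" using w by linarith
    have "r - t * (w * r) = r - (w * t) * r" by (simp add: algebra_simps)
    also have "\<dots> = int n * (l * r)" unfolding wt by (simp add: algebra_simps)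
    finally have "int n dvd r - t * (w * r)" by simp
    then show ?thesis by (simp add: int_pow_pow y_eq_iff)
  qed
  then show "\<exists>w::int. y [^] (r::int) = (y [^] t) [^] w" by blast
  have sub: "subgroup (generate G {x, y [^] t}) G" by (rule generate_is_subgroup) simp
  have in_gen: "x \<in> generate G {x, y [^] t}" "y [^] t \<in> generate G {x, y [^] t}" by (simp_all add: generate.incl)
  have "y = (y [^] t) [^] (w * 1)" using pw[of 1] by simp
  then have "y \<in> generate G {x, y [^] t}" using subgroup_int_pow_closed[OF sub in_gen(2), of "w * 1"] by simp
  then have "generate G {x, y} \<subseteq> generate G {x, y [^] t}" using in_gen(1) sub by (intro generate_subgroup_incl) auto
  moreover have "generate G {x, y} = carrier G" using gens by (simp add: dicyclic_gens_def)
  ultimately have gen: "generate G {x, y [^] t} = carrier G" using generate_incl[of "{x, y [^] t}"] by auto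
  have "odd t"
  proof
    assume "even t"
    then have "is_unit (2::int)" using t n_even by (metis coprime_common_divisor)
    then show False by simp
  qed
  then obtain r where r: "t = 2 * r + 1" by (rule oddE)
  have "t * half - half = (2 * half) * r" unfolding r by (simp add: algebra_simps)
  then have "y [^] (t * half) = y [^] half" unfolding two_half y_eq_iff by simp
  moreover have "(y [^] t) [^] (n div 2) = (y [^] t) [^] half" by (simp only: int_pow_int)
  moreover have "x [^] (2::nat) = x \<otimes> x" by (simp add: numeral_2_eq_2)
  ultimately have "x [^] (2::nat) = (y [^] t) [^] (n div 2)" using x_x by (simp add: int_pow_pow)
  moreover have "(y [^] t) [^] n = \<one>" by (simp add: int_pow_pow y_eq_one_iff flip: int_pow_int)
  moreover have "y [^] t \<otimes> x = x \<otimes> (y [^] t) [^] s" by (simp add: pow_y_x int_pow_pow mult.commute)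
  ultimately show "dicyclic_gens G n s x (y [^] t)" using gen by (simp add: dicyclic_gens_def)
qed

end

section \<open>Other generating pairs in the exceptional case\<close>

context exceptional
begin

text \<open>The square of \<open>b\<close> generates the even powers of \<open>y\<close>, and
  distinct nontrivial types commute up to \<open>y [^] half = b [^] half\<close>, so
  \<open>b\<close> can take the place of \<open>y\<close>. What remains is to find a partner
  \<open>a\<close> of another nontrivial type with
  \<open>a \<otimes> a = y [^] half\<close>.\<close>

lemma other_generators:
  assumes b: "b \<in> carrier G" "ty b \<noteq> (False, False)" and ord_b: "\<And>i. 0 < i \<Longrightarrow> i < n \<Longrightarrow> b [^] (i::nat) \<noteq> \<one>"
  obtains a where "dicyclic_gens G n s a b"
    "\<And>g. g \<in> carrier G \<Longrightarrow> ty g = (False, False) \<Longrightarrow> \<exists>i::int. g = b [^] (2 * i)"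
    "\<And>g. g \<in> carrier G \<Longrightarrow> ty g \<noteq> (False, False) \<Longrightarrow> ty g \<noteq> ty b \<Longrightarrow> \<exists>i::int. g = a \<otimes> b [^] i"
proof -
  have tyh: "ty (y [^] half) = (False, False)" using even_half by (simp add: ty_pow)
  obtain k where k: "b \<otimes> b = y [^] (2 * k :: int)" using square_even_power[OF b(1)] by blast
  have b2: "b [^] (2 * i :: int) = y [^] (2 * (k * i))" for i
  proof -
    have "b [^] (2::int) = b \<otimes> b" using int_pow_mult[OF b(1), of 1 1] b(1) by simp
    then have "(b [^] (2::int)) [^] i = y [^] (2 * k * i)" by (simp add: k int_pow_pow)
    then show ?thesis using b(1) by (simp add: int_pow_pow mult.assoc)
  qed
  \<comment> \<open>A common divisor \<open>d > 1\<close> of \<open>k\<close> and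
    \<open>half\<close> would make the power of \<open>b\<close> with exponent
    \<open>n div d\<close> trivial.\<close>
  have cop: "coprime k half"
  proof (rule ccontr)
    assume nc: "\<not> coprime k half"
    define d where "d = gcd k half"
    have "d \<noteq> 1" "0 < d" using nc half_ge by (auto simp: d_def coprime_iff_gcd_eq_1)
    then have d1: "2 \<le> d" by linarith
    have "d dvd k" "d dvd half" by (simp_all add: d_def)
    then obtain k' e where k': "k = d * k'" and e: "half = d * e" by blast
    have e0: "0 < e" using e d1 half_ge by (metis zero_less_mult_pos less_le_trans zero_less_numeral)
    have "2 * e \<le> d * e" using d1 e0 by (intro mult_right_mono) auto
    then have lt: "2 * e < int n" using e two_half half_ge by linarith
    have "k * e = half * k'" by (simp add: k' e)
    then have "2 * (k * e) = int n * k'" using two_half by (metis mult.assoc)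
    then have "b [^] (2 * e) = \<one>" unfolding b2 by (simp add: y_eq_one_iff)
    moreover have "b [^] (2 * e) = b [^] nat (2 * e)" using e0 by (simp flip: int_pow_int)
    moreover have "0 < nat (2 * e)" "nat (2 * e) < n" using e0 lt by linarith+
    ultimately show False using ord_b by metis
  qed
  then obtain w l where w: "w * k + l * half = 1" using bezout_int[of k half] by (auto simp: coprime_iff_gcd_eq_1)
  have triv: "\<exists>i::int. g = b [^] (2 * i)" if g: "g \<in> carrier G" "ty g = (False, False)" for g
  proof -
    obtain j where j: "g = y [^] (2 * j :: int)" using trivial_type[OF g] by blast
    have wk: "w * k = 1 - l * half" using w by linarith
    have "2 * j - 2 * (k * (w * j)) = 2 * j - 2 * ((w * k) * j)" by (simp add: algebra_simps)
    also have "\<dots> = (2 * half) * (l * j)" unfolding wk by (simp add: algebra_simps)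
    finally have "int n dvd 2 * j - 2 * (k * (w * j))" unfolding two_half by simp
    then have "g = b [^] (2 * (w * j))" unfolding b2 j by (simp only: y_eq_iff)
    then show ?thesis by blast
  qed
  have same: "\<exists>i::int. g = b [^] i" if g: "g \<in> carrier G" "ty g = ty b \<or> ty g = (False, False)" for g
  proof (cases "ty g = (False, False)")
    case True
    then show ?thesis using triv g by blast
  next
    case False
    define h where "h = g \<otimes> inv b"
    have h: "h \<in> carrier G" "g = h \<otimes> b" using g b(1) by (simp_all add: h_def m_assoc)
    have "ty h = (False, False)" using ty_mult[OF h(1) b(1)] g(2) False h(2) by (cases "ty h"; cases "ty b") auto
    then obtain i :: int where "h = b [^] (2 * i)" using triv h(1) by blast
    then have "g = b [^] (2 * i + 1)" using h(2) b(1) by (simp add: int_pow_mult)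
    then show ?thesis by blast
  qed
  have odd_k: "odd k"
  proof
    assume "even k"
    then have "is_unit (2::int)" using cop even_half by (metis coprime_common_divisor)
    then show False by simp
  qed
  then obtain r where r: "k = 2 * r + 1" by (rule oddE)
  obtain h where h: "half = 2 * h" using even_half by blast
  have bh: "b [^] half = y [^] half"
  proof -
    have "2 * (k * h) - half = (2 * half) * r" unfolding h r by (simp add: algebra_simps)
    then have "y [^] (2 * (k * h)) = y [^] half" unfolding two_half y_eq_iff by simp
    then show ?thesis using b2[of h] h by simp
  qed
  have bn: "b [^] int n = \<one>"
    using b2[of half] two_half by (simp add: y_eq_one_iff mult.left_commute)
  \<comment> \<open>Usually \<open>x\<close> will do. If \<open>b\<close> has the type of
    \<open>x\<close>, the candidate is \<open>y [^] h\<close> with \<open>half = 2 * h\<close>,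
    whose type is nontrivial only for odd \<open>h\<close>; comparing exponents in
    \<open>b \<otimes> b = y [^] (2 * k)\<close> modulo \<open>4\<close>, with \<open>k\<close> odd,
    shows that \<open>h\<close> is odd.\<close>
  have "\<exists>a\<in>carrier G. a \<otimes> a = y [^] half \<and> ty a \<noteq> (False, False) \<and> ty a \<noteq> ty b"
  proof (cases "ty b = (True, False)")
    case False
    have "x = x \<otimes> y [^] (0::int)" by simp
    then have "ty x = (True, False)" using ty_x_pow[of 0] by simp
    then show ?thesis using x_x False by (intro bexI[of _ x]) auto
  next
    case True
    then have "b = x \<otimes> y [^] ex b" "even (ex b)" using b(1) N_ex by (auto simp: ty_def)
    then obtain j where j: "b = x \<otimes> y [^] (2 * j :: int)" by (metis evenE)
    have "y [^] (half + s * (2 * j) + 2 * j) = y [^] (2 * k)" using k unfolding j xyxy .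
    then have "int n dvd half + s * (2 * j) + 2 * j - 2 * k" by (simp only: y_eq_iff)
    moreover have "4 dvd int n" using n4 by (metis int_dvd_int_iff of_nat_numeral)
    ultimately have "4 dvd half + s * (2 * j) + 2 * j - 2 * k" by (rule dvd_trans[rotated])
    moreover obtain s' where s': "s = 2 * s' + 1" using s_odd by (rule oddE)
    have "half + s * (2 * j) + 2 * j - 2 * k = 2 * (h - 1) + 4 * (s' * j + j - r)" unfolding s' h r by (simp add: algebra_simps)
    ultimately have "4 dvd 2 * (h - 1)" by (metis dvd_add_left_iff dvd_triv_left)
    then have "odd h" by presburger
    then show ?thesis using True h by (intro bexI[of _ "y [^] h"]) (auto simp: yy ty_pow)
  qed
  then obtain a where a: "a \<in> carrier G" "a \<otimes> a = y [^] half" "ty a \<noteq> (False, False)" "ty a \<noteq> ty b" by blast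
  have other: "\<exists>i::int. g = a \<otimes> b [^] i" if g: "g \<in> carrier G" "ty g \<noteq> (False, False)" "ty g \<noteq> ty b" for g
  proof -
    define h where "h = inv a \<otimes> g"
    have h: "h \<in> carrier G" "g = a \<otimes> h" using g a(1) by (simp_all add: h_def flip: m_assoc)
    have "ty h = ty b \<or> ty h = (False, False)"
      using ty_mult[OF a(1) h(1)] g(2,3) a(3,4) b(2) h(2) by (cases "ty h"; cases "ty b"; cases "ty a") auto
    then show ?thesis using same[OF h(1)] h(2) by blast
  qed
  have sub: "subgroup (generate G {a, b}) G" by (rule generate_is_subgroup) (use a b in auto)
  have ab: "a \<in> generate G {a, b}" "b \<in> generate G {a, b}" by (simp_all add: generate.incl)
  have "carrier G \<subseteq> generate G {a, b}"
  proof
    fix g assume g: "g \<in> carrier G"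
    have "(\<exists>i::int. g = b [^] i) \<or> (\<exists>i::int. g = a \<otimes> b [^] i)" using same[OF g] other[OF g] by blast
    then show "g \<in> generate G {a, b}"
      using subgroup_int_pow_closed[OF sub ab(2)] subgroup.m_closed[OF sub ab(1)] by blast
  qed
  then have gen: "generate G {a, b} = carrier G" using generate_incl[of "{a, b}"] a(1) b(1) by blast
  obtain k' where k': "s - 1 = half * k'" "odd k'" by (rule s_eq)
  obtain r' where r': "k' = 2 * r' + 1" using k'(2) by (rule oddE)
  have "b [^] (s - 1) = y [^] (half * k')" unfolding k'(1) using bh b(1) by (metis int_pow_pow y_closed)
  also have "\<dots> = y [^] half"
  proof -
    have "half * k' - half = (2 * half) * r'" unfolding r' by (simp add: algebra_simps)
    then show ?thesis unfolding two_half y_eq_iff by simp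
  qed
  finally have "b [^] s = b \<otimes> y [^] half" using int_pow_mult[OF b(1), of 1 "s - 1"] b(1) by simp
  moreover have "b \<otimes> a = (a \<otimes> b) \<otimes> y [^] half" by (rule commute_twist) (use a b in auto)
  ultimately have "b \<otimes> a = a \<otimes> b [^] s" using a(1) b(1) by (simp add: m_assoc)
  then have "dicyclic_gens G n s a b" unfolding dicyclic_gens_def
    using a(1,2) b(1) gen bh bn by (simp add: numeral_2_eq_2 int_pow_int)
  then show ?thesis using that triv other by blast
qed

end

context exceptional_sequence
begin

lemma exceptional_form:
  "\<exists>\<alpha> \<beta> t1 t2 t3. dicyclic_gens G n s \<alpha> \<beta> \<and> gcd (t1 - t2) (int n) = 1 \<and>
    S = replicate_mset (n - 1) (\<beta> [^] (t1::int)) + replicate_mset (n - 1) (\<beta> [^] (t2::int)) + {# \<alpha> \<otimes> (\<beta> [^] (t3::int)) #}"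
proof -
  obtain c a b where st: "S = replicate_mset (n - 1) c + replicate_mset (n - 1) a + {#b#}"
    "c \<in> carrier G" "a \<in> carrier G" "b \<in> carrier G" "ty c = (False, False)" "ty a \<noteq> (False, False)"
    "ty b \<noteq> (False, False)" "ty b \<noteq> ty a" by (rule two_value_structure)
  \<comment> \<open>As \<open>c\<close> is central, \<open>\<beta> [^] i = \<one>\<close> would make
    \<open>i\<close> copies of \<open>a\<close> and \<open>n - i\<close> copies of \<open>c\<close>
    a product-one sequence; so no such \<open>i\<close> lies strictly between \<open>0\<close> and
    \<open>n\<close>. Over \<open>\<beta>\<close> the exponents of \<open>c\<close> and
    \<open>a\<close> are consecutive, whence the gcd condition.\<close>
  define \<beta> where "\<beta> = a \<otimes> inv c"
  have \<beta>: "\<beta> \<in> carrier G" "a = \<beta> \<otimes> c" using st by (simp_all add: \<beta>_def m_assoc)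
  have ty\<beta>: "ty \<beta> = ty a" using ty_mult[OF \<beta>(1) st(2)] \<beta>(2) st(5) by (cases "ty \<beta>") auto
  obtain j where j: "c = y [^] (2 * j :: int)" using trivial_type[OF st(2,5)] by blast
  have cn: "c [^] n = \<one>" unfolding j by (simp add: int_pow_pow y_eq_one_iff flip: int_pow_int)
  have pow: "list_prod G (replicate i g) = g [^] i" if "g \<in> carrier G" for i g
    using that by (induction i) (simp_all flip: nat_pow_Suc2)
  have "\<beta> [^] i \<noteq> \<one>" if i: "0 < i" "i < n" for i
  proof
    assume one: "\<beta> [^] i = \<one>"
    define us where "us = replicate i a @ replicate (n - i) c"
    have "list_prod G us = a [^] i \<otimes> c [^] (n - i)" unfolding us_def using st(2,3)
      by (subst list_prod_append) (auto simp: pow)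
    also have "a [^] i = \<beta> [^] i \<otimes> c [^] i" unfolding \<beta>(2)
      using commute_trivial[OF st(2) \<beta>(1) st(5)] \<beta>(1) st(2) by (simp add: pow_mult_distrib)
    also have "\<dots> \<otimes> c [^] (n - i) = \<one>" using one cn i st(2) by (simp add: nat_pow_mult)
    finally have "0 \<in> exps (mset us)" by (intro exps_listI[of us]) simp_all
    moreover have "mset us \<subseteq># S"
    proof -
      have "replicate_mset i a \<subseteq># replicate_mset (n - 1) a" "replicate_mset (n - i) c \<subseteq># replicate_mset (n - 1) c"
        using i by (simp_all add: count_le_replicate_mset_subset_eq[symmetric])
      then have "replicate_mset (n - i) c + replicate_mset i a + {#} \<subseteq># S"
        unfolding st(1) by (intro subset_mset.add_mono) auto
      then show ?thesis by (simp add: us_def add.commute)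
    qed
    moreover have "size (mset us) = n" using i by (simp add: us_def)
    ultimately show False using no_product_one[of "mset us" 0] by simp
  qed
  then obtain \<alpha> where \<alpha>: "dicyclic_gens G n s \<alpha> \<beta>"
    "\<And>g. g \<in> carrier G \<Longrightarrow> ty g = (False, False) \<Longrightarrow> \<exists>i::int. g = \<beta> [^] (2 * i)"
    "\<And>g. g \<in> carrier G \<Longrightarrow> ty g \<noteq> (False, False) \<Longrightarrow> ty g \<noteq> ty \<beta> \<Longrightarrow> \<exists>i::int. g = \<alpha> \<otimes> \<beta> [^] i"
    using other_generators[OF \<beta>(1)] ty\<beta> st(6) by metis
  obtain i :: int where i: "c = \<beta> [^] (2 * i)" using \<alpha>(2) st(2,5) by blast
  have ai: "a = \<beta> [^] (1 + 2 * i)" using \<beta> i by (simp add: int_pow_mult)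
  obtain t3 :: int where "b = \<alpha> \<otimes> \<beta> [^] t3" using \<alpha>(3)[OF st(4,7)] st(8) ty\<beta> by auto
  then have "S = replicate_mset (n - 1) (\<beta> [^] (2 * i)) + replicate_mset (n - 1) (\<beta> [^] (1 + 2 * i)) + {#\<alpha> \<otimes> \<beta> [^] t3#}"
    using st(1) i ai by metis
  then show ?thesis using \<alpha>(1)
    by (intro exI[of _ \<alpha>] exI[of _ \<beta>] exI[of _ "2 * i"] exI[of _ "1 + 2 * i"] exI[of _ t3]) simp
qed

end

context dicyclic_like
begin

definition extremal :: "'a multiset \<Rightarrow> bool" where
  "extremal S \<longleftrightarrow> (\<exists>\<alpha> \<beta> t1 t2 t3. dicyclic_gens G n s \<alpha> \<beta> \<and> gcd (t1 - t2) (int n) = 1 \<and>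
    S = replicate_mset (n - 1) (\<beta> [^] (t1::int)) + replicate_mset (n - 1) (\<beta> [^] (t2::int)) + {# \<alpha> \<otimes> (\<beta> [^] (t3::int)) #})"

lemma gens_dicyclic_like: "dicyclic_gens G n s a b \<Longrightarrow> dicyclic_like G n s a b"
  by unfold_locales (use fin ord n8 n4 s_sq in auto)

text \<open>Outside the exceptional case at most one term is outside \<open>H\<close>, and at least
  one, since \<open>2 * n - 1\<close> terms of \<open>H\<close> fall to Erdos--Ginzburg--Ziv; the
  inverse theorem describes the other \<open>2 * n - 2\<close>, with \<open>x\<close> and
  \<open>y\<close> themselves as generators.\<close>

lemma no_product_one_extremal:
  assumes s_ne: "\<not> int n dvd s - 1" and S: "set_mset S \<subseteq> carrier G" "size S = 2 * n - 1"
    and none: "\<not> has_m_product_one_subseq G n S"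
  shows "extremal S"
proof (cases "half dvd s - 1")
  case True
  interpret exceptional_sequence G n s x y S by unfold_locales (use True s_ne S none in auto)
  show ?thesis unfolding extremal_def by (rule exceptional_form)
next
  case ne: False
  then have k: "size (filter_mset N S) \<le> 1" using two_outside_product_one[OF ne S] none by linarith
  define R where "R = filter_mset (\<lambda>g. \<not> N g) S"
  have RH: "g \<in> carrier G \<and> \<not> N g" if "g \<in># R" for g using that S(1) by (auto simp: R_def)
  have RS: "R \<subseteq># S" by (simp add: R_def)
  have S_eq: "S = filter_mset N S + R" unfolding R_def by (rule multiset_partition)
  have szR: "size S = size (filter_mset N S) + size R" using S_eq by (metis size_union)
  have free: "\<not> zero_sum n ex T" if T: "T \<subseteq># R" "size T = n" for T
  proof
    assume "zero_sum n ex T"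
    moreover have "(\<Sum>g\<in>#T. ex g) \<in> exps T" by (rule exps_sum) (use RH set_mset_mono[OF T(1)] in auto)
    ultimately have "product_one G T" using product_oneI by (auto simp: zero_sum_def)
    then show False using none T RS subset_mset.order_trans unfolding has_m_product_one_subseq_def by blast
  qed
  have "size (filter_mset N S) \<noteq> 0"
  proof
    assume "size (filter_mset N S) = 0"
    then have "2 * n - 1 \<le> size R" using szR S(2) by simp
    then obtain T where "T \<subseteq># R" "size T = n" "zero_sum n ex T" using erdos_ginzburg_ziv[of n R ex] n8 by auto
    then show False using free by blast
  qed
  then have "size (filter_mset N S) = 1" using k by linarith
  then obtain b where b: "filter_mset N S = {#b#}" using size_1_singleton_mset by blast
  have "b \<in># filter_mset N S" by (simp add: b)
  then have bN: "b \<in> carrier G" "N b" using S(1) by auto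
  have "size R = 2 * n - 2" using szR S(2) b by simp
  then obtain u v where uv: "coprime (u - v) (int n)"
    "image_mset (\<lambda>g. ex g mod int n) R = replicate_mset (n - 1) (u mod int n) + replicate_mset (n - 1) (v mod int n)"
    using erdos_ginzburg_ziv_inverse[of n R ex] free n8 by auto
  have "R = image_mset (\<lambda>g. y [^] (ex g mod int n)) R"
    by (rule sym, rule multiset.map_ident_strong) (use RH H_ex in \<open>auto simp: pow_mod\<close>)
  also have "\<dots> = image_mset (\<lambda>i. y [^] i) (image_mset (\<lambda>g. ex g mod int n) R)"
    by (simp add: image_mset.compositionality comp_def)
  also have "\<dots> = replicate_mset (n - 1) (y [^] u) + replicate_mset (n - 1) (y [^] v)"
    unfolding uv(2) by (simp add: image_replicate_mset pow_mod)
  finally have "S = replicate_mset (n - 1) (y [^] u) + replicate_mset (n - 1) (y [^] v) + {#x \<otimes> y [^] ex b#}"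
    using S_eq b N_ex[OF bN] by (metis add.commute)
  moreover have "gcd (u - v) (int n) = 1" using uv(1) by (simp add: coprime_iff_gcd_eq_1)
  ultimately show ?thesis unfolding extremal_def using gens
    by (intro exI[of _ x] exI[of _ y] exI[of _ u] exI[of _ v] exI[of _ "ex b"] conjI)
qed

end

context dicyclic_like
begin

lemma extremalE:
  assumes "extremal S"
  obtains \<alpha> \<beta> and t1 t2 t3 :: int where "dicyclic_gens G n s \<alpha> \<beta>" "gcd (t1 - t2) (int n) = 1"
    "S = replicate_mset (n - 1) (\<beta> [^] t1) + replicate_mset (n - 1) (\<beta> [^] t2) + {#\<alpha> \<otimes> \<beta> [^] t3#}"
  using assms unfolding extremal_def by (elim exE conjE) (rule that)

lemma extremal_shape:
  assumes "extremal S"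
  obtains b1 b2 c where "S = replicate_mset (n - 1) b1 + replicate_mset (n - 1) b2 + {#c#}"
    "b1 \<noteq> b2" "c \<noteq> b1" "c \<noteq> b2"
proof -
  obtain \<alpha> \<beta> and t1 t2 t3 :: int where e: "dicyclic_gens G n s \<alpha> \<beta>" "gcd (t1 - t2) (int n) = 1"
    "S = replicate_mset (n - 1) (\<beta> [^] t1) + replicate_mset (n - 1) (\<beta> [^] t2) + {#\<alpha> \<otimes> \<beta> [^] t3#}"
    using assms by (rule extremalE)
  interpret D: dicyclic_like G n s \<alpha> \<beta> by (rule gens_dicyclic_like[OF e(1)])
  show ?thesis by (rule that[OF e(3)]) (rule D.two_powers_distinct[OF e(2)])+
qed

text \<open>An extremal sequence has two repeated values and one further term. Here
  \<open>b1\<close> and \<open>b2\<close> must be the repeated values, and \<open>c\<close>,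
  \<open>d\<close> are one term too many.\<close>

lemma not_extremalI:
  assumes ne: "b1 \<noteq> b2" "b1 \<noteq> c" "b2 \<noteq> c"
    and cnt: "2 \<le> count S b1" "2 \<le> count S b2" "d = c \<longrightarrow> 2 \<le> count S c" "c \<in># S" "d \<in># S" "d \<noteq> b1" "d \<noteq> b2"
  shows "\<not> extremal S"
proof
  assume "extremal S"
  then obtain a1 a2 e where S: "S = replicate_mset (n - 1) a1 + replicate_mset (n - 1) a2 + {#e#}"
    "a1 \<noteq> a2" "e \<noteq> a1" "e \<noteq> a2" by (rule extremal_shape)
  have mult: "g = a1 \<or> g = a2" if "2 \<le> count S g" for g
    using that S by (auto split: if_splits)
  have mem: "g = a1 \<or> g = a2 \<or> g = e" if "g \<in># S" for g
    using that S(1) by (auto simp: in_replicate_mset split: if_splits)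
  have b12: "{b1, b2} = {a1, a2}" using mult[OF cnt(1)] mult[OF cnt(2)] ne(1) by auto
  then have "a1 = b1 \<or> a1 = b2" "a2 = b1 \<or> a2 = b2" by blast+
  then have "c \<noteq> a1" "c \<noteq> a2" "d \<noteq> a1" "d \<noteq> a2" using ne(2,3) cnt(6,7) by metis+
  then have "c = e" "d = e" using mem[OF cnt(4)] mem[OF cnt(5)] by simp_all
  then have "2 \<le> count S e" using cnt(3) by simp
  then show False using mult S(3,4) by blast
qed

end

section \<open>Sequences of length \<open>3 * n - 1\<close> and product-one free sequences\<close>

locale nontrivial_dicyclic_like = dicyclic_like +
  assumes s_ne: "\<not> int n dvd s - 1"
begin

text \<open>In a counterexample of \<open>2 * n\<close> terms, deleting any term leaves an extremal
  sequence. So \<open>b1\<close> has multiplicity \<open>n - 1\<close>, as no term reaches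
  \<open>n\<close>; deleting one copy leaves \<open>n - 2\<close>, but extremal sequences have only
  multiplicities \<open>0\<close>, \<open>1\<close> and \<open>n - 1\<close>.\<close>

lemma has_subseq_of_size_2n:
  assumes "set_mset Q \<subseteq> carrier G" "2 * n \<le> size Q"
  shows "has_m_product_one_subseq G n Q"
proof (rule ccontr)
  assume none: "\<not> ?thesis"
  obtain P where P: "P \<subseteq># Q" "size P = 2 * n" using assms(2) by (rule obtain_submset_of_size)
  have cP: "set_mset P \<subseteq> carrier G" using set_mset_mono[OF P(1)] assms(1) by blast
  have noneP: "\<not> has_m_product_one_subseq G n R" if R: "R \<subseteq># P" for R
  proof
    assume "has_m_product_one_subseq G n R"
    then obtain T where T: "T \<subseteq># R" "size T = n \<and> product_one G T" unfolding has_m_product_one_subseq_def by blast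
    have "T \<subseteq># Q" using subset_mset.order_trans[OF T(1) R] P(1) by (rule subset_mset.order_trans)
    then show False using none T(2) unfolding has_m_product_one_subseq_def by blast
  qed
  have ext: "extremal (P - {#g#})" if g: "g \<in># P" for g
  proof (rule no_product_one_extremal[OF s_ne])
    show "set_mset (P - {#g#}) \<subseteq> carrier G" using cP by (meson in_diffD subset_iff)
    show "size (P - {#g#}) = 2 * n - 1" using P(2) g by (simp add: size_Diff_singleton)
    show "\<not> has_m_product_one_subseq G n (P - {#g#})" by (rule noneP) simp
  qed
  have "P \<noteq> {#}" using P(2) n8 by auto
  then obtain q where q: "q \<in># P" by blast
  obtain b1 b2 c where sh: "P - {#q#} = replicate_mset (n - 1) b1 + replicate_mset (n - 1) b2 + {#c#}"
    "b1 \<noteq> b2" "c \<noteq> b1" "c \<noteq> b2" using extremal_shape[OF ext[OF q]] by blast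
  have P_eq: "P = replicate_mset (n - 1) b1 + replicate_mset (n - 1) b2 + {#c, q#}" using q sh(1)
    by (metis add_mset_add_single insert_DiffM union_mset_add_mset_right add_mset_commute)
  have few: "count P g \<le> n - 1" if g: "g \<in> carrier G" for g
  proof (rule ccontr)
    assume "\<not> ?thesis"
    then have "replicate_mset n g \<subseteq># P" by (simp add: count_le_replicate_mset_subset_eq[symmetric])
    moreover have "product_one G (replicate_mset n g)" by (rule product_one_replicate[OF g])
    ultimately have "has_m_product_one_subseq G n P" unfolding has_m_product_one_subseq_def
      by (intro exI[of _ "replicate_mset n g"]) simp
    then show False using noneP[of P] by simp
  qed
  have "b1 \<in># P" "b2 \<in># P" using P_eq n8 by (auto simp: in_replicate_mset)
  then have b12: "b1 \<in># P" "b1 \<in> carrier G" "b2 \<in> carrier G" using cP by auto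
  have "q \<noteq> b1" "q \<noteq> b2" using few[OF b12(2)] few[OF b12(3)] P_eq sh(2-4) n8 by auto
  then have "count (P - {#b1#}) b1 = n - 2" using P_eq sh(2,3) by simp
  moreover obtain a1 a2 e where "P - {#b1#} = replicate_mset (n - 1) a1 + replicate_mset (n - 1) a2 + {#e#}"
    "a1 \<noteq> a2" "e \<noteq> a1" "e \<noteq> a2" using extremal_shape[OF ext[OF b12(1)]] by blast
  then have "count (P - {#b1#}) b1 \<in> {0, 1, n - 1}" by auto
  ultimately show False using n8 by auto
qed

text \<open>Whichever product-one \<open>T\<close> of length \<open>n\<close> is removed, the rest
  must be extremal, since two disjoint ones would combine to length \<open>2 * n\<close>. Comparing
  different choices forces \<open>T\<close> to be \<open>n\<close> copies of a repeated term of the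
  rest.\<close>

lemma no_2n_subseq_form:
  assumes S: "set_mset S \<subseteq> carrier G" "size S = 3 * n - 1" and none: "\<not> has_m_product_one_subseq G (2 * n) S"
  shows "\<exists>\<alpha> \<beta> t1 t2 t3. dicyclic_gens G n s \<alpha> \<beta> \<and> gcd (t1 - t2) (int n) = 1 \<and>
    S = replicate_mset (2 * n - 1) (\<beta> [^] (t1::int)) + replicate_mset (n - 1) (\<beta> [^] (t2::int)) + {#\<alpha> \<otimes> (\<beta> [^] (t3::int))#}"
proof -
  have cl: "set_mset R \<subseteq> carrier G" if "R \<subseteq># S" for R using set_mset_mono[OF that] S(1) by blast
  have join: False if AB: "A + B \<subseteq># S" "size A = n" "size B = n" "product_one G A" "product_one G B" for A B
  proof -
    have "A \<subseteq># S" "B \<subseteq># S" using AB(1) by (auto intro: subset_mset.order_trans[rotated])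
    then have "product_one G (A + B)" using product_one_add cl AB(4,5) by blast
    moreover have "size (A + B) = 2 * n" using AB(2,3) by simp
    ultimately show False using none AB(1) unfolding has_m_product_one_subseq_def by blast
  qed
  have rest: "extremal (S - T)" if T: "T \<subseteq># S" "size T = n" "product_one G T" for T
  proof (rule no_product_one_extremal[OF s_ne])
    show "set_mset (S - T) \<subseteq> carrier G" by (rule cl) simp
    show "size (S - T) = 2 * n - 1" using T S(2) by (simp add: size_Diff_submset)
    show "\<not> has_m_product_one_subseq G n (S - T)"
    proof
      assume "has_m_product_one_subseq G n (S - T)"
      then obtain B where B: "B \<subseteq># S - T" "size B = n" "product_one G B" unfolding has_m_product_one_subseq_def by blast
      have "T + B \<subseteq># T + (S - T)" using B(1) by (rule subset_mset.add_left_mono)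
      then have "T + B \<subseteq># S" using T(1) by (simp add: subset_mset.add_diff_inverse)
      then show False using join T B by blast
    qed
  qed
  have "has_m_product_one_subseq G n S" using has_subseq_of_size_2n S n8 by simp
  then obtain T where T: "T \<subseteq># S" "size T = n" "product_one G T" unfolding has_m_product_one_subseq_def by blast
  obtain \<alpha> \<beta> and t1 t2 t3 :: int where e: "dicyclic_gens G n s \<alpha> \<beta>" "gcd (t1 - t2) (int n) = 1"
    "S - T = replicate_mset (n - 1) (\<beta> [^] t1) + replicate_mset (n - 1) (\<beta> [^] t2) + {#\<alpha> \<otimes> \<beta> [^] t3#}"
    using rest[OF T] by (rule extremalE)
  interpret D: dicyclic_like G n s \<alpha> \<beta> by (rule gens_dicyclic_like[OF e(1)])
  define b1 where "b1 = \<beta> [^] t1"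
  define b2 where "b2 = \<beta> [^] t2"
  define c where "c = \<alpha> \<otimes> \<beta> [^] t3"
  have dist: "b1 \<noteq> b2" "b1 \<noteq> c" "b2 \<noteq> c" using D.two_powers_distinct[OF e(2)] unfolding b1_def b2_def c_def by metis+
  have bc: "b1 \<in> carrier G" "b2 \<in> carrier G" by (simp_all add: b1_def b2_def)
  have ST: "S - T = replicate_mset (n - 1) b1 + replicate_mset (n - 1) b2 + {#c#}"
    using e(3) by (simp add: b1_def b2_def c_def)
  have S_eq: "S = T + (replicate_mset (n - 1) b1 + replicate_mset (n - 1) b2 + {#c#})"
    using T(1) ST by (metis subset_mset.add_diff_inverse)
  have only: "w = b1 \<or> w = b2" if w: "w \<in># T" for w
  proof (rule ccontr)
    assume wn: "\<not> ?thesis"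
    \<comment> \<open>Six terms that rule out extremality are set aside. As
      \<open>3 * n - 7 \<ge> 2 * n\<close>, some product-one \<open>U\<close> of length
      \<open>n\<close> avoids them, and they survive in \<open>S - U\<close>.\<close>
    define P where "P = {#w#} + ({#b1, b1#} + {#b2, b2#} + {#c#})"
    have "{#b1, b1#} \<subseteq># replicate_mset (n - 1) b1" "{#b2, b2#} \<subseteq># replicate_mset (n - 1) b2"
      using n8 by (auto intro!: mset_subset_eqI)
    then have PS: "P \<subseteq># S" unfolding P_def S_eq using w by (intro subset_mset.add_mono) auto
    have "2 * n \<le> size (S - P)" using S(2) PS n8 by (simp add: size_Diff_submset P_def)
    then have "has_m_product_one_subseq G n (S - P)" using has_subseq_of_size_2n cl[of "S - P"] by simp
    then obtain U where U: "U \<subseteq># S - P" "size U = n" "product_one G U" unfolding has_m_product_one_subseq_def by blast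
    have US: "U \<subseteq># S" using U(1) by (rule subset_mset.order_trans) simp
    have "U + P \<subseteq># S" using U(1) PS by (simp add: subset_mset.le_diff_conv2)
    then have PU: "P \<subseteq># S - U" using US by (simp add: subset_mset.le_diff_conv2 add.commute)
    have ge: "count P g \<le> count (S - U) g" for g using PU by (rule mset_subset_eq_count)
    have "2 \<le> count P b1" "2 \<le> count P b2" "w = c \<longrightarrow> 2 \<le> count P c" by (auto simp: P_def)
    moreover have "c \<in># S - U" "w \<in># S - U" using mset_subset_eqD[OF PU] by (auto simp: P_def)
    ultimately have "\<not> extremal (S - U)"
      using ge wn by (intro not_extremalI[OF dist, of "S - U" w]) (auto intro: le_trans)
    then show False using rest[OF US U(2,3)] by blast
  qed
  have "T = replicate_mset (count T b1) b1 + replicate_mset (count T b2) b2"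
  proof (rule multiset_eqI)
    fix g show "count T g = count (replicate_mset (count T b1) b1 + replicate_mset (count T b2) b2) g"
      using only[of g] dist(1) by (auto intro: count_inI)
  qed
  then obtain i j where ij: "T = replicate_mset i b1 + replicate_mset j b2" by blast
  have sum: "i + j = n" using T(2) ij by simp
  \<comment> \<open>If both values occurred in \<open>T\<close>, each would have multiplicity at
    least \<open>n\<close> in \<open>S\<close>, and \<open>n\<close> copies of both form a
    product-one sequence.\<close>
  have "i = 0 \<or> j = 0"
  proof (rule ccontr)
    assume "\<not> ?thesis"
    then have "1 \<le> i" "1 \<le> j" by auto
    have S_eq': "S = (replicate_mset i b1 + replicate_mset (n - 1) b1) + (replicate_mset j b2 + replicate_mset (n - 1) b2) + {#c#}"
      unfolding S_eq ij by (simp add: add_ac)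
    have "replicate_mset n b1 \<subseteq># replicate_mset i b1 + replicate_mset (n - 1) b1"
      "replicate_mset n b2 \<subseteq># replicate_mset j b2 + replicate_mset (n - 1) b2"
      using \<open>1 \<le> i\<close> \<open>1 \<le> j\<close> by (auto intro!: mset_subset_eqI)
    then have "replicate_mset n b1 + replicate_mset n b2 + {#} \<subseteq># S" unfolding S_eq' by (intro subset_mset.add_mono) auto
    then have "replicate_mset n b1 + replicate_mset n b2 \<subseteq># S" by simp
    then show False by (rule join) (simp_all add: product_one_replicate bc)
  qed
  then show ?thesis
  proof
    assume "i = 0"
    then have "S = replicate_mset (2 * n - 1) b2 + replicate_mset (n - 1) b1 + {#c#}"
      unfolding S_eq ij using sum n8 by (intro multiset_eqI) auto
    moreover have "gcd (t2 - t1) (int n) = 1" using e(2) by (metis gcd_neg1_int minus_diff_eq)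
    ultimately show ?thesis using e(1) unfolding b1_def b2_def c_def by (intro exI conjI)
  next
    assume "j = 0"
    then have "S = replicate_mset (2 * n - 1) b1 + replicate_mset (n - 1) b2 + {#c#}"
      unfolding S_eq ij using sum n8 by (intro multiset_eqI) auto
    then show ?thesis using e(1,2) unfolding b1_def b2_def c_def by (intro exI conjI)
  qed
qed

lemma list_prod_remove_one:
  "set us \<subseteq> carrier G \<Longrightarrow> list_prod G (filter (\<lambda>g. g \<noteq> \<one>) us) = list_prod G us"
  by (induction us) (auto simp: list_prod_closed)

text \<open>Padding with \<open>n - 1\<close> copies of the identity turns product-one free sequences into sequences
  without product-one subsequence of length \<open>n\<close>.\<close>

lemma product_one_free_form:
  assumes S: "set_mset S \<subseteq> carrier G" "size S = n" and free: "product_one_free G S"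
  shows "\<exists>\<alpha> \<beta> t. dicyclic_gens G n s \<alpha> \<beta> \<and> S = replicate_mset (n - 1) \<beta> + {#\<alpha> \<otimes> (\<beta> [^] (t::int))#}"
proof -
  define P where "P = S + replicate_mset (n - 1) \<one>"
  have one_S: "\<one> \<notin># S"
  proof
    assume "\<one> \<in># S"
    then have "{#\<one>#} \<subseteq># S" by simp
    moreover have "{#\<one>#} \<subseteq># S \<and> {#\<one>#} \<noteq> {#} \<longrightarrow> \<not> product_one G {#\<one>#}"
      using free unfolding product_one_free_def by (rule spec)
    moreover have "product_one G {#\<one>#}" unfolding product_one_def by (intro exI[of _ "[\<one>]"]) simp
    ultimately show False by simp
  qed
  have cP: "set_mset P \<subseteq> carrier G" using S(1) by (auto simp: P_def in_replicate_mset split: if_splits)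
  have "\<not> has_m_product_one_subseq G n P"
  proof
    assume "has_m_product_one_subseq G n P"
    then obtain T where T: "T \<subseteq># P" "size T = n" "product_one G T" unfolding has_m_product_one_subseq_def by blast
    obtain us where us: "mset us = T" "list_prod G us = \<one>" using T(3) by (auto simp: product_one_def)
    define U where "U = filter_mset (\<lambda>g. g \<noteq> \<one>) T"
    have "list_prod G (filter (\<lambda>g. g \<noteq> \<one>) us) = \<one>"
      using list_prod_remove_one[of us] us set_mset_mono[OF T(1)] cP by auto
    then have "product_one G U" unfolding product_one_def U_def using us(1) by (metis mset_filter)
    moreover have "U \<subseteq># S"
    proof (rule mset_subset_eqI)
      fix g show "count U g \<le> count S g"
        using mset_subset_eq_count[OF T(1), of g] by (cases "g = \<one>") (simp_all add: U_def P_def)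
    qed
    \<comment> \<open>\<open>T\<close> has \<open>n\<close> terms, but only \<open>n - 1\<close>
      identities are available.\<close>
    moreover have "U \<noteq> {#}"
    proof
      assume "U = {#}"
      then have "set_mset T \<subseteq> {\<one>}" by (auto simp: U_def filter_mset_eq_conv)
      then have "T = replicate_mset (size T) \<one>" by (rule set_mset_subset_singletonD)
      then have "count T \<one> = n" using T(2) by (metis count_replicate_mset)
      moreover have "count T \<one> \<le> count P \<one>" using T(1) by (rule mset_subset_eq_count)
      moreover have "count P \<one> = n - 1" using one_S by (simp add: P_def not_in_iff)
      ultimately show False using n8 by linarith
    qed
    moreover have "U \<subseteq># S \<and> U \<noteq> {#} \<longrightarrow> \<not> product_one G U" using free unfolding product_one_free_def by (rule spec)
    ultimately show False by simp
  qed
  moreover have "size P = 2 * n - 1" using S(2) n8 by (simp add: P_def)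
  ultimately have "extremal P" using no_product_one_extremal[OF s_ne cP] by blast
  then obtain \<alpha> \<beta> and t1 t2 t3 :: int where e: "dicyclic_gens G n s \<alpha> \<beta>" "gcd (t1 - t2) (int n) = 1"
    "P = replicate_mset (n - 1) (\<beta> [^] t1) + replicate_mset (n - 1) (\<beta> [^] t2) + {#\<alpha> \<otimes> \<beta> [^] t3#}"
    by (rule extremalE)
  interpret D: dicyclic_like G n s \<alpha> \<beta> by (rule gens_dicyclic_like[OF e(1)])
  \<comment> \<open>One of the two powers is the padding \<open>\<one>\<close>. The exponent
    \<open>b\<close> of the other is then prime to \<open>n\<close>, so \<open>\<beta> [^] b\<close>
    itself serves as the generator required.\<close>
  have main: ?thesis if one: "\<beta> [^] a = \<one>" and cop: "gcd (a - b) (int n) = 1"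
    and SP: "S + replicate_mset (n - 1) \<one> = replicate_mset (n - 1) \<one> + replicate_mset (n - 1) (\<beta> [^] b) + {#\<alpha> \<otimes> \<beta> [^] t3#}"
    for a b :: int
  proof -
    have na: "int n dvd a" using one by (simp add: D.y_eq_one_iff)
    have "coprime b (int n)"
    proof (rule coprimeI)
      fix d assume d: "d dvd b" "d dvd int n"
      then have "d dvd a - b" using na by (meson dvd_diff dvd_trans)
      then have "d dvd gcd (a - b) (int n)" using d(2) by simp
      then show "is_unit d" using cop by simp
    qed
    note gp = D.gens_power[OF this]
    obtain w :: int where "\<beta> [^] t3 = (\<beta> [^] b) [^] w" using gp(2) by blast
    moreover have "replicate_mset (n - 1) \<one> + S = replicate_mset (n - 1) \<one> + (replicate_mset (n - 1) (\<beta> [^] b) + {#\<alpha> \<otimes> \<beta> [^] t3#})"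
      using SP by (simp only: add_ac)
    then have "S = replicate_mset (n - 1) (\<beta> [^] b) + {#\<alpha> \<otimes> \<beta> [^] t3#}" by (simp only: add_left_cancel)
    ultimately have "S = replicate_mset (n - 1) (\<beta> [^] b) + {#\<alpha> \<otimes> (\<beta> [^] b) [^] w#}" by simp
    with gp(1) show ?thesis by (intro exI conjI)
  qed
  have "\<one> \<in># P" using n8 by (simp add: P_def in_replicate_mset)
  moreover have "\<one> \<noteq> \<alpha> \<otimes> \<beta> [^] t3" using D.N_x_pow[of t3] D.not_N_pow[of 0] by fastforce
  ultimately have "\<beta> [^] t1 = \<one> \<or> \<beta> [^] t2 = \<one>" unfolding e(3) by (auto simp: in_replicate_mset split: if_splits)
  then show ?thesis
  proof
    assume one: "\<beta> [^] t1 = \<one>"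
    show ?thesis by (rule main[OF one e(2)]) (use e(3) one in \<open>simp add: P_def\<close>)
  next
    assume one: "\<beta> [^] t2 = \<one>"
    have "gcd (t2 - t1) (int n) = 1" using e(2) by (metis gcd_neg1_int minus_diff_eq)
    then show ?thesis by (rule main[OF one]) (use e(3) one in \<open>simp add: P_def add.commute\<close>)
  qed
qed

end

theorem theorem1p2:
  fixes G (structure)
    and n :: nat and s :: int and x y :: 'a and S :: "'a multiset"
  assumes grp: "group G"
    and n8: "n \<ge> 8" and n4: "4 dvd n"
    and s_sq: "s^2 mod int n = 1 mod int n"
    and s_ne1: "s mod int n \<noteq> 1 mod int n" and s_nem1: "s mod int n \<noteq> (-1) mod int n"
    and pres: "dicyclic_gens G n s x y"
    and fin: "finite (carrier G)" and ord: "card (carrier G) = 2 * n"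
    and seq: "set_mset S \<subseteq> carrier G"
  shows
    "(size S = 2 * n - 1 \<longrightarrow>
       (\<not> has_m_product_one_subseq G n S \<longleftrightarrow>
        (\<exists>\<alpha> \<beta> t1 t2 t3. dicyclic_gens G n s \<alpha> \<beta> \<and> gcd (t1 - t2) (int n) = 1 \<and>
           S = replicate_mset (n - 1) (\<beta> [^] (t1::int)) + replicate_mset (n - 1) (\<beta> [^] (t2::int))
               + {# \<alpha> \<otimes> (\<beta> [^] (t3::int)) #}))) \<and>
     (size S = 3 * n - 1 \<longrightarrow>
       (\<not> has_m_product_one_subseq G (2 * n) S \<longleftrightarrow>
        (\<exists>\<alpha> \<beta> t1 t2 t3. dicyclic_gens G n s \<alpha> \<beta> \<and> gcd (t1 - t2) (int n) = 1 \<and>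
           S = replicate_mset (2 * n - 1) (\<beta> [^] (t1::int)) + replicate_mset (n - 1) (\<beta> [^] (t2::int))
               + {# \<alpha> \<otimes> (\<beta> [^] (t3::int)) #}))) \<and>
     (size S = n \<longrightarrow>
       (product_one_free G S \<longleftrightarrow>
        (\<exists>\<alpha> \<beta> t. dicyclic_gens G n s \<alpha> \<beta> \<and>
           S = replicate_mset (n - 1) \<beta> + {# \<alpha> \<otimes> (\<beta> [^] (t::int)) #})))"
proof -
  interpret nontrivial_dicyclic_like G n s x y
    by (intro nontrivial_dicyclic_like.intro dicyclic_like.intro dicyclic_like_axioms.intro
        nontrivial_dicyclic_like_axioms.intro grp pres fin ord n8 n4 s_sq)
      (use s_ne1 in \<open>simp add: mod_eq_dvd_iff\<close>)
  have a: "\<not> has_m_product_one_subseq G n S" if "dicyclic_gens G n s \<alpha> \<beta>" "gcd (t1 - t2) (int n) = 1"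
    "S = replicate_mset (n - 1) (\<beta> [^] t1) + replicate_mset (n - 1) (\<beta> [^] t2) + {#\<alpha> \<otimes> \<beta> [^] t3#}"
    for \<alpha> \<beta> and t1 t2 t3 :: int
  proof
    interpret D: dicyclic_like G n s \<alpha> \<beta> by (rule gens_dicyclic_like[OF that(1)])
    assume "has_m_product_one_subseq G n S"
    then obtain T where T: "T \<subseteq># S" "size T = n" "product_one G T" unfolding has_m_product_one_subseq_def by blast
    show False
      by (rule D.two_powers_no_product_one[OF that(2) T(1)[unfolded that(3)] T(3), of 1]) (use T(2) n8 in auto)
  qed
  have b: "\<not> has_m_product_one_subseq G (2 * n) S" if "dicyclic_gens G n s \<alpha> \<beta>" "gcd (t1 - t2) (int n) = 1"
    "S = replicate_mset (2 * n - 1) (\<beta> [^] t1) + replicate_mset (n - 1) (\<beta> [^] t2) + {#\<alpha> \<otimes> \<beta> [^] t3#}"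
    for \<alpha> \<beta> and t1 t2 t3 :: int
  proof
    interpret D: dicyclic_like G n s \<alpha> \<beta> by (rule gens_dicyclic_like[OF that(1)])
    assume "has_m_product_one_subseq G (2 * n) S"
    then obtain T where T: "T \<subseteq># S" "size T = 2 * n" "product_one G T" unfolding has_m_product_one_subseq_def by blast
    show False
      by (rule D.two_powers_no_product_one[OF that(2) T(1)[unfolded that(3)] T(3), of 2]) (use T(2) n8 in auto)
  qed
  have c: "product_one_free G S" if "dicyclic_gens G n s \<alpha> \<beta>"
    "S = replicate_mset (n - 1) \<beta> + {#\<alpha> \<otimes> \<beta> [^] t#}" for \<alpha> \<beta> and t :: int
    unfolding product_one_free_def
  proof (intro allI impI notI)
    interpret D: dicyclic_like G n s \<alpha> \<beta> by (rule gens_dicyclic_like[OF that(1)])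
    fix T assume T: "T \<subseteq># S \<and> T \<noteq> {#}" and one: "product_one G T"
    \<comment> \<open>With zero copies of the second power the congruence reads \<open>n\<close>
      dividing \<open>i\<close>, where \<open>0 < i < n\<close>.\<close>
    have "S = replicate_mset (n - 1) (\<beta> [^] (1::int)) + replicate_mset 0 (\<beta> [^] (0::int)) + {#\<alpha> \<otimes> \<beta> [^] t#}"
      using that(2) by simp
    then have "T \<subseteq># replicate_mset (n - 1) (\<beta> [^] (1::int)) + replicate_mset 0 (\<beta> [^] (0::int)) + {#\<alpha> \<otimes> \<beta> [^] t#}"
      using T by simp
    then obtain i j where ij: "T = replicate_mset i (\<beta> [^] (1::int)) + replicate_mset j (\<beta> [^] (0::int))"
      "i \<le> n - 1" "j \<le> 0" "int n dvd int i * 1 + int j * 0"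
      using D.product_one_two_powers[OF _ one] by blast
    have "0 < i" using ij(1,3) T by (cases i) auto
    moreover have "n dvd i" using ij(4) by simp
    ultimately have "n \<le> i" by (intro dvd_imp_le)
    then show False using ij(2) n8 by linarith
  qed
  note forward = no_product_one_extremal[OF s_ne seq, unfolded extremal_def] no_2n_subseq_form[OF seq] product_one_free_form[OF seq]
  show ?thesis
    by (intro conjI impI iffI; (elim exE conjE)?; (rule forward | rule a | rule b | rule c); assumption)
qed

end
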